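(* The problems $\mathrm{Game}(\{0\},\{0\},\mathbb{N})$ and $\mathrm{Synthesis}(\mathrm{FO}[\sim],\{0\},\{0\},\mathbb{N})$ are undecidable.
   Context: $\mathbb{T}=\{s,e,se\}$. Synthesis: a process triple $\mathbb{P}=(\mathbb{P}_s,\mathbb{P}_e,\mathbb{P}_{se})$ of pairwise disjoint finite sets; finite alphabet $A=A_s\uplus A_e$; events $\Sigma_s=A_s\times(\mathbb{P}_s\cup\mathbb{P}_{se})$, $\Sigma_e=A_e\times(\mathbb{P}_e\cup\mathbb{P}_{se})$, $\Sigma=\Sigma_s\cup\Sigma_e$; executions $w\in\Sigma^*\cup\Sigma^\omega$. $\mathrm{FO}_A[\sim]$ has atoms $\theta(x)$ ($\theta\in\mathbb{T}$), $a(x)$ ($a\in A$), $x=y$, $x\sim y$, closed under $\neg,\vee,\exists$, evaluated over universe $\mathbb{P}\uplus\mathrm{Pos}(w)$ with $\theta$ denoting $\mathbb{P}_\theta$, $a$ the positions with action $a$, and $\sim$ the least equivalence relating a process to positions it executes and positions executed by the same process. A $\mathbb{P}$-strategy is $f:\Sigma^*\to\Sigma_s\cup\{\varepsilon\}$; $w=\sigma_1\sigma_2\dots$ is $f$-compatible if $f(\sigma_1\dots\sigma_{i-1})=\sigma_i$ whenever $\sigma_i\in\Sigma_s$; $f$-fair if finite $w$ has $f(w)=\varepsilon$ and infinite $w$ with $f$ non-$\varepsilon$ on infinitely many prefixes has infinitely many $\Sigma_s$-events. $f$ is $\mathbb{P}$-winning for $\varphi$ if every $f$-compatible $f$-fair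 $w$ satisfies $(\mathbb{P},w)\models\varphi$. $\mathrm{Win}(\varphi)$ is the set of $(k_s,k_e,k_{se})$ such that some $\mathbb{P}$ with $|\mathbb{P}_\theta|=k_\theta$ admits a $\mathbb{P}$-winning strategy. $\mathrm{Synthesis}(\mathrm{FO}[\sim],N_s,N_e,N_{se})$: given $A$ and a sentence $\varphi\in\mathrm{FO}_A[\sim]$, decide whether $\mathrm{Win}(\varphi)\cap(N_s\times N_e\times N_{se})\ne\emptyset$. Games: $\mathcal{G}=(A,B,\mathcal{F})$ with $B\in\mathbb{N}$, locations $L=\{0,\dots,B\}^A$, finite $\mathcal{F}\subseteq\mathfrak{C}^L$ where $\mathfrak{C}$ consists of triples $(\bowtie_s n_s,\bowtie_e n_e,\bowtie_{se}n_{se})$, $\bowtie\in\{=,\ge\}$, $n\in\mathbb{N}$. $\ell_0$ is all-zero; $(\ell+a)(a)=\min\{\ell(a)+1,B\}$, other coordinates unchanged, extended to words. Configurations $C:L\to\mathbb{N}^{\mathbb{T}}$. System (resp. environment) transitions $\tau:L\times L\to\mathbb{N}\times\{0\}\times\mathbb{N}$ (resp. $\{0\}\times\mathbb{N}\times\mathbb{N}$) with nonzero $\tau(\ell,\ell')$ only if $\ell'=\ell+w$, $w\in A_s^*$ (resp. $A_e^*$); applicable at $C$ if $\sum_{\ell'}\tau(\ell,\ell')\le C(\ell)$ for all $\ell$, giving $\tau(C)(\ell)=C(\ell)-\sum_{\ell'}\tau(\ell,\ell')+\sum_{\ell'}\tau(\ell',\ell)$. $C\models\mathcal{F}$ if some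 $\kappa\in\mathcal{F}$ is satisfied componentwise at every location. $C$-plays $C_0\tau_1C_1\dots\tau_nC_n$ start at $C$, alternate system moves (odd $i$, $C_i\models\mathcal{F}$) and environment moves (even $i$, $C_i\not\models\mathcal{F}$). A $C$-strategy is a partial map from $C$-plays to system transitions, defined on $C$, giving applicable transitions leading to configurations satisfying $\mathcal{F}$; it is winning if every play following it on odd moves and not a strict prefix of such a play ends in a configuration satisfying $\mathcal{F}$. $C_{\vec k}$ puts $\vec k$ on $\ell_0$ and $(0,0,0)$ elsewhere; $\mathrm{Win}(\mathcal{G})=\{\vec k\mid C_{\vec k}$ has a winning strategy$\}$. $\mathrm{Game}(N_s,N_e,N_{se})$: given $\mathcal{G}$, decide whether $\mathrm{Win}(\mathcal{G})\cap(N_s\times N_e\times N_{se})\ne\emptyset$. *)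

theory Defs
  imports Complex_Main "HOL-Library.Nat_Bijection" "HOL-Library.FuncSet" "HOL-Library.Sublist"
begin

text \<open>
  Kleene's partial recursive functions. Arities are not tracked: a term is evaluated on an
  argument list and simply has no value where the list is too short.
\<close>

datatype recf =
    Zero
  | Succ
  | Proj nat
  | Comp recf "recf list"
  | PrimRec recf recf
  | Mu recf

inductive computes :: "recf \<Rightarrow> nat list \<Rightarrow> nat \<Rightarrow> bool" where
  computes_Zero: "computes Zero xs 0"
| computes_Succ: "computes Succ (x # xs) (Suc x)"
| computes_Proj: "i < length xs \<Longrightarrow> computes (Proj i) xs (xs ! i)"
| computes_Comp: "\<lbrakk>length ys = length gs; \<forall>i<length gs. computes (gs ! i) xs (ys ! i); computes f ys z\<rbrakk>
    \<Longrightarrow> computes (Comp f gs) xs z"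
| computes_PrimRec_0: "computes f xs y \<Longrightarrow> computes (PrimRec f g) (0 # xs) y"
| computes_PrimRec_Suc: "\<lbrakk>computes (PrimRec f g) (n # xs) r; computes g (n # r # xs) y\<rbrakk>
    \<Longrightarrow> computes (PrimRec f g) (Suc n # xs) y"
| computes_Mu: "\<lbrakk>computes f (n # xs) 0; \<forall>m<n. \<exists>y>0. computes f (m # xs) y\<rbrakk>
    \<Longrightarrow> computes (Mu f) xs n"

inductive_cases computes_ZeroE: "computes Zero xs y"
inductive_cases computes_SuccE: "computes Succ xs y"
inductive_cases computes_ProjE: "computes (Proj i) xs y"
inductive_cases computes_CompE: "computes (Comp f gs) xs y"
inductive_cases computes_PrimRec_0E: "computes (PrimRec f g) (0 # xs) y"
inductive_cases computes_PrimRec_SucE: "computes (PrimRec f g) (Suc n # xs) y"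
inductive_cases computes_MuE: "computes (Mu f) xs y"

lemma computes_deterministic: "computes f xs y \<Longrightarrow> computes f xs z \<Longrightarrow> y = z"
proof (induction arbitrary: z rule: computes.induct)
  case (computes_Comp ys gs xs f y)
  from computes_Comp.prems obtain ys' where ys': "length ys' = length gs"
    "\<forall>i<length gs. computes (gs ! i) xs (ys' ! i)" and z: "computes f ys' z"
    by (rule computes_CompE) blast
  have "ys = ys'"
    by (rule nth_equalityI) (use computes_Comp.hyps computes_Comp.IH(1) ys' in simp_all)
  with z computes_Comp.IH(2) show ?case by simp
next
  case (computes_PrimRec_Suc f g n xs r y)
  from computes_PrimRec_Suc.prems obtain r' where
    "computes (PrimRec f g) (n # xs) r'" and z: "computes g (n # r' # xs) z"
    by (rule computes_PrimRec_SucE)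
  then have "r = r'" using computes_PrimRec_Suc.IH(1) by simp
  with z computes_PrimRec_Suc.IH(2) show ?case by simp
next
  case (computes_Mu f n xs)
  from computes_Mu.prems have z: "computes f (z # xs) 0" "\<forall>m<z. \<exists>y>0. computes f (m # xs) y"
    by (auto elim!: computes_MuE)
  have "\<not> z < n" using z(1) computes_Mu.IH(2) by fastforce
  moreover have "\<not> n < z" using z(2) computes_Mu.IH(1) by fastforce
  ultimately show ?case by simp
next
  case (computes_PrimRec_0 f xs y g)
  from computes_PrimRec_0.prems have "computes f xs z" by (rule computes_PrimRec_0E)
  then show ?case by (rule computes_PrimRec_0.IH)
qed (auto elim!: computes_ZeroE computes_SuccE computes_ProjE)

text \<open>
  A decision problem has instances \<open>I\<close>, coded as natural numbers by \<open>enc\<close> (which must be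
  injective on \<open>I\<close>), and positive instances \<open>Y\<close>. Nothing is required of the algorithm on numbers
  that are not codes of instances.
\<close>

definition decidable :: "('i \<Rightarrow> nat) \<Rightarrow> 'i set \<Rightarrow> 'i set \<Rightarrow> bool" where
  "decidable enc I Y \<longleftrightarrow> (\<exists>f. \<forall>x\<in>I. computes f [enc x] (if x \<in> Y then 1 else 0))"

datatype ptype = Sys | Env | Shared

fun ptriple :: "nat \<times> nat \<times> nat \<Rightarrow> ptype \<Rightarrow> nat" where
  "ptriple (ks, ke, kse) Sys = ks"
| "ptriple (ks, ke, kse) Env = ke"
| "ptriple (ks, ke, kse) Shared = kse"

definition process_triple :: "(ptype \<Rightarrow> 'p set) \<Rightarrow> bool" where
  "process_triple P \<longleftrightarrow> (\<forall>\<theta>. finite (P \<theta>)) \<and> (\<forall>\<theta> \<theta>'. \<theta> \<noteq> \<theta>' \<longrightarrow> P \<theta> \<inter> P \<theta>' = {})"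

definition sys_events :: "'a set \<Rightarrow> (ptype \<Rightarrow> 'p set) \<Rightarrow> ('a \<times> 'p) set" where
  "sys_events As P = As \<times> (P Sys \<union> P Shared)"

definition env_events :: "'a set \<Rightarrow> (ptype \<Rightarrow> 'p set) \<Rightarrow> ('a \<times> 'p) set" where
  "env_events Ae P = Ae \<times> (P Env \<union> P Shared)"

definition events :: "'a set \<Rightarrow> 'a set \<Rightarrow> (ptype \<Rightarrow> 'p set) \<Rightarrow> ('a \<times> 'p) set" where
  "events As Ae P = sys_events As P \<union> env_events Ae P"

text \<open>Positions are numbered from 0, so \<open>word_prefix w i\<close> is what precedes position \<open>i\<close>.\<close>

datatype 'e word = Fin "'e list" | Inf "nat \<Rightarrow> 'e"

fun pos :: "'e word \<Rightarrow> nat set" where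
  "pos (Fin u) = {..<length u}"
| "pos (Inf g) = UNIV"

fun letter :: "'e word \<Rightarrow> nat \<Rightarrow> 'e" where
  "letter (Fin u) i = u ! i"
| "letter (Inf g) i = g i"

definition word_prefix :: "'e word \<Rightarrow> nat \<Rightarrow> 'e list" where
  "word_prefix w n = map (letter w) [0..<n]"

definition executions :: "'a set \<Rightarrow> 'a set \<Rightarrow> (ptype \<Rightarrow> 'p set) \<Rightarrow> ('a \<times> 'p) word set" where
  "executions As Ae P = {w. \<forall>i\<in>pos w. letter w i \<in> events As Ae P}"

datatype 'a fo =
    FType ptype nat
  | FAct 'a nat
  | FEq nat nat
  | FSim nat nat
  | FNeg "'a fo"
  | FOr "'a fo" "'a fo"
  | FEx nat "'a fo"

fun free_vars :: "'a fo \<Rightarrow> nat set" where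
  "free_vars (FType \<theta> x) = {x}"
| "free_vars (FAct a x) = {x}"
| "free_vars (FEq x y) = {x, y}"
| "free_vars (FSim x y) = {x, y}"
| "free_vars (FNeg \<phi>) = free_vars \<phi>"
| "free_vars (FOr \<phi> \<psi>) = free_vars \<phi> \<union> free_vars \<psi>"
| "free_vars (FEx x \<phi>) = free_vars \<phi> - {x}"

definition sentence :: "'a set \<Rightarrow> 'a fo \<Rightarrow> bool" where
  "sentence A \<phi> \<longleftrightarrow> set_fo \<phi> \<subseteq> A \<and> free_vars \<phi> = {}"

definition universe :: "(ptype \<Rightarrow> 'p set) \<Rightarrow> ('a \<times> 'p) word \<Rightarrow> ('p + nat) set" where
  "universe P w = (\<Union>\<theta>. P \<theta>) <+> pos w"

definition same_process :: "(ptype \<Rightarrow> 'p set) \<Rightarrow> ('a \<times> 'p) word \<Rightarrow> (('p + nat) \<times> ('p + nat)) set" where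
  "same_process P w = \<Inter> {R. equiv (universe P w) R \<and>
     (\<forall>i\<in>pos w. (Inl (snd (letter w i)), Inr i) \<in> R) \<and>
     (\<forall>i\<in>pos w. \<forall>j\<in>pos w. snd (letter w i) = snd (letter w j) \<longrightarrow> (Inr i, Inr j) \<in> R)}"

fun sat :: "(ptype \<Rightarrow> 'p set) \<Rightarrow> ('a \<times> 'p) word \<Rightarrow> (nat \<Rightarrow> 'p + nat) \<Rightarrow> 'a fo \<Rightarrow> bool" where
  "sat P w \<nu> (FType \<theta> x) \<longleftrightarrow> \<nu> x \<in> Inl ` P \<theta>"
| "sat P w \<nu> (FAct a x) \<longleftrightarrow> \<nu> x \<in> Inr ` {i \<in> pos w. fst (letter w i) = a}"
| "sat P w \<nu> (FEq x y) \<longleftrightarrow> \<nu> x = \<nu> y"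
| "sat P w \<nu> (FSim x y) \<longleftrightarrow> (\<nu> x, \<nu> y) \<in> same_process P w"
| "sat P w \<nu> (FNeg \<phi>) \<longleftrightarrow> \<not> sat P w \<nu> \<phi>"
| "sat P w \<nu> (FOr \<phi> \<psi>) \<longleftrightarrow> sat P w \<nu> \<phi> \<or> sat P w \<nu> \<psi>"
| "sat P w \<nu> (FEx x \<phi>) \<longleftrightarrow> (\<exists>u\<in>universe P w. sat P w (\<nu>(x := u)) \<phi>)"

text \<open>
  For sentences the assignment is irrelevant; it need not take values in the universe, which may
  be empty.
\<close>

definition models :: "(ptype \<Rightarrow> 'p set) \<Rightarrow> ('a \<times> 'p) word \<Rightarrow> 'a fo \<Rightarrow> bool" where
  "models P w \<phi> \<longleftrightarrow> (\<forall>\<nu>. sat P w \<nu> \<phi>)"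

text \<open>\<open>None\<close> is the strategy's answer \<open>\<epsilon>\<close>.\<close>

definition synth_strategy ::
  "'a set \<Rightarrow> 'a set \<Rightarrow> (ptype \<Rightarrow> 'p set) \<Rightarrow> (('a \<times> 'p) list \<Rightarrow> ('a \<times> 'p) option) \<Rightarrow> bool" where
  "synth_strategy As Ae P f \<longleftrightarrow>
     (\<forall>u\<in>lists (events As Ae P). f u \<in> insert None (Some ` sys_events As P))"

definition compatible ::
  "'a set \<Rightarrow> (ptype \<Rightarrow> 'p set) \<Rightarrow> (('a \<times> 'p) list \<Rightarrow> ('a \<times> 'p) option) \<Rightarrow> ('a \<times> 'p) word \<Rightarrow> bool" where
  "compatible As P f w \<longleftrightarrow>
     (\<forall>i\<in>pos w. letter w i \<in> sys_events As P \<longrightarrow> f (word_prefix w i) = Some (letter w i))"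

fun fair ::
  "'a set \<Rightarrow> (ptype \<Rightarrow> 'p set) \<Rightarrow> (('a \<times> 'p) list \<Rightarrow> ('a \<times> 'p) option) \<Rightarrow> ('a \<times> 'p) word \<Rightarrow> bool" where
  "fair As P f (Fin u) \<longleftrightarrow> f u = None"
| "fair As P f (Inf g) \<longleftrightarrow>
     (infinite {n. f (word_prefix (Inf g) n) \<noteq> None} \<longrightarrow> infinite {n. g n \<in> sys_events As P})"

definition synth_winning ::
  "'a set \<Rightarrow> 'a set \<Rightarrow> (ptype \<Rightarrow> 'p set) \<Rightarrow> 'a fo \<Rightarrow> (('a \<times> 'p) list \<Rightarrow> ('a \<times> 'p) option) \<Rightarrow> bool" where
  "synth_winning As Ae P \<phi> f \<longleftrightarrow>
     (\<forall>w\<in>executions As Ae P. compatible As P f w \<and> fair As P f w \<longrightarrow> models P w \<phi>)"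

text \<open>
  Processes are drawn from the natural numbers, which provide sets of every finite cardinality.
\<close>

definition synth_win :: "'a set \<Rightarrow> 'a set \<Rightarrow> 'a fo \<Rightarrow> (nat \<times> nat \<times> nat) set" where
  "synth_win As Ae \<phi> = {k. \<exists>P :: ptype \<Rightarrow> nat set.
     process_triple P \<and> (\<forall>\<theta>. card (P \<theta>) = ptriple k \<theta>) \<and>
     (\<exists>f. synth_strategy As Ae P f \<and> synth_winning As Ae P \<phi> f)}"

text \<open>
  A condition \<open>(\<bowtie>, n)\<close> constrains a number of processes; the elements of the acceptance
  component are functions from locations to triples of conditions.
\<close>

datatype cmp = CEq | CGe

fun satisfies :: "nat \<Rightarrow> cmp \<times> nat \<Rightarrow> bool" where
  "satisfies m (CEq, n) \<longleftrightarrow> m = n"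
| "satisfies m (CGe, n) \<longleftrightarrow> m \<ge> n"

record 'a game =
  sys_acts :: "'a set"
  env_acts :: "'a set"
  bound :: nat
  acceptance :: "(('a \<Rightarrow> nat) \<Rightarrow> ptype \<Rightarrow> cmp \<times> nat) set"

abbreviation acts :: "'a game \<Rightarrow> 'a set" where
  "acts G \<equiv> sys_acts G \<union> env_acts G"

definition locations :: "'a game \<Rightarrow> ('a \<Rightarrow> nat) set" where
  "locations G = acts G \<rightarrow>\<^sub>E {0..bound G}"

definition is_game :: "'a game \<Rightarrow> bool" where
  "is_game G \<longleftrightarrow> finite (sys_acts G) \<and> finite (env_acts G) \<and> sys_acts G \<inter> env_acts G = {} \<and>
     finite (acceptance G) \<and> acceptance G \<subseteq> locations G \<rightarrow>\<^sub>E UNIV"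

definition init_loc :: "'a game \<Rightarrow> 'a \<Rightarrow> nat" where
  "init_loc G = (\<lambda>a\<in>acts G. 0)"

definition step_loc :: "'a game \<Rightarrow> ('a \<Rightarrow> nat) \<Rightarrow> 'a \<Rightarrow> ('a \<Rightarrow> nat)" where
  "step_loc G l a = l(a := min (l a + 1) (bound G))"

definition steps_loc :: "'a game \<Rightarrow> ('a \<Rightarrow> nat) \<Rightarrow> 'a list \<Rightarrow> ('a \<Rightarrow> nat)" where
  "steps_loc G l w = foldl (step_loc G) l w"

text \<open>
  Configurations and transitions are functions on locations, extended by 0 to all functions
  \<open>'a \<Rightarrow> nat\<close>.
\<close>

type_synonym 'a config = "('a \<Rightarrow> nat) \<Rightarrow> ptype \<Rightarrow> nat"
type_synonym 'a trans = "('a \<Rightarrow> nat) \<Rightarrow> ('a \<Rightarrow> nat) \<Rightarrow> ptype \<Rightarrow> nat"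

definition init_config :: "'a game \<Rightarrow> nat \<times> nat \<times> nat \<Rightarrow> 'a config" where
  "init_config G k l \<theta> = (if l = init_loc G then ptriple k \<theta> else 0)"

definition transitions :: "'a game \<Rightarrow> 'a set \<Rightarrow> ptype \<Rightarrow> 'a trans set" where
  "transitions G X \<theta>0 = {\<tau>. (\<forall>l l'. \<tau> l l' \<theta>0 = 0) \<and>
     (\<forall>l l' \<theta>. \<tau> l l' \<theta> \<noteq> 0 \<longrightarrow>
        l \<in> locations G \<and> l' \<in> locations G \<and> (\<exists>w\<in>lists X. l' = steps_loc G l w))}"

definition sys_transitions :: "'a game \<Rightarrow> 'a trans set" where
  "sys_transitions G = transitions G (sys_acts G) Env"

definition env_transitions :: "'a game \<Rightarrow> 'a trans set" where
  "env_transitions G = transitions G (env_acts G) Sys"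

definition applicable :: "'a game \<Rightarrow> 'a trans \<Rightarrow> 'a config \<Rightarrow> bool" where
  "applicable G \<tau> C \<longleftrightarrow> (\<forall>l\<in>locations G. \<forall>\<theta>. (\<Sum>l'\<in>locations G. \<tau> l l' \<theta>) \<le> C l \<theta>)"

definition apply_trans :: "'a game \<Rightarrow> 'a trans \<Rightarrow> 'a config \<Rightarrow> 'a config" where
  "apply_trans G \<tau> C l \<theta> =
     C l \<theta> - (\<Sum>l'\<in>locations G. \<tau> l l' \<theta>) + (\<Sum>l'\<in>locations G. \<tau> l' l \<theta>)"

definition accepting :: "'a game \<Rightarrow> 'a config \<Rightarrow> bool" where
  "accepting G C \<longleftrightarrow> (\<exists>\<kappa>\<in>acceptance G. \<forall>l\<in>locations G. \<forall>\<theta>. satisfies (C l \<theta>) (\<kappa> l \<theta>))"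

text \<open>
  A play \<open>C\<^sub>0 \<tau>\<^sub>1 C\<^sub>1 \<dots> \<tau>\<^sub>n C\<^sub>n\<close> from \<open>C\<^sub>0 = C\<close> is represented by the list of the pairs
  \<open>(\<tau>\<^sub>i, C\<^sub>i)\<close>, so the play \<open>C\<close> itself is the empty list.
\<close>

type_synonym 'a play = "('a trans \<times> 'a config) list"

definition play_trans :: "'a play \<Rightarrow> nat \<Rightarrow> 'a trans" where
  "play_trans \<pi> i = fst (\<pi> ! (i - 1))"

definition play_config :: "'a config \<Rightarrow> 'a play \<Rightarrow> nat \<Rightarrow> 'a config" where
  "play_config C \<pi> i = (C # map snd \<pi>) ! i"

definition plays :: "'a game \<Rightarrow> 'a config \<Rightarrow> 'a play set" where
  "plays G C = {\<pi>. \<forall>i\<in>{1..length \<pi>}.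
     applicable G (play_trans \<pi> i) (play_config C \<pi> (i - 1)) \<and>
     play_config C \<pi> i = apply_trans G (play_trans \<pi> i) (play_config C \<pi> (i - 1)) \<and>
     (if odd i then play_trans \<pi> i \<in> sys_transitions G \<and> accepting G (play_config C \<pi> i)
      else play_trans \<pi> i \<in> env_transitions G \<and> \<not> accepting G (play_config C \<pi> i))}"

definition game_strategy :: "'a game \<Rightarrow> 'a config \<Rightarrow> ('a play \<Rightarrow> 'a trans option) \<Rightarrow> bool" where
  "game_strategy G C f \<longleftrightarrow> f [] \<noteq> None \<and>
     (\<forall>\<pi>\<in>plays G C. \<forall>\<tau>. f \<pi> = Some \<tau> \<longrightarrow>
        \<tau> \<in> sys_transitions G \<and>
        applicable G \<tau> (play_config C \<pi> (length \<pi>)) \<and>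
        accepting G (apply_trans G \<tau> (play_config C \<pi> (length \<pi>))))"

definition follows :: "('a play \<Rightarrow> 'a trans option) \<Rightarrow> 'a play \<Rightarrow> bool" where
  "follows f \<pi> \<longleftrightarrow>
     (\<forall>i\<in>{1..length \<pi>}. odd i \<longrightarrow> f (take (i - 1) \<pi>) = Some (play_trans \<pi> i))"

definition game_winning :: "'a game \<Rightarrow> 'a config \<Rightarrow> ('a play \<Rightarrow> 'a trans option) \<Rightarrow> bool" where
  "game_winning G C f \<longleftrightarrow>
     (\<forall>\<pi>\<in>plays G C.
        follows f \<pi> \<and> \<not> (\<exists>\<pi>'\<in>plays G C. follows f \<pi>' \<and> strict_prefix \<pi> \<pi>') \<longrightarrow>
        accepting G (play_config C \<pi> (length \<pi>)))"

definition game_win :: "'a game \<Rightarrow> (nat \<times> nat \<times> nat) set" where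
  "game_win G = {k. \<exists>f. game_strategy G (init_config G k) f \<and> game_winning G (init_config G k) f}"

text \<open>
  In instances, action names are natural numbers. Finite sets are coded by \<open>set_encode\<close> and
  functions on a finite domain by their graphs.
\<close>

definition graph_code :: "('x \<Rightarrow> nat) \<Rightarrow> ('y \<Rightarrow> nat) \<Rightarrow> 'x set \<Rightarrow> ('x \<Rightarrow> 'y) \<Rightarrow> nat" where
  "graph_code cx cy X g = set_encode ((\<lambda>x. prod_encode (cx x, cy (g x))) ` X)"

fun cond_code :: "cmp \<times> nat \<Rightarrow> nat" where
  "cond_code (CEq, n) = prod_encode (0, n)"
| "cond_code (CGe, n) = prod_encode (1, n)"

definition cond_triple_code :: "(ptype \<Rightarrow> cmp \<times> nat) \<Rightarrow> nat" where
  "cond_triple_code c = list_encode [cond_code (c Sys), cond_code (c Env), cond_code (c Shared)]"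

definition loc_code :: "nat game \<Rightarrow> (nat \<Rightarrow> nat) \<Rightarrow> nat" where
  "loc_code G l = graph_code id id (acts G) l"

definition game_code :: "nat game \<Rightarrow> nat" where
  "game_code G = list_encode [set_encode (sys_acts G), set_encode (env_acts G), bound G,
     set_encode (graph_code (loc_code G) cond_triple_code (locations G) ` acceptance G)]"

definition game_instances :: "nat game set" where
  "game_instances = {G. is_game G}"

definition game_problem :: "nat set \<Rightarrow> nat set \<Rightarrow> nat set \<Rightarrow> nat game set" where
  "game_problem Ns Ne Nse = {G \<in> game_instances. game_win G \<inter> (Ns \<times> Ne \<times> Nse) \<noteq> {}}"

fun ptype_code :: "ptype \<Rightarrow> nat" where
  "ptype_code Sys = 0"
| "ptype_code Env = 1"
| "ptype_code Shared = 2"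

fun fo_code :: "nat fo \<Rightarrow> nat" where
  "fo_code (FType \<theta> x) = list_encode [0, ptype_code \<theta>, x]"
| "fo_code (FAct a x) = list_encode [1, a, x]"
| "fo_code (FEq x y) = list_encode [2, x, y]"
| "fo_code (FSim x y) = list_encode [3, x, y]"
| "fo_code (FNeg \<phi>) = list_encode [4, fo_code \<phi>]"
| "fo_code (FOr \<phi> \<psi>) = list_encode [5, fo_code \<phi>, fo_code \<psi>]"
| "fo_code (FEx x \<phi>) = list_encode [6, x, fo_code \<phi>]"

fun synthesis_code :: "nat set \<times> nat set \<times> nat fo \<Rightarrow> nat" where
  "synthesis_code (As, Ae, \<phi>) = list_encode [set_encode As, set_encode Ae, fo_code \<phi>]"

definition synthesis_instances :: "(nat set \<times> nat set \<times> nat fo) set" where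
  "synthesis_instances =
     {(As, Ae, \<phi>). finite As \<and> finite Ae \<and> As \<inter> Ae = {} \<and> sentence (As \<union> Ae) \<phi>}"

definition synthesis_problem ::
  "nat set \<Rightarrow> nat set \<Rightarrow> nat set \<Rightarrow> (nat set \<times> nat set \<times> nat fo) set" where
  "synthesis_problem Ns Ne Nse =
     {(As, Ae, \<phi>) \<in> synthesis_instances. synth_win As Ae \<phi> \<inter> (Ns \<times> Ne \<times> Nse) \<noteq> {}}"

lemma graph_code_inj:
  assumes fin: "finite X" and cx: "inj_on cx X" and cy: "inj cy"
  shows "inj_on (graph_code cx cy X) (X \<rightarrow>\<^sub>E Y)"
proof (rule inj_onI)
  fix g h assume g: "g \<in> X \<rightarrow>\<^sub>E Y" and h: "h \<in> X \<rightarrow>\<^sub>E Y"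
    and eq: "graph_code cx cy X g = graph_code cx cy X h"
  have im: "(\<lambda>x. prod_encode (cx x, cy (g x))) ` X = (\<lambda>x. prod_encode (cx x, cy (h x))) ` X"
    using eq fin by (simp add: graph_code_def set_encode_eq)
  show "g = h"
  proof (rule PiE_ext[OF g h])
    fix x assume x: "x \<in> X"
    then have "prod_encode (cx x, cy (g x)) \<in> (\<lambda>x. prod_encode (cx x, cy (h x))) ` X"
      using im by blast
    then obtain y where "y \<in> X" "cx x = cx y" "cy (g x) = cy (h y)"
      by (auto simp: prod_encode_eq)
    then show "g x = h x" using x cx cy by (auto dest: inj_onD injD)
  qed
qed

lemma cond_code_inj: "inj cond_code"
proof (rule injI)
  show "x = y" if "cond_code x = cond_code y" for x y
    using that by (cases x rule: cond_code.cases; cases y rule: cond_code.cases)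
      (auto simp: prod_encode_eq)
qed

lemma cond_triple_code_inj: "inj cond_triple_code"
proof (rule injI, rule ext)
  show "c \<theta> = d \<theta>" if "cond_triple_code c = cond_triple_code d" for c d \<theta>
    using that by (cases \<theta>) (auto simp: cond_triple_code_def list_encode_eq
      inj_eq[OF cond_code_inj] simp del: list_encode.simps)
qed

lemma finite_locations: "is_game G \<Longrightarrow> finite (locations G)"
  by (auto simp: is_game_def locations_def intro: finite_PiE)

lemma loc_code_inj: "is_game G \<Longrightarrow> inj_on (loc_code G) (locations G)"
  using graph_code_inj[of "acts G" id id] unfolding locations_def loc_code_def[abs_def]
  by (auto simp: is_game_def)

lemma game_code_inj: "inj_on game_code game_instances"
proof (rule inj_onI)
  fix G H assume G: "G \<in> game_instances" and H: "H \<in> game_instances"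
    and eq: "game_code G = game_code H"
  have wf: "is_game G" "is_game H" using G H by (auto simp: game_instances_def)
  have eqs: "sys_acts G = sys_acts H" "env_acts G = env_acts H" "bound G = bound H"
    and acc: "graph_code (loc_code G) cond_triple_code (locations G) ` acceptance G =
      graph_code (loc_code H) cond_triple_code (locations H) ` acceptance H"
    using eq wf
    by (auto simp: game_code_def list_encode_eq set_encode_eq is_game_def
        simp del: list_encode.simps)
  have same: "locations H = locations G" "loc_code H = loc_code G"
    using eqs by (auto simp: locations_def loc_code_def[abs_def])
  have "inj_on (graph_code (loc_code G) cond_triple_code (locations G)) (locations G \<rightarrow>\<^sub>E UNIV)"
    by (intro graph_code_inj finite_locations loc_code_inj cond_triple_code_inj wf)
  moreover have "acceptance G \<subseteq> locations G \<rightarrow>\<^sub>E UNIV" "acceptance H \<subseteq> locations G \<rightarrow>\<^sub>E UNIV"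
    using wf same by (auto simp: is_game_def)
  ultimately have "acceptance G = acceptance H"
    using acc unfolding same by (simp add: inj_on_image_eq_iff)
  then show "G = H" using eqs by simp
qed

lemma ptype_code_inj: "ptype_code \<theta> = ptype_code \<theta>' \<Longrightarrow> \<theta> = \<theta>'"
  by (cases \<theta>; cases \<theta>') auto

lemma fo_code_inj: "fo_code \<phi> = fo_code \<psi> \<Longrightarrow> \<phi> = \<psi>"
proof (induction \<phi> arbitrary: \<psi>)
  case (FType \<theta> x)
  then show ?case
    by (cases \<psi>) (auto simp: list_encode_eq simp del: list_encode.simps dest: ptype_code_inj)
next
  case (FAct a x)
  then show ?case by (cases \<psi>) (simp_all add: list_encode_eq del: list_encode.simps)
next
  case (FEq x y)
  then show ?case by (cases \<psi>) (simp_all add: list_encode_eq del: list_encode.simps)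
next
  case (FSim x y)
  then show ?case by (cases \<psi>) (simp_all add: list_encode_eq del: list_encode.simps)
next
  case (FNeg \<phi>)
  from FNeg.prems show ?case
    by (cases \<psi>) (auto simp: list_encode_eq simp del: list_encode.simps intro: FNeg.IH)
next
  case (FOr \<phi>1 \<phi>2)
  from FOr.prems show ?case
    by (cases \<psi>) (auto simp: list_encode_eq simp del: list_encode.simps intro: FOr.IH)
next
  case (FEx x \<phi>)
  from FEx.prems show ?case
    by (cases \<psi>) (auto simp: list_encode_eq simp del: list_encode.simps intro: FEx.IH)
qed

lemma synthesis_code_inj: "inj_on synthesis_code synthesis_instances"
  by (rule inj_onI)
    (auto simp: synthesis_instances_def list_encode_eq set_encode_eq
      simp del: list_encode.simps dest: fo_code_inj)

end

theory Submission
  imports Defs "HOL-Computational_Algebra.Primes" "HOL-Library.Infinite_Set"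
begin

text \<open>
  Only shared processes occur, and their number is chosen freely, so it can bound the length of a
  computation. A process is a token whose state is the set of system actions it has performed. Every
  system action \<open>s\<close> has a matching environment action that acknowledges it, and the winning
  condition is such that an unsolicited acknowledgement loses for the environment at once, while
  after a system move exactly one process may wait for an acknowledgement, whose arrival makes the
  condition false again. The environment is thus forced to acknowledge, and the game (or the
  specification) becomes a solitaire in which the system moves one token at a time, subject to tests
  for exact numbers of tokens in given states. A register machine is simulated by keeping the value of
  a register as the number of tokens in one state; tests for zero are tests for the number 0.

  The machine is fixed. It accepts the set of all \<open>x\<close> such that the program with code \<open>x\<close> halts on
  \<open>x\<close>, and its input enters the instance in a single test, that the first register contains
  exactly \<open>x\<close>. So the code of the instance is an explicit recursive function of \<open>x\<close>.
\<close>

section \<open>Total recursive functions\<close>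

text \<open>What shapes the simulation is irreversibility: a process never loses an action. A
  decrement cannot return a token to the pool, so it parks the token in \<open>LGone\<close>, and
  every machine step spends fresh tokens from \<open>LFree\<close>. This costs nothing, because the
  number of tokens is existentially quantified, and it bounds the length of every token run, which
  is what turns a winning strategy back into a finite run.

  The other obstacle is that only one token moves at a time, so a register and the control state
  cannot change together. A handshake between an edge token and a register token links the two
  changes, and the exact counts that every rule demands on control locations keep two handshakes
  from overlapping.

  In synthesis the environment may act at any moment and executions may be infinite. The
  specification therefore depends only on the set of events that have occurred. There are finitely
  many events, so this set is complete after a finite prefix, and infinite executions reduce to
  finite ones.\<close>

definition total_rec :: "nat \<Rightarrow> (nat list \<Rightarrow> nat) \<Rightarrow> bool" where
  "total_rec n F \<longleftrightarrow> (\<exists>f. \<forall>xs. length xs = n \<longrightarrow> computes f xs (F xs))"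

lemma total_rec_cong:
  "total_rec n F \<Longrightarrow> (\<And>xs. length xs = n \<Longrightarrow> F xs = G xs) \<Longrightarrow> total_rec n G"
  unfolding total_rec_def by metis

lemma total_rec_nth: "i < n \<Longrightarrow> total_rec n (\<lambda>xs. xs ! i)"
  unfolding total_rec_def by (metis computes_Proj)

lemma total_rec_comp:
  assumes F: "total_rec m F" and len: "length Gs = m" and Gs: "\<forall>G\<in>set Gs. total_rec n G"
  shows "total_rec n (\<lambda>xs. F (map (\<lambda>G. G xs) Gs))"
proof -
  obtain f where f: "\<And>xs. length xs = m \<Longrightarrow> computes f xs (F xs)"
    using F unfolding total_rec_def by blast
  obtain r where r: "\<And>G xs. G \<in> set Gs \<Longrightarrow> length xs = n \<Longrightarrow> computes (r G) xs (G xs)"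
    using Gs unfolding total_rec_def by metis
  have "computes (Comp f (map r Gs)) xs (F (map (\<lambda>G. G xs) Gs))" if "length xs = n" for xs
    by (rule computes_Comp[where ys = "map (\<lambda>G. G xs) Gs"]) (use f r len that in simp_all)
  then show ?thesis unfolding total_rec_def by blast
qed

lemma total_rec_comp1:
  "total_rec (Suc 0) (\<lambda>xs. g (xs ! 0)) \<Longrightarrow> total_rec n F \<Longrightarrow> total_rec n (\<lambda>xs. g (F xs))"
  using total_rec_comp[of "Suc 0" "\<lambda>xs. g (xs ! 0)" "[F]" n] by simp

lemma total_rec_comp2:
  "total_rec 2 (\<lambda>xs. g (xs ! 0) (xs ! 1)) \<Longrightarrow> total_rec n F \<Longrightarrow> total_rec n G
    \<Longrightarrow> total_rec n (\<lambda>xs. g (F xs) (G xs))"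
  using total_rec_comp[of 2 "\<lambda>xs. g (xs ! 0) (xs ! 1)" "[F, G]" n] by simp

lemma total_rec_Suc: "total_rec n F \<Longrightarrow> total_rec n (\<lambda>xs. Suc (F xs))"
proof (rule total_rec_comp1[of Suc])
  have "computes Succ xs (Suc (xs ! 0))" if "length xs = Suc 0" for xs
    using that computes_Succ by (cases xs) auto
  then show "total_rec (Suc 0) (\<lambda>xs. Suc (xs ! 0))" unfolding total_rec_def by blast
qed

lemma total_rec_const: "total_rec n (\<lambda>xs. c)"
proof (induction c)
  case 0
  then show ?case unfolding total_rec_def using computes_Zero by blast
next
  case (Suc c)
  then show ?case by (rule total_rec_Suc)
qed

lemma total_rec_primrec:
  assumes A: "total_rec n A" and G: "total_rec (n + 2) G"
    and F0: "\<And>xs. length xs = n \<Longrightarrow> F (0 # xs) = A xs"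
    and FS: "\<And>k xs. length xs = n \<Longrightarrow> F (Suc k # xs) = G (k # F (k # xs) # xs)"
  shows "total_rec (Suc n) F"
proof -
  obtain a where a: "\<And>xs. length xs = n \<Longrightarrow> computes a xs (A xs)"
    using A unfolding total_rec_def by blast
  obtain g where g: "\<And>xs. length xs = n + 2 \<Longrightarrow> computes g xs (G xs)"
    using G unfolding total_rec_def by blast
  have "computes (PrimRec a g) (k # xs) (F (k # xs))" if "length xs = n" for k xs
  proof (induction k)
    case 0
    show ?case using F0 a that by (simp add: computes_PrimRec_0)
  next
    case (Suc k)
    show ?case unfolding FS[OF that] by (rule computes_PrimRec_Suc[OF Suc g]) (use that in simp)
  qed
  then have "\<forall>xs. length xs = Suc n \<longrightarrow> computes (PrimRec a g) xs (F xs)"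
    by (metis length_Suc_conv)
  then show ?thesis unfolding total_rec_def by blast
qed

text \<open>The existence of a zero keeps minimisation total, and the values below the least zero
  are positive, as \<open>computes_Mu\<close> demands.\<close>

lemma total_rec_least:
  assumes G: "total_rec (Suc n) G" and ex: "\<And>xs. length xs = n \<Longrightarrow> \<exists>k. G (k # xs) = 0"
  shows "total_rec n (\<lambda>xs. LEAST k. G (k # xs) = 0)"
proof -
  obtain g where g: "\<And>xs. length xs = Suc n \<Longrightarrow> computes g xs (G xs)"
    using G unfolding total_rec_def by blast
  have "computes (Mu g) xs (LEAST k. G (k # xs) = 0)" if len: "length xs = n" for xs
  proof (rule computes_Mu)
    have "G ((LEAST k. G (k # xs) = 0) # xs) = 0"
      by (rule LeastI_ex[OF ex[OF len]])
    then show "computes g ((LEAST k. G (k # xs) = 0) # xs) 0"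
      using g len by (metis length_Cons)
    show "\<forall>m<LEAST k. G (k # xs) = 0. \<exists>y>0. computes g (m # xs) y"
    proof (intro allI impI)
      fix m assume "m < (LEAST k. G (k # xs) = 0)"
      then have "G (m # xs) \<noteq> 0" by (rule not_less_Least)
      moreover have "computes g (m # xs) (G (m # xs))" by (rule g) (simp add: len)
      ultimately show "\<exists>y>0. computes g (m # xs) y" by blast
    qed
  qed
  then show ?thesis unfolding total_rec_def by blast
qed

lemma total_rec_add: "total_rec n F \<Longrightarrow> total_rec n G \<Longrightarrow> total_rec n (\<lambda>xs. F xs + G xs)"
proof (rule total_rec_comp2[of "(+)"])
  show "total_rec 2 (\<lambda>xs. xs ! 0 + xs ! 1)"
    unfolding numeral_2_eq_2
    by (rule total_rec_primrec[where A = "\<lambda>xs. xs ! 0" and G = "\<lambda>xs. Suc (xs ! 1)"])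
      (simp_all add: total_rec_nth total_rec_Suc)
qed

lemma total_rec_mult: "total_rec n F \<Longrightarrow> total_rec n G \<Longrightarrow> total_rec n (\<lambda>xs. F xs * G xs)"
proof (rule total_rec_comp2[of "(*)"])
  show "total_rec 2 (\<lambda>xs. xs ! 0 * xs ! 1)"
    unfolding numeral_2_eq_2
    by (rule total_rec_primrec[where A = "\<lambda>xs. 0" and G = "\<lambda>xs. xs ! 1 + xs ! 2"])
      (simp_all add: total_rec_nth total_rec_add total_rec_const)
qed

lemma total_rec_power: "total_rec n F \<Longrightarrow> total_rec n (\<lambda>xs. b ^ F xs)"
proof (rule total_rec_comp1[of "\<lambda>x. b ^ x"])
  show "total_rec (Suc 0) (\<lambda>xs. b ^ (xs ! 0))"
    by (rule total_rec_primrec[where A = "\<lambda>xs. 1" and G = "\<lambda>xs. b * xs ! 1"])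
      (auto intro!: total_rec_nth total_rec_mult total_rec_const)
qed

lemma total_rec_pred: "total_rec n F \<Longrightarrow> total_rec n (\<lambda>xs. F xs - 1)"
proof (rule total_rec_comp1[of "\<lambda>x. x - 1"])
  show "total_rec (Suc 0) (\<lambda>xs. xs ! 0 - 1)"
    by (rule total_rec_primrec[where A = "\<lambda>xs. 0" and G = "\<lambda>xs. xs ! 0"])
      (auto intro!: total_rec_nth total_rec_const)
qed

text \<open>Primitive recursion runs on the first argument, so the subtrahend is put first: x - Suc
  k = (x - k) - 1.\<close>

lemma total_rec_diff: "total_rec n F \<Longrightarrow> total_rec n G \<Longrightarrow> total_rec n (\<lambda>xs. F xs - G xs)"
proof (rule total_rec_comp2[of "\<lambda>y x. x - y"])
  show "total_rec 2 (\<lambda>xs. xs ! 1 - xs ! 0)"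
    unfolding numeral_2_eq_2
    by (rule total_rec_primrec[where A = "\<lambda>xs. xs ! 0" and G = "\<lambda>xs. xs ! 1 - 1"])
      (simp_all add: total_rec_nth total_rec_pred[unfolded One_nat_def])
qed

lemma total_rec_if_zero:
  assumes "total_rec n C" "total_rec n F" "total_rec n G"
  shows "total_rec n (\<lambda>xs. if C xs = 0 then F xs else G xs)"
proof (rule total_rec_cong)
  show "total_rec n (\<lambda>xs. (1 - C xs) * F xs + (1 - (1 - C xs)) * G xs)"
    by (intro total_rec_add total_rec_mult total_rec_diff total_rec_const assms)
qed simp

lemma total_rec_if_eq:
  assumes "total_rec n C" "total_rec n D" "total_rec n F" "total_rec n G"
  shows "total_rec n (\<lambda>xs. if C xs = D xs then F xs else G xs)"
proof (rule total_rec_cong)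
  show "total_rec n (\<lambda>xs. if (C xs - D xs) + (D xs - C xs) = 0 then F xs else G xs)"
    by (intro total_rec_if_zero total_rec_add total_rec_diff assms)
qed auto

lemma total_rec_div: "total_rec n F \<Longrightarrow> total_rec n G \<Longrightarrow> total_rec n (\<lambda>xs. F xs div G xs)"
proof (rule total_rec_comp2[of "(div)"])
  \<comment> \<open>With k, the dividend x and the divisor y in positions 0, 1, 2, this vanishes iff
    x < y * (k + 1), and the least such k is the quotient. The first branch makes k = 0 a zero when
    y = 0, in agreement with x div 0 = 0.\<close>
  let ?G = "\<lambda>ys. if ys ! 2 = 0 then 0 else Suc (ys ! 1) - ys ! 2 * Suc (ys ! 0)"
  have L: "(LEAST k. ?G (k # xs) = 0) = xs ! 0 div xs ! 1" if "length xs = 2" for xs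
  proof (rule Least_equality)
    show "?G ((xs ! 0 div xs ! 1) # xs) = 0"
      using dividend_less_times_div[of "xs ! 1" "xs ! 0"]
      by (auto simp: algebra_simps numeral_2_eq_2 simp flip: less_eq_Suc_le)
    show "xs ! 0 div xs ! 1 \<le> k" if "?G (k # xs) = 0" for k
      using that less_mult_imp_div_less[of "xs ! 0" "Suc k" "xs ! 1"]
      by (simp add: mult.commute numeral_2_eq_2 split: if_splits)
  qed
  have E: "\<exists>k. ?G (k # xs) = 0" if "length xs = 2" for xs
    using dividend_less_times_div[of "xs ! 1" "xs ! 0"]
    by (intro exI[of _ "xs ! 0 div xs ! 1"])
      (auto simp: algebra_simps numeral_2_eq_2 simp flip: less_eq_Suc_le)
  have T: "total_rec (Suc 2) ?G"
    by (intro total_rec_if_zero total_rec_nth total_rec_const total_rec_diff total_rec_mult total_rec_Suc)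
      simp_all
  show "total_rec 2 (\<lambda>xs. xs ! 0 div xs ! 1)"
    by (rule total_rec_cong[OF total_rec_least[OF T E] L])
qed

lemma total_rec_triangle: "total_rec n F \<Longrightarrow> total_rec n (\<lambda>xs. triangle (F xs))"
  unfolding triangle_def by (intro total_rec_div total_rec_mult total_rec_Suc total_rec_const)

lemma total_rec_prod_encode:
  "total_rec n F \<Longrightarrow> total_rec n G \<Longrightarrow> total_rec n (\<lambda>xs. prod_encode (F xs, G xs))"
  unfolding prod_encode_def by (simp add: total_rec_add total_rec_triangle)

lemma triangle_mono: "m \<le> n \<Longrightarrow> triangle m \<le> triangle n"
  by (rule lift_Suc_mono_le[of triangle]) simp_all

text \<open>A pair (a, b) has the code \<open>triangle\<close> (a + b) + a, which lies below
  \<open>triangle\<close> (a + b + 1). Hence a + b is the least k with code <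
  \<open>triangle\<close> (k + 1), and both components follow from it by subtraction.\<close>

lemma total_rec_prod_decode_sum:
  "total_rec n F \<Longrightarrow> total_rec n (\<lambda>xs. fst (prod_decode (F xs)) + snd (prod_decode (F xs)))"
proof (rule total_rec_comp1[of "\<lambda>x. fst (prod_decode x) + snd (prod_decode x)"])
  let ?G = "\<lambda>ys. Suc (ys ! 1) - triangle (Suc (ys ! 0))"
  have eq: "(?G (k # xs) = 0) = (a + b \<le> k)"
    if "length xs = Suc 0" and ab: "prod_decode (xs ! 0) = (a, b)" for xs k a b
  proof -
    have x: "xs ! 0 = triangle (a + b) + a"
      using prod_decode_inverse[of "xs ! 0"] ab by (simp add: prod_encode_def)
    show ?thesis
    proof
      assume 0: "?G (k # xs) = 0"
      show "a + b \<le> k"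
      proof (rule ccontr)
        assume "\<not> a + b \<le> k"
        then have "triangle (Suc k) \<le> triangle (a + b)" by (intro triangle_mono) simp
        then show False using 0 x by simp
      qed
    next
      assume "a + b \<le> k"
      then have "triangle (Suc (a + b)) \<le> triangle (Suc k)" by (intro triangle_mono) simp
      then show "?G (k # xs) = 0" using x by simp
    qed
  qed
  have L: "(LEAST k. ?G (k # xs) = 0) = fst (prod_decode (xs ! 0)) + snd (prod_decode (xs ! 0))"
    if "length xs = Suc 0" for xs
    by (rule Least_equality)
      (simp_all only: eq[OF that prod.collapse[symmetric]] order_refl)
  have T: "total_rec (Suc (Suc 0)) ?G"
    by (intro total_rec_diff total_rec_Suc total_rec_triangle total_rec_nth) simp_all
  have E: "\<exists>k. ?G (k # xs) = 0" if "length xs = Suc 0" for xs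
    using eq[OF that prod.collapse[symmetric]] by blast
  show "total_rec (Suc 0) (\<lambda>xs. fst (prod_decode (xs ! 0)) + snd (prod_decode (xs ! 0)))"
    by (rule total_rec_cong[OF total_rec_least[OF T E] L])
qed

lemma total_rec_dfst: "total_rec n F \<Longrightarrow> total_rec n (\<lambda>xs. fst (prod_decode (F xs)))"
proof (rule total_rec_cong)
  assume F: "total_rec n F"
  show "total_rec n (\<lambda>xs. F xs - triangle (fst (prod_decode (F xs)) + snd (prod_decode (F xs))))"
    by (intro total_rec_diff total_rec_triangle total_rec_prod_decode_sum F)
  show "F xs - triangle (fst (prod_decode (F xs)) + snd (prod_decode (F xs))) = fst (prod_decode (F xs))" for xs
  proof -
    obtain a b where ab: "prod_decode (F xs) = (a, b)" by fastforce
    then have "triangle (a + b) + a = F xs"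
      using prod_decode_inverse[of "F xs"] by (simp add: prod_encode_def)
    then show ?thesis unfolding ab by simp
  qed
qed

lemma total_rec_dsnd: "total_rec n F \<Longrightarrow> total_rec n (\<lambda>xs. snd (prod_decode (F xs)))"
proof (rule total_rec_cong)
  assume F: "total_rec n F"
  show "total_rec n (\<lambda>xs. (fst (prod_decode (F xs)) + snd (prod_decode (F xs))) - fst (prod_decode (F xs)))"
    by (intro total_rec_diff total_rec_dfst total_rec_prod_decode_sum F)
qed simp

lemma total_rec_list_encode_Nil: "total_rec n (\<lambda>xs. list_encode [])"
  by (rule total_rec_const)

lemma total_rec_list_encode_Cons:
  "total_rec n F \<Longrightarrow> total_rec n (\<lambda>xs. list_encode (G xs))
    \<Longrightarrow> total_rec n (\<lambda>xs. list_encode (F xs # G xs))"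
  by (simp add: total_rec_Suc total_rec_prod_encode)

lemmas total_rec_intros = total_rec_nth total_rec_const total_rec_Suc total_rec_add total_rec_mult
  total_rec_power total_rec_diff total_rec_prod_encode total_rec_dfst total_rec_dsnd total_rec_div
  total_rec_list_encode_Nil total_rec_list_encode_Cons

section \<open>Register machines\<close>

datatype cmd = INC nat | DEC nat | Seq cmd cmd | Loop nat cmd

text \<open>\<open>Loop\<close> decrements its register before each pass and tests it afresh
  afterwards. A body that leaves the register alone runs a fixed number of times; a body that writes
  it, as in \<open>realizable_Mu\<close>, performs an unbounded search.\<close>

inductive exec :: "cmd \<Rightarrow> (nat \<Rightarrow> nat) \<Rightarrow> (nat \<Rightarrow> nat) \<Rightarrow> bool" where
  exec_INC: "exec (INC r) v (v(r := Suc (v r)))"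
| exec_DEC: "exec (DEC r) v (v(r := v r - 1))"
| exec_Seq: "exec c v v' \<Longrightarrow> exec d v' v'' \<Longrightarrow> exec (Seq c d) v v''"
| exec_Loop_0: "v r = 0 \<Longrightarrow> exec (Loop r c) v v"
| exec_Loop: "0 < v r \<Longrightarrow> exec c (v(r := v r - 1)) v' \<Longrightarrow> exec (Loop r c) v' v''
    \<Longrightarrow> exec (Loop r c) v v''"

lemma exec_INC': "w = v(r := Suc (v r)) \<Longrightarrow> exec (INC r) v w"
  by (simp add: exec_INC)

definition Noop :: cmd where "Noop = Seq (INC 0) (DEC 0)"

lemma exec_Noop: "exec Noop v v"
  unfolding Noop_def
  by (rule exec_Seq[OF exec_INC]) (use exec_DEC[of 0 "v(0 := Suc (v 0))"] in simp)

lemma exec_Clear: "exec (Loop r (DEC r)) v (v(r := 0))"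
proof (induction "v r" arbitrary: v rule: less_induct)
  case less
  show ?case
  proof (cases "v r = 0")
    case True
    then have "v(r := 0) = v" by (simp add: fun_eq_iff)
    then show ?thesis using exec_Loop_0[of v r] True by simp
  next
    case False
    let ?w = "v(r := v r - 1)"
    have "exec (Loop r (DEC r)) (?w(r := ?w r - 1)) ((?w(r := ?w r - 1))(r := 0))"
      by (rule less) (use False in simp)
    then show ?thesis using False by (simp add: exec_Loop[OF _ exec_DEC])
  qed
qed

lemma exec_Move:
  "a \<noteq> b \<Longrightarrow> exec (Loop a (INC b)) v (v(a := 0, b := v b + v a))"
proof (induction "v a" arbitrary: v)
  case 0
  then have v: "v(a := 0, b := v b + v a) = v" by (simp add: fun_eq_iff)
  show ?case unfolding v by (rule exec_Loop_0) (simp add: 0)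
next
  case (Suc n)
  let ?w = "v(a := n, b := Suc (v b))"
  have "exec (Loop a (INC b)) ?w (?w(a := 0, b := ?w b + ?w a))"
    by (rule Suc) (use Suc in simp_all)
  moreover have "?w(a := 0, b := ?w b + ?w a) = v(a := 0, b := v b + v a)"
    using Suc by (auto simp: fun_eq_iff)
  moreover have "exec (INC b) (v(a := v a - 1)) ?w"
    by (rule exec_INC') (use Suc in \<open>auto simp: fun_eq_iff\<close>)
  ultimately show ?case using Suc by (metis exec_Loop zero_less_Suc)
qed

lemma exec_Move2:
  "a \<noteq> b \<Longrightarrow> a \<noteq> c \<Longrightarrow> b \<noteq> c \<Longrightarrow>
    exec (Loop a (Seq (INC b) (INC c))) v (v(a := 0, b := v b + v a, c := v c + v a))"
proof (induction "v a" arbitrary: v)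
  case 0
  then have v: "v(a := 0, b := v b + v a, c := v c + v a) = v" by (simp add: fun_eq_iff)
  show ?case unfolding v by (rule exec_Loop_0) (simp add: 0)
next
  case (Suc n)
  let ?w = "v(a := n, b := Suc (v b), c := Suc (v c))"
  have "exec (Loop a (Seq (INC b) (INC c))) ?w (?w(a := 0, b := ?w b + ?w a, c := ?w c + ?w a))"
    by (rule Suc) (use Suc in simp_all)
  moreover have "?w(a := 0, b := ?w b + ?w a, c := ?w c + ?w a)
      = v(a := 0, b := v b + v a, c := v c + v a)"
    using Suc by (auto simp: fun_eq_iff)
  moreover have "exec (Seq (INC b) (INC c)) (v(a := v a - 1)) ?w"
    by (rule exec_Seq[OF exec_INC], rule exec_INC') (use Suc in \<open>auto simp: fun_eq_iff\<close>)
  ultimately show ?case using Suc by (metis exec_Loop zero_less_Suc)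
qed

text \<open>A loop empties the register that it reads, so the value is poured into both
  \<open>b\<close> and \<open>t\<close>, and the source is restored from \<open>t\<close>.\<close>

definition Copy :: "nat \<Rightarrow> nat \<Rightarrow> nat \<Rightarrow> cmd" where
  "Copy a b t = Seq (Loop a (Seq (INC b) (INC t))) (Loop t (INC a))"

lemma exec_Copy:
  assumes "a \<noteq> b" "a \<noteq> t" "b \<noteq> t" "v b = 0" "v t = 0"
  shows "exec (Copy a b t) v (v(b := v a))"
proof -
  let ?w = "v(a := 0, b := v b + v a, t := v t + v a)"
  have "?w(t := 0, a := ?w a + ?w t) = v(b := v a)"
    using assms by (auto simp: fun_eq_iff)
  then show ?thesis
    unfolding Copy_def using exec_Seq[OF exec_Move2 exec_Move[of t a ?w]] assms by metis
qed

section \<open>Counter programs for recursive functions\<close>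

text \<open>Arguments are read from the registers \<open>ins\<close>; registers from \<open>d\<close> on are scratch space, zero
  before and after.\<close>

definition realizes :: "recf \<Rightarrow> cmd \<Rightarrow> nat list \<Rightarrow> nat \<Rightarrow> nat \<Rightarrow> bool" where
  "realizes f c ins out d \<longleftrightarrow>
     (\<forall>v y. computes f (map v ins) y \<and> v out = 0 \<and> (\<forall>r\<ge>d. v r = 0) \<longrightarrow> exec c v (v(out := y)))"

lemma realizesD:
  "realizes f c ins out d \<Longrightarrow> computes f (map v ins) y \<Longrightarrow> v out = 0 \<Longrightarrow> (\<And>r. r \<ge> d \<Longrightarrow> v r = 0)
    \<Longrightarrow> w = v(out := y) \<Longrightarrow> exec c v w"
  unfolding realizes_def by blast

text \<open>Quantifying over all register layouts lets the induction over terms place the arguments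
  and results of subterms in scratch space of the enclosing program.\<close>

definition realizable :: "recf \<Rightarrow> bool" where
  "realizable f \<longleftrightarrow> (\<forall>ins out d. set ins \<subseteq> {..<d} \<and> out < d \<and> out \<notin> set ins
     \<longrightarrow> (\<exists>c. realizes f c ins out d))"

lemma realizableE:
  assumes "realizable f" "set ins \<subseteq> {..<d}" "out < d" "out \<notin> set ins"
  obtains c where "realizes f c ins out d"
  using assms unfolding realizable_def by blast

lemma realizable_Zero: "realizable Zero"
proof -
  have "realizes Zero Noop ins out d" for ins out d
    unfolding realizes_def
    by (auto elim!: computes_ZeroE simp: exec_Noop fun_upd_idem)
  then show ?thesis unfolding realizable_def by blast
qed

lemma realizable_Proj: "realizable (Proj i)"
  unfolding realizable_def
proof (intro allI impI exI)
  fix ins :: "nat list" and out d :: nat assume d: "set ins \<subseteq> {..<d} \<and> out < d \<and> out \<notin> set ins"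
  show "realizes (Proj i) (Copy (ins ! i) out d) ins out d"
    unfolding realizes_def
  proof (intro allI impI, elim conjE)
    fix v y assume c: "computes (Proj i) (map v ins) y" and v: "v out = 0" "\<forall>r\<ge>d. v r = 0"
    from c have i: "i < length ins" "y = v (ins ! i)" by (auto elim: computes_ProjE)
    then have "ins ! i \<in> set ins" by simp
    then show "exec (Copy (ins ! i) out d) v (v(out := y))"
      unfolding i(2) using d v by (intro exec_Copy) auto
  qed
qed

lemma realizable_Succ: "realizable Succ"
  unfolding realizable_def
proof (intro allI impI exI)
  fix ins :: "nat list" and out d :: nat assume d: "set ins \<subseteq> {..<d} \<and> out < d \<and> out \<notin> set ins"
  show "realizes Succ (Seq (Copy (ins ! 0) out d) (INC out)) ins out d"
    unfolding realizes_def
  proof (intro allI impI, elim conjE)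
    fix v y assume c: "computes Succ (map v ins) y" and v: "v out = 0" "\<forall>r\<ge>d. v r = 0"
    from c have i: "ins \<noteq> []" "y = Suc (v (ins ! 0))" by (auto elim!: computes_SuccE)
    then have "ins ! 0 \<in> set ins" by simp
    then have "exec (Copy (ins ! 0) out d) v (v(out := v (ins ! 0)))"
      using d v by (intro exec_Copy) auto
    then show "exec (Seq (Copy (ins ! 0) out d) (INC out)) v (v(out := y))"
      unfolding i(2) by (rule exec_Seq) (simp add: exec_INC')
  qed
qed

lemma exec_clear_range:
  "\<exists>c. \<forall>v. exec c v (\<lambda>r. if d \<le> r \<and> r < d + m then 0 else v r)"
proof (induction m)
  case 0
  have "(\<lambda>r. if d \<le> r \<and> r < d + 0 then 0 else v r) = v" for v :: "nat \<Rightarrow> nat"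
    by (auto simp: fun_eq_iff)
  then show ?case using exec_Noop by metis
next
  case (Suc m)
  then obtain c where c: "\<And>v. exec c v (\<lambda>r. if d \<le> r \<and> r < d + m then 0 else v r)" by blast
  have "exec (Seq c (Loop (d + m) (DEC (d + m)))) v (\<lambda>r. if d \<le> r \<and> r < d + Suc m then 0 else v r)" for v
  proof (rule exec_Seq[OF c])
    let ?w = "\<lambda>r. if d \<le> r \<and> r < d + m then 0 else v r"
    have "(\<lambda>r. if d \<le> r \<and> r < d + Suc m then 0 else v r) = ?w(d + m := 0)"
      by (auto simp: fun_eq_iff)
    then show "exec (Loop (d + m) (DEC (d + m))) ?w (\<lambda>r. if d \<le> r \<and> r < d + Suc m then 0 else v r)"
      using exec_Clear by simp
  qed
  then show ?case by blast
qed

text \<open>The block of argument values starts at \<open>d\<close>. The bound \<open>m\<close>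
  stays fixed while \<open>gs\<close> grows at its end, so every argument program has its scratch
  space beyond the whole block and cannot disturb values already computed.\<close>

lemma realizable_arguments:
  assumes "\<forall>g\<in>set gs. realizable g" "set ins \<subseteq> {..<d}" "length gs \<le> m"
  shows "\<exists>c. \<forall>v ys. length ys = length gs \<and> (\<forall>i<length gs. computes (gs ! i) (map v ins) (ys ! i))
      \<and> (\<forall>r\<ge>d. v r = 0)
    \<longrightarrow> exec c v (\<lambda>r. if d \<le> r \<and> r < d + length gs then ys ! (r - d) else v r)"
  using assms
proof (induction gs rule: rev_induct)
  case Nil
  have "(\<lambda>r. if d \<le> r \<and> r < d + length [] then ys ! (r - d) else v r) = v"
    for v :: "nat \<Rightarrow> nat" and ys
    by (auto simp: fun_eq_iff)
  then show ?case using exec_Noop by metis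
next
  case (snoc g gs)
  let ?n = "length gs"
  have gs': "\<forall>g\<in>set gs. realizable g" and m': "?n \<le> m" using snoc.prems by auto
  obtain c where c: "\<And>v ys. length ys = ?n \<Longrightarrow> (\<forall>i<?n. computes (gs ! i) (map v ins) (ys ! i))
      \<Longrightarrow> (\<forall>r\<ge>d. v r = 0) \<Longrightarrow> exec c v (\<lambda>r. if d \<le> r \<and> r < d + ?n then ys ! (r - d) else v r)"
    using snoc.IH[OF gs' snoc.prems(2) m'] by blast
  have "realizable g" "set ins \<subseteq> {..<d + m}" "d + ?n < d + m" "d + ?n \<notin> set ins"
    using snoc.prems by auto
  then obtain e where e: "realizes g e ins (d + ?n) (d + m)" by (rule realizableE)
  have "exec (Seq c e) v (\<lambda>r. if d \<le> r \<and> r < d + length (gs @ [g]) then ys ! (r - d) else v r)"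
    if ys: "length ys = length (gs @ [g])"
      and comp: "\<forall>i<length (gs @ [g]). computes ((gs @ [g]) ! i) (map v ins) (ys ! i)"
      and z: "\<forall>r\<ge>d. v r = 0" for v ys
  proof -
    let ?w = "\<lambda>r. if d \<le> r \<and> r < d + ?n then butlast ys ! (r - d) else v r"
    have "exec c v ?w"
    proof (rule c)
      show "\<forall>i<?n. computes (gs ! i) (map v ins) (butlast ys ! i)"
      proof (intro allI impI)
        fix i assume "i < ?n"
        then show "computes (gs ! i) (map v ins) (butlast ys ! i)"
          using comp[rule_format, of i] ys by (simp add: nth_append nth_butlast)
      qed
    qed (use ys z in auto)
    moreover have "exec e ?w (\<lambda>r. if d \<le> r \<and> r < d + length (gs @ [g]) then ys ! (r - d) else v r)"
    proof (rule realizesD[OF e])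
      have w: "map ?w ins = map v ins" using snoc.prems(2) by auto
      show "computes g (map ?w ins) (ys ! ?n)"
        unfolding w using comp[rule_format, of ?n] by simp
      show "?w r = 0" if "r \<ge> d + m" for r
        using that z snoc.prems(3) by auto
    qed (use ys z in \<open>auto simp: fun_eq_iff nth_butlast\<close>)
    ultimately show ?thesis by (rule exec_Seq)
  qed
  then show ?case by blast
qed

lemma realizable_Comp:
  assumes f: "realizable f" and gs: "\<forall>g\<in>set gs. realizable g"
  shows "realizable (Comp f gs)"
  unfolding realizable_def
proof (intro allI impI)
  fix ins :: "nat list" and out d :: nat assume d: "set ins \<subseteq> {..<d} \<and> out < d \<and> out \<notin> set ins"
  let ?m = "length gs"
  obtain c where c: "\<And>v ys. length ys = ?m \<Longrightarrow> (\<forall>i<?m. computes (gs ! i) (map v ins) (ys ! i))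
      \<Longrightarrow> (\<forall>r\<ge>d. v r = 0) \<Longrightarrow> exec c v (\<lambda>r. if d \<le> r \<and> r < d + ?m then ys ! (r - d) else v r)"
    using realizable_arguments[OF gs, of ins d ?m] d by blast
  have "set [d..<d + ?m] \<subseteq> {..<d + ?m}" "out < d + ?m" "out \<notin> set [d..<d + ?m]" using d by auto
  with f obtain e where e: "realizes f e [d..<d + ?m] out (d + ?m)" by (rule realizableE)
  obtain k where k: "\<And>v. exec k v (\<lambda>r. if d \<le> r \<and> r < d + ?m then 0 else v r)"
    using exec_clear_range by blast
  have "realizes (Comp f gs) (Seq c (Seq e k)) ins out d"
    unfolding realizes_def
  proof (intro allI impI, elim conjE)
    fix v y assume comp: "computes (Comp f gs) (map v ins) y" and v: "v out = 0" "\<forall>r\<ge>d. v r = 0"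
    from comp obtain ys where ys: "length ys = ?m"
      "\<forall>i<?m. computes (gs ! i) (map v ins) (ys ! i)" and y: "computes f ys y"
      by (rule computes_CompE) blast
    let ?w = "\<lambda>r. if d \<le> r \<and> r < d + ?m then ys ! (r - d) else v r"
    have "map ?w [d..<d + ?m] = ys" using ys by (auto intro: nth_equalityI)
    then have run_e: "exec e ?w (?w(out := y))"
      by (intro realizesD[OF e]) (use y v d in auto)
    have eq: "(\<lambda>r. if d \<le> r \<and> r < d + ?m then 0 else (?w(out := y)) r) = v(out := y)"
      using d v by (auto simp: fun_eq_iff)
    have run_k: "exec k (?w(out := y)) (v(out := y))"
      using k[of "?w(out := y)"] unfolding eq .
    show "exec (Seq c (Seq e k)) v (v(out := y))"
      by (rule exec_Seq[OF c[OF ys v(2)] exec_Seq[OF run_e run_k]])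
  qed
  then show "\<exists>c. realizes (Comp f gs) c ins out d" by blast
qed

lemma realizable_PrimRec:
  assumes f: "realizable f" and g: "realizable g"
  shows "realizable (PrimRec f g)"
  unfolding realizable_def
proof (intro allI impI)
  fix ins0 :: "nat list" and out d :: nat assume d0: "set ins0 \<subseteq> {..<d} \<and> out < d \<and> out \<notin> set ins0"
  show "\<exists>c. realizes (PrimRec f g) c ins0 out d"
  proof (cases ins0)
    case Nil
    have "\<not> computes (PrimRec f g) [] y" for y by (auto elim: computes.cases)
    then show ?thesis by (auto simp: realizes_def Nil)
  next
    case (Cons a ins)
    then have a: "a < d" "a \<noteq> out" and d: "set ins \<subseteq> {..<d}" "out < d" "out \<notin> set ins" using d0 by auto
    \<comment> \<open>\<open>?A\<close> is the accumulator, \<open>?K\<close> the number of rounds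
      left, \<open>?I\<close> the current index and \<open>?T\<close> the result of one round. The
      step function reads index, accumulator and parameters, in the order of
      \<open>computes_PrimRec_Suc\<close>.\<close>
    let ?A = "d" and ?K = "d + 1" and ?I = "d + 2" and ?T = "d + 3"
    have "set ins \<subseteq> {..<d + 4}" "?A < d + 4" "?A \<notin> set ins" using d by auto
    with f obtain cf where cf: "realizes f cf ins ?A (d + 4)" by (rule realizableE)
    have "set (?I # ?A # ins) \<subseteq> {..<d + 4}" "?T < d + 4" "?T \<notin> set (?I # ?A # ins)" using d by auto
    with g obtain cg where cg: "realizes g cg (?I # ?A # ins) ?T (d + 4)" by (rule realizableE)
    let ?body = "Seq cg (Seq (Loop ?A (DEC ?A)) (Seq (Loop ?T (INC ?A)) (INC ?I)))"
    \<comment> \<open>Whatever the loop reaches from the state after n rounds, it reaches from the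
      start. Stated backwards, the induction peels off the last of the n rounds, which is the one
      that \<open>computes_PrimRec_Suc\<close> exposes.\<close>
    have loop: "exec (Loop ?K ?body) (v(?A := y0, ?K := n + m)) w"
      if "computes (PrimRec f g) (n # map v ins) y" "computes f (map v ins) y0" "\<forall>r\<ge>d. v r = 0"
        "exec (Loop ?K ?body) (v(?A := y, ?K := m, ?I := n)) w" for n m v y y0 w
      using that
    proof (induction n arbitrary: y m)
      case 0
      then have y: "y = y0" by (meson computes_PrimRec_0E computes_deterministic)
      have v: "v(?A := y0, ?K := m, ?I := 0) = v(?A := y0, ?K := 0 + m)"
        using 0 by (auto simp: fun_eq_iff)
      show ?case using 0(4) unfolding y v .
    next
      case (Suc n)
      from Suc.prems(1) obtain r where r: "computes (PrimRec f g) (n # map v ins) r"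
        "computes g (n # r # map v ins) y" by (rule computes_PrimRec_SucE)
      let ?u = "v(?A := r, ?K := m, ?I := n)"
      have u: "map ?u (?I # ?A # ins) = n # r # map v ins" using d by auto
      have "exec cg ?u (?u(?T := y))"
        by (rule realizesD[OF cg], unfold u, rule r(2)) (use Suc.prems(3) in auto)
      moreover have "exec (Loop ?A (DEC ?A)) (?u(?T := y)) (?u(?T := y, ?A := 0))" by (rule exec_Clear)
      moreover have "exec (Loop ?T (INC ?A)) (?u(?T := y, ?A := 0)) (?u(?A := y))"
      proof -
        have "?u(?A := y) = (?u(?T := y, ?A := 0))(?T := 0, ?A := (?u(?T := y, ?A := 0)) ?A + (?u(?T := y, ?A := 0)) ?T)"
          using Suc.prems(3) by (auto simp: fun_eq_iff)
        then show ?thesis using exec_Move[of ?T ?A "?u(?T := y, ?A := 0)"] by simp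
      qed
      moreover have "exec (INC ?I) (?u(?A := y)) (v(?A := y, ?K := m, ?I := Suc n))"
        by (rule exec_INC') (auto simp: fun_eq_iff)
      ultimately have "exec ?body ?u (v(?A := y, ?K := m, ?I := Suc n))"
        by (blast intro: exec_Seq)
      moreover have "(v(?A := r, ?K := Suc m, ?I := n))(?K := (v(?A := r, ?K := Suc m, ?I := n)) ?K - 1) = ?u"
        by (auto simp: fun_eq_iff)
      moreover have "0 < (v(?A := r, ?K := Suc m, ?I := n)) ?K" by simp
      ultimately have "exec (Loop ?K ?body) (v(?A := r, ?K := Suc m, ?I := n)) w"
        using exec_Loop[OF _ _ Suc.prems(4), of "v(?A := r, ?K := Suc m, ?I := n)"] by (simp only:)
      from Suc.IH[OF r(1) Suc.prems(2,3) this] show ?case by simp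
    qed
    have "realizes (PrimRec f g)
       (Seq cf (Seq (Copy a ?K ?I) (Seq (Loop ?K ?body) (Seq (Loop ?A (INC out)) (Loop ?I (DEC ?I)))))) ins0 out d"
      unfolding realizes_def
    proof (intro allI impI, elim conjE)
      fix v y assume "computes (PrimRec f g) (map v ins0) y" and v: "v out = 0" "\<forall>r\<ge>d. v r = 0"
      then have comp: "computes (PrimRec f g) (v a # map v ins) y" by (simp add: Cons)
      have "\<exists>y0. computes f (map v ins) y0" if "computes (PrimRec f g) (n # map v ins) y" for n y
        using that
      proof (induction n arbitrary: y)
        case 0
        then show ?case by (auto elim: computes_PrimRec_0E)
      next
        case (Suc n)
        then show ?case by (meson computes_PrimRec_SucE)
      qed
      with comp obtain y0 where y0: "computes f (map v ins) y0" by blast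
      have "exec cf v (v(?A := y0))" by (rule realizesD[OF cf]) (use y0 v in auto)
      moreover have "exec (Copy a ?K ?I) (v(?A := y0)) (v(?A := y0, ?K := v a))"
        using exec_Copy[of a ?K ?I "v(?A := y0)"] a v by auto
      moreover have "exec (Loop ?K ?body) (v(?A := y0, ?K := v a)) (v(?A := y, ?K := 0, ?I := v a))"
        using loop[of "v a" v y y0 0] comp y0 v by (simp add: exec_Loop_0)
      moreover have "exec (Loop ?A (INC out)) (v(?A := y, ?K := 0, ?I := v a)) (v(?I := v a, out := y))"
      proof -
        let ?u = "v(?A := y, ?K := 0, ?I := v a)"
        have "v(?I := v a, out := y) = ?u(?A := 0, out := ?u out + ?u ?A)"
          using v d by (auto simp: fun_eq_iff)
        then show ?thesis using exec_Move[of ?A out ?u] d by simp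
      qed
      moreover have "exec (Loop ?I (DEC ?I)) (v(?I := v a, out := y)) (v(out := y))"
      proof -
        have "v(out := y) = v(?I := v a, out := y, ?I := 0)" using v d by (auto simp: fun_eq_iff)
        then show ?thesis using exec_Clear by metis
      qed
      ultimately show "exec (Seq cf (Seq (Copy a ?K ?I) (Seq (Loop ?K ?body)
          (Seq (Loop ?A (INC out)) (Loop ?I (DEC ?I)))))) v (v(out := y))"
        by (blast intro: exec_Seq)
    qed
    then show ?thesis by blast
  qed
qed

lemma realizable_Mu:
  assumes f: "realizable f"
  shows "realizable (Mu f)"
  unfolding realizable_def
proof (intro allI impI)
  fix ins :: "nat list" and out d :: nat assume d: "set ins \<subseteq> {..<d} \<and> out < d \<and> out \<notin> set ins"
  let ?I = "d" and ?T = "d + 1"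
  have "set (?I # ins) \<subseteq> {..<d + 2}" "?T < d + 2" "?T \<notin> set (?I # ins)" using d by auto
  with f obtain cf where cf: "realizes f cf (?I # ins) ?T (d + 2)" by (rule realizableE)
  \<comment> \<open>\<open>?I\<close> is the current candidate and \<open>?T\<close> the value of
    \<open>f\<close> there. The loop has taken one from \<open>?T\<close>, so the rest is cleared
    before the next candidate is evaluated into it.\<close>
  let ?body = "Seq (Loop ?T (DEC ?T)) (Seq (INC ?I) cf)"
  have "realizes (Mu f) (Seq cf (Seq (Loop ?T ?body) (Loop ?I (INC out)))) ins out d"
    unfolding realizes_def
  proof (intro allI impI, elim conjE)
    fix v y assume "computes (Mu f) (map v ins) y" and v: "v out = 0" "\<forall>r\<ge>d. v r = 0"
    then have y0: "computes f (y # map v ins) 0" and pos: "\<And>m. m < y \<Longrightarrow> \<exists>z>0. computes f (m # map v ins) z"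
      by (auto elim: computes_MuE)
    have ins: "map (v(?I := m)) ins = map v ins" for m using d by auto
    have run: "exec cf (v(?I := m)) (v(?I := m, ?T := z))" if "computes f (m # map v ins) z" for m z
    proof (rule realizesD[OF cf])
      show "computes f (map (v(?I := m)) (?I # ins)) z" using that ins[of m] by (simp del: map_eq_conv)
    qed (use v in auto)
    \<comment> \<open>The induction is on the number k of candidates still ahead of the least zero
      y; the value z at y - k is positive unless k = 0.\<close>
    have loop: "exec (Loop ?T ?body) (v(?I := y - k, ?T := z)) (v(?I := y))"
      if "k \<le> y" "computes f ((y - k) # map v ins) z" for k z
      using that
    proof (induction k arbitrary: z)
      case 0
      then have "z = 0" using y0 by (auto dest: computes_deterministic)
      then have u: "v(?I := y - 0, ?T := z) = v(?I := y)" using v by (auto simp: fun_eq_iff)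
      show ?case unfolding u by (rule exec_Loop_0) (use v in simp)
    next
      case (Suc k)
      let ?m = "y - Suc k"
      have m: "Suc ?m = y - k" using Suc.prems by simp
      obtain z' where z': "computes f ((y - k) # map v ins) z'"
        using y0 pos[of "y - k"] Suc.prems(1) by (cases k) auto
      have "z > 0" using pos[of ?m] Suc.prems by (auto dest: computes_deterministic)
      moreover have "exec ?body ((v(?I := ?m, ?T := z))(?T := z - 1)) (v(?I := y - k, ?T := z'))"
      proof (rule exec_Seq, rule exec_Clear, rule exec_Seq, rule exec_INC)
        let ?w = "v(?I := ?m, ?T := z, ?T := z - 1, ?T := 0)"
        have "?w(?I := Suc (?w ?I)) = v(?I := y - k)" using v m by (auto simp: fun_eq_iff)
        then show "exec cf (?w(?I := Suc (?w ?I))) (v(?I := y - k, ?T := z'))" using run[OF z'] by simp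
      qed
      moreover have "exec (Loop ?T ?body) (v(?I := y - k, ?T := z')) (v(?I := y))"
        using Suc.IH[OF _ z'] Suc.prems(1) by (simp only: Suc_leD)
      ultimately show ?case
        using exec_Loop[where v = "v(?I := ?m, ?T := z)" and r = ?T and c = ?body]
        by (simp only: fun_upd_same)
    qed
    obtain z0 where z0: "computes f (0 # map v ins) z0" using y0 pos[of 0] by (cases y) auto
    have "v(?I := 0) = v" using v by (auto simp: fun_eq_iff)
    then have "exec cf v (v(?I := 0, ?T := z0))" using run[OF z0] by simp
    moreover have "exec (Loop ?T ?body) (v(?I := 0, ?T := z0)) (v(?I := y))"
      using loop[of y z0] z0 by simp
    moreover have "exec (Loop ?I (INC out)) (v(?I := y)) (v(out := y))"
    proof -
      have "v(out := y) = (v(?I := y))(?I := 0, out := (v(?I := y)) out + (v(?I := y)) ?I)"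
        using v d by (auto simp: fun_eq_iff)
      then show ?thesis using exec_Move[of ?I out "v(?I := y)"] d by simp
    qed
    ultimately show "exec (Seq cf (Seq (Loop ?T ?body) (Loop ?I (INC out)))) v (v(out := y))"
      by (blast intro: exec_Seq)
  qed
  then show "\<exists>c. realizes (Mu f) c ins out d" by blast
qed

lemma realizable: "realizable f"
  by (induction f)
    (simp_all add: realizable_Zero realizable_Succ realizable_Proj realizable_Comp realizable_PrimRec
      realizable_Mu)

section \<open>Register machines with jumps, and compilation\<close>

datatype instr = Inc nat nat | Dec nat nat nat

fun rm_step :: "instr list \<Rightarrow> nat \<times> (nat \<Rightarrow> nat) \<Rightarrow> nat \<times> (nat \<Rightarrow> nat)" where
  "rm_step p (i, v) = (if i < length p then
     (case p ! i of
        Inc r j \<Rightarrow> (j, v(r := Suc (v r)))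
      | Dec r j k \<Rightarrow> if v r = 0 then (k, v) else (j, v(r := v r - 1)))
     else (i, v))"

definition rm_init :: "nat \<Rightarrow> nat \<times> (nat \<Rightarrow> nat)" where
  "rm_init x = (0, (\<lambda>_. 0)(0 := x))"

definition halts :: "instr list \<Rightarrow> nat \<Rightarrow> bool" where
  "halts p x \<longleftrightarrow> (\<exists>t. length p \<le> fst ((rm_step p ^^ t) (rm_init x)))"

lemma rm_step_halted: "length p \<le> fst c \<Longrightarrow> (rm_step p ^^ t) c = c"
  by (induction t; cases c) auto

lemma rm_halted_mono:
  assumes "length p \<le> fst ((rm_step p ^^ t) c)" "t \<le> t'"
  shows "length p \<le> fst ((rm_step p ^^ t') c)"
proof -
  have "(rm_step p ^^ t') c = (rm_step p ^^ (t' - t)) ((rm_step p ^^ t) c)"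
    using assms(2) by (metis comp_apply funpow_add le_add_diff_inverse2)
  then show ?thesis using assms(1) by (simp add: rm_step_halted)
qed

fun code_size :: "cmd \<Rightarrow> nat" where
  "code_size (INC r) = 1"
| "code_size (DEC r) = 1"
| "code_size (Seq c d) = code_size c + code_size d"
| "code_size (Loop r c) = Suc (code_size c)"

text \<open>Code for a command placed at address \<open>s\<close> and exiting to address \<open>t\<close>.\<close>

fun compile :: "cmd \<Rightarrow> nat \<Rightarrow> nat \<Rightarrow> instr list" where
  "compile (INC r) s t = [Inc r t]"
| "compile (DEC r) s t = [Dec r t t]"
| "compile (Seq c d) s t = compile c s (s + code_size c) @ compile d (s + code_size c) t"
| "compile (Loop r c) s t = Dec r (Suc s) t # compile c (Suc s) s"

lemma length_compile [simp]: "length (compile c s t) = code_size c"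
  by (induction c arbitrary: s t) auto

definition code_at :: "instr list \<Rightarrow> nat \<Rightarrow> instr list \<Rightarrow> bool" where
  "code_at p s q \<longleftrightarrow> (\<forall>i<length q. s + i < length p \<and> p ! (s + i) = q ! i)"

lemma code_at_append: "code_at p s (q @ q') \<longleftrightarrow> code_at p s q \<and> code_at p (s + length q) q'"
proof
  assume *: "code_at p s (q @ q')"
  have "s + i < length p \<and> p ! (s + i) = q ! i" if "i < length q" for i
    using * that unfolding code_at_def by (metis length_append nth_append trans_less_add1)
  moreover have "s + length q + i < length p \<and> p ! (s + length q + i) = q' ! i" if "i < length q'" for i
    using *[unfolded code_at_def, rule_format, of "length q + i"] that by (simp add: add.assoc)
  ultimately show "code_at p s q \<and> code_at p (s + length q) q'" unfolding code_at_def by blast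
next
  assume *: "code_at p s q \<and> code_at p (s + length q) q'"
  have "s + i < length p \<and> p ! (s + i) = (q @ q') ! i" if "i < length (q @ q')" for i
  proof (cases "i < length q")
    case True
    then show ?thesis using * by (simp add: code_at_def nth_append)
  next
    case False
    then show ?thesis
      using *[THEN conjunct2, unfolded code_at_def, rule_format, of "i - length q"] that
      by (simp add: nth_append)
  qed
  then show "code_at p s (q @ q')" unfolding code_at_def by blast
qed

lemma code_at_Cons: "code_at p s (i # q) \<longleftrightarrow> s < length p \<and> p ! s = i \<and> code_at p (Suc s) q"
  using code_at_append[of p s "[i]" q] by (simp add: code_at_def)

definition rm_reach :: "instr list \<Rightarrow> nat \<times> (nat \<Rightarrow> nat) \<Rightarrow> nat \<times> (nat \<Rightarrow> nat) \<Rightarrow> bool" where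
  "rm_reach p c c' \<longleftrightarrow> (\<exists>t. (rm_step p ^^ t) c = c')"

lemma rm_reach_step: "rm_step p c = c' \<Longrightarrow> rm_reach p c c'"
  unfolding rm_reach_def by (rule exI[of _ 1]) simp

lemma rm_reach_trans: "rm_reach p c c' \<Longrightarrow> rm_reach p c' c'' \<Longrightarrow> rm_reach p c c''"
  unfolding rm_reach_def by (metis comp_apply funpow_add)

text \<open>A loop body exits to the address of its own test, so addresses \<open>s\<close> and
  \<open>t\<close> vary in the induction; the test is then executed again with the registers that
  the body left.\<close>

lemma compile_correct:
  "exec c v w \<Longrightarrow> code_at p s (compile c s t) \<Longrightarrow> rm_reach p (s, v) (t, w)"
proof (induction arbitrary: s t rule: exec.induct)
  case (exec_INC r v)
  then show ?case by (intro rm_reach_step) (simp add: code_at_Cons fun_eq_iff)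
next
  case (exec_DEC r v)
  have "v(r := 0) = v" if "v r = 0" using that by auto
  with exec_DEC show ?case by (intro rm_reach_step) (auto simp: code_at_Cons)
next
  case (exec_Seq c v v' d v'')
  then have "code_at p s (compile c s (s + code_size c))"
    "code_at p (s + code_size c) (compile d (s + code_size c) t)"
    by (simp_all add: code_at_append)
  then show ?case by (blast intro: rm_reach_trans exec_Seq.IH)
next
  case (exec_Loop_0 v r c)
  then show ?case by (intro rm_reach_step) (simp add: code_at_Cons)
next
  case (exec_Loop v r c v' v'')
  have "rm_reach p (s, v) (Suc s, v(r := v r - 1))"
    using exec_Loop by (intro rm_reach_step) (simp add: code_at_Cons)
  moreover have "rm_reach p (Suc s, v(r := v r - 1)) (s, v')"
    by (rule exec_Loop.IH(1)) (use exec_Loop.prems in \<open>simp add: code_at_Cons\<close>)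
  moreover have "rm_reach p (s, v') (t, v'')" using exec_Loop by blast
  ultimately show ?case by (blast intro: rm_reach_trans)
qed

text \<open>Kleene normal form: the machine evaluates \<open>T x t\<close> for \<open>t = 0, 1, \<dots>\<close> until the value is 0.\<close>

lemma machine_for_search:
  assumes f: "\<And>x t. computes f [x, t] (T x t)" and T: "\<And>x t. T x t \<le> 1"
  shows "\<exists>p. \<forall>x. halts p x \<longleftrightarrow> (\<exists>t. T x t = 0)"
proof -
  obtain c where c: "realizes f c [0, 1] 2 3"
    using realizable[of f] by (rule realizableE[where ins = "[0, 1]" and out = 2 and d = 3]) auto
  let ?L = "code_size c"
  \<comment> \<open>Register 0 holds x, register 1 holds t, register 2 receives T x t. On value 0
    control leaves the program at address \<open>?L\<close> + 2. Otherwise the value is 1, so the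
    test itself resets register 2, and the search goes on with t + 1.\<close>
  let ?p = "compile c 0 ?L @ [Dec 2 (?L + 1) (?L + 2), Inc 1 0]"
  let ?v = "\<lambda>x t. (\<lambda>_. 0)(0 := x, 1 := t) :: nat \<Rightarrow> nat"
  have code: "code_at ?p 0 (compile c 0 ?L)" by (simp add: code_at_def nth_append)
  have eval: "rm_reach ?p (0, ?v x t) (?L, (?v x t)(2 := T x t))" for x t
    by (rule compile_correct[OF realizesD[OF c] code]) (use f in auto)
  have last: "rm_step ?p (?L, v) = (if v 2 = 0 then (?L + 2, v) else (?L + 1, v(2 := v 2 - 1)))"
    "rm_step ?p (?L + 1, v) = (0, v(1 := Suc (v 1)))" for v
    by (simp_all add: nth_append)
  have halt: "rm_reach ?p (0, ?v x t) (?L + 2, ?v x t)" if "T x t = 0" for x t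
  proof (rule rm_reach_trans[OF eval rm_reach_step])
    have "(?v x t)(2 := T x t) = ?v x t" using that by (auto simp: fun_eq_iff)
    then show "rm_step ?p (?L, (?v x t)(2 := T x t)) = (?L + 2, ?v x t)" by (simp only: last) simp
  qed
  have next1: "\<exists>s. (rm_step ?p ^^ Suc s) (0, ?v x t) = (0, ?v x (Suc t))" if "T x t \<noteq> 0" for x t
  proof -
    have T1: "T x t = 1" using that T[of x t] by simp
    obtain s where s: "(rm_step ?p ^^ s) (0, ?v x t) = (?L, (?v x t)(2 := T x t))"
      using eval unfolding rm_reach_def by blast
    have 1: "rm_step ?p (?L, (?v x t)(2 := T x t)) = (?L + 1, ?v x t)"
      by (simp only: last) (simp add: T1 fun_eq_iff)
    have 2: "rm_step ?p (?L + 1, ?v x t) = (0, ?v x (Suc t))"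
      by (simp only: last) (simp add: fun_eq_iff)
    have "(rm_step ?p ^^ Suc (Suc s)) (0, ?v x t) = (0, ?v x (Suc t))"
      by (simp only: funpow.simps comp_apply s 1 2)
    then show ?thesis by blast
  qed
  \<comment> \<open>The bound s \<ge> t shows that an unsuccessful search is back at address 0 at
    arbitrarily late times, which contradicts halting because a halted machine stays put.\<close>
  have iter: "\<exists>s\<ge>t. (rm_step ?p ^^ s) (0, ?v x 0) = (0, ?v x t)" if "\<forall>t'<t. T x t' \<noteq> 0" for x t
    using that
  proof (induction t)
    case 0
    show ?case by (rule exI[of _ 0]) simp
  next
    case (Suc t)
    have "\<forall>t'<t. T x t' \<noteq> 0" using Suc.prems by simp
    from Suc.IH[OF this] obtain s where
      s: "s \<ge> t" "(rm_step ?p ^^ s) (0, ?v x 0) = (0, ?v x t)" by blast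
    obtain s' where s': "(rm_step ?p ^^ Suc s') (0, ?v x t) = (0, ?v x (Suc t))"
      using next1 Suc.prems by blast
    have "(rm_step ?p ^^ (Suc s' + s)) (0, ?v x 0) = (0, ?v x (Suc t))"
      unfolding funpow_add comp_apply s(2) s' ..
    moreover have "Suc t \<le> Suc s' + s" using s(1) by simp
    ultimately show ?case by blast
  qed
  have init: "rm_init x = (0, ?v x 0)" for x by (auto simp: rm_init_def fun_eq_iff)
  have "halts ?p x \<longleftrightarrow> (\<exists>t. T x t = 0)" for x
  proof
    assume "\<exists>t. T x t = 0"
    then have t: "T x (LEAST t. T x t = 0) = 0" by (rule LeastI_ex)
    have "\<forall>t'<(LEAST t. T x t = 0). T x t' \<noteq> 0" using not_less_Least by blast
    from iter[OF this] halt[OF t] obtain s where "(rm_step ?p ^^ s) (rm_init x) = (?L + 2, ?v x (LEAST t. T x t = 0))"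
      unfolding init rm_reach_def by (metis comp_apply funpow_add)
    then show "halts ?p x" unfolding halts_def by (intro exI[of _ s]) simp
  next
    assume "halts ?p x"
    then obtain t where t: "length ?p \<le> fst ((rm_step ?p ^^ t) (rm_init x))" unfolding halts_def by blast
    show "\<exists>t. T x t = 0"
    proof (rule ccontr)
      assume "\<nexists>t. T x t = 0"
      then obtain s where s: "s \<ge> t" "(rm_step ?p ^^ s) (rm_init x) = (0, ?v x t)"
        using iter[of t x] unfolding init by auto
      show False using rm_halted_mono[OF t s(1)] unfolding s(2) by simp
    qed
  qed
  then show ?thesis by blast
qed

section \<open>An undecidable set accepted by a machine\<close>

text \<open>A program is a nested pair of instruction codes that ends in 0. Since
  \<open>prod_decode\<close> maps 0 to (0, 0), every fetch beyond the end yields 0.\<close>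

definition fetch :: "nat \<Rightarrow> nat \<Rightarrow> nat" where
  "fetch x i = fst (prod_decode (((\<lambda>y. snd (prod_decode y)) ^^ i) x))"

text \<open>The evaluator knows \<open>reg_prime 0\<close> as a constant and receives all other
  primes inside instruction codes, so it only multiplies, divides and compares.\<close>

definition reg_prime :: "nat \<Rightarrow> nat" where
  "reg_prime = Infinite_Set.enumerate {q. prime q}"

text \<open>
  Register \<open>r\<close> is the exponent of \<open>reg_prime r\<close> in a single number \<open>n\<close>; an instruction
  \<open>(m, d, j, k)\<close> means ``if \<open>d\<close> divides \<open>n\<close>, replace \<open>n\<close> by \<open>m * (n div d)\<close> and go to \<open>j\<close>, else go to
  \<open>k\<close>''. The word 0, which is fetched beyond the end of the program, halts.
\<close>

definition ustep :: "nat \<Rightarrow> nat \<Rightarrow> nat" where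
  "ustep x s = (if fetch x (fst (prod_decode s)) = 0 then s
     else if snd (prod_decode (fst (prod_decode (fetch x (fst (prod_decode s)))))) *
         (snd (prod_decode s) div snd (prod_decode (fst (prod_decode (fetch x (fst (prod_decode s)))))))
         = snd (prod_decode s)
     then prod_encode (fst (prod_decode (snd (prod_decode (fetch x (fst (prod_decode s)))))),
         fst (prod_decode (fst (prod_decode (fetch x (fst (prod_decode s)))))) *
         (snd (prod_decode s) div snd (prod_decode (fst (prod_decode (fetch x (fst (prod_decode s))))))))
     else prod_encode (snd (prod_decode (snd (prod_decode (fetch x (fst (prod_decode s)))))),
         snd (prod_decode s)))"

definition urun :: "nat \<Rightarrow> nat \<Rightarrow> nat" where
  "urun x t = (ustep x ^^ t) (prod_encode (0, reg_prime 0 ^ x))"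

text \<open>The values are kept in {0, 1} to meet the bound of
  \<open>machine_for_search\<close>.\<close>

definition running :: "nat \<Rightarrow> nat \<Rightarrow> nat" where
  "running x t = (if fetch x (fst (prod_decode (urun x t))) = 0 then 0 else 1)"

definition halting_set :: "nat set" where
  "halting_set = {x. \<exists>t. running x t = 0}"

lemma total_rec_fetch: "total_rec n F \<Longrightarrow> total_rec n G \<Longrightarrow> total_rec n (\<lambda>xs. fetch (F xs) (G xs))"
proof (rule total_rec_comp2[of "\<lambda>i x. fetch x i"])
  have "total_rec 2 (\<lambda>xs. ((\<lambda>y. snd (prod_decode y)) ^^ (xs ! 0)) (xs ! 1))"
    unfolding numeral_2_eq_2
  proof (rule total_rec_primrec)
    show "total_rec (Suc 0) (\<lambda>xs. xs ! 0)" by (simp add: total_rec_nth)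
    show "total_rec (Suc 0 + 2) (\<lambda>xs. snd (prod_decode (xs ! 1)))"
      by (intro total_rec_dsnd total_rec_nth) simp
  qed simp_all
  then show "total_rec 2 (\<lambda>xs. fetch (xs ! 1) (xs ! 0))"
    unfolding fetch_def by (rule total_rec_dfst)
qed

lemma total_rec_ustep: "total_rec n F \<Longrightarrow> total_rec n G \<Longrightarrow> total_rec n (\<lambda>xs. ustep (F xs) (G xs))"
  unfolding ustep_def
  by (intro total_rec_if_zero total_rec_if_eq total_rec_intros total_rec_fetch)

lemma total_rec_running: "total_rec 2 (\<lambda>xs. running (xs ! 0) (xs ! 1))"
proof -
  have "total_rec 2 (\<lambda>xs. urun (xs ! 1) (xs ! 0))"
    unfolding numeral_2_eq_2
  proof (rule total_rec_primrec)
    show "total_rec (Suc 0) (\<lambda>xs. prod_encode (0, reg_prime 0 ^ (xs ! 0)))"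
      by (intro total_rec_prod_encode total_rec_const total_rec_power total_rec_nth) simp
    show "total_rec (Suc 0 + 2) (\<lambda>xs. ustep (xs ! 2) (xs ! 1))"
      by (intro total_rec_ustep total_rec_nth) simp_all
  qed (simp_all add: urun_def numeral_2_eq_2)
  then have "total_rec 2 (\<lambda>xs. urun (xs ! 0) (xs ! 1))"
    by (rule total_rec_comp2[of "\<lambda>t x. urun x t"]) (simp_all add: total_rec_nth)
  then show ?thesis
    unfolding running_def
    by (intro total_rec_if_zero total_rec_fetch total_rec_dfst total_rec_const total_rec_nth) simp_all
qed

lemma prime_reg_prime: "prime (reg_prime r)"
  unfolding reg_prime_def using enumerate_in_set[OF primes_infinite] by simp

lemma reg_prime_inj: "reg_prime r = reg_prime r' \<longleftrightarrow> r = r'"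
  unfolding reg_prime_def using enumerate_mono_iff[OF primes_infinite] by (metis less_irrefl linorder_neqE_nat)

lemma multiplicity_reg_prime: "multiplicity (reg_prime r) (reg_prime r') = (if r = r' then 1 else 0)"
  using prime_multiplicity_other[OF prime_reg_prime prime_reg_prime, of r r'] reg_prime_inj[of r r'] prime_reg_prime[of r]
  by auto

text \<open>An increment has divisor 1, so its divisibility test always succeeds and the second
  target 0 is a dummy; a decrement has multiplier 1.\<close>

fun instr_code :: "instr \<Rightarrow> nat" where
  "instr_code (Inc r j) = prod_encode (prod_encode (reg_prime r, 1), prod_encode (j, 0))"
| "instr_code (Dec r j k) = prod_encode (prod_encode (1, reg_prime r), prod_encode (j, k))"

definition prog_code :: "instr list \<Rightarrow> nat" where
  "prog_code p = foldr (\<lambda>i x. prod_encode (instr_code i, x)) p 0"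

lemma prod_encode_pos: "0 < a \<or> 0 < b \<Longrightarrow> 0 < prod_encode (a, b)"
  by (metis le_prod_encode_1 le_prod_encode_2 less_le_trans)

lemma instr_code_pos: "0 < instr_code i"
  by (cases i) (simp_all add: prod_encode_pos)

lemma fetch_prog_code: "fetch (prog_code p) i = (if i < length p then instr_code (p ! i) else 0)"
proof (induction p arbitrary: i)
  case Nil
  have "prod_decode 0 = (0, 0)" using prod_encode_inverse[of "(0, 0)"] by (simp add: prod_encode_def)
  then have "((\<lambda>y. snd (prod_decode y)) ^^ i) 0 = 0" by (induction i) simp_all
  then show ?case using \<open>prod_decode 0 = (0, 0)\<close> by (simp add: fetch_def prog_code_def)
next
  case (Cons a p)
  have fetch_Suc: "fetch x (Suc i) = fetch (snd (prod_decode x)) i" for x i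
    unfolding fetch_def funpow_Suc_right by simp
  show ?case
  proof (cases i)
    case 0
    then show ?thesis by (simp add: fetch_def prog_code_def)
  next
    case (Suc j)
    have "fetch (prog_code (a # p)) (Suc j) = fetch (prog_code p) j"
      unfolding fetch_Suc by (simp add: prog_code_def)
    then show ?thesis using Cons.IH Suc by simp
  qed
qed

definition represents :: "nat \<Rightarrow> nat \<times> (nat \<Rightarrow> nat) \<Rightarrow> bool" where
  "represents s c \<longleftrightarrow> (\<exists>n>0. s = prod_encode (fst c, n) \<and> (\<forall>r. multiplicity (reg_prime r) n = snd c r))"

text \<open>Distinct registers have distinct primes, so multiplying or dividing by one prime changes
  one exponent by 1, and divisibility by it is the test that the register is nonzero.\<close>

lemma represents_step:
  assumes "represents s c"
  shows "represents (ustep (prog_code p) s) (rm_step p c)"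
proof -
  obtain i v where c: "c = (i, v)" by fastforce
  obtain n where n: "n > 0" "s = prod_encode (i, n)" "\<And>r. multiplicity (reg_prime r) n = v r"
    using assms unfolding represents_def c by auto
  show ?thesis
  proof (cases "i < length p")
    case False
    then have "ustep (prog_code p) s = s" by (simp add: ustep_def n(2) fetch_prog_code)
    then show ?thesis using assms False by (simp add: c)
  next
    case True
    show ?thesis
    proof (cases "p ! i")
      case (Inc r j)
      have pos: "reg_prime r > 0" using prime_reg_prime prime_gt_0_nat by blast
      have "ustep (prog_code p) s = prod_encode (j, reg_prime r * n)"
        using True Inc instr_code_pos[of "Inc r j"] by (simp add: ustep_def n(2) fetch_prog_code)
      moreover have "multiplicity (reg_prime r') (reg_prime r * n) = (v(r := Suc (v r))) r'" for r'
        using n(1,3) pos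
        by (subst prime_elem_multiplicity_mult_distrib)
          (auto simp: multiplicity_reg_prime prime_reg_prime)
      ultimately show ?thesis using True Inc n(1) pos by (auto simp: represents_def c)
    next
      case (Dec r j k)
      let ?q = "reg_prime r"
      have pos: "?q > 0" using prime_reg_prime prime_gt_0_nat by blast
      have dvd: "?q dvd n \<longleftrightarrow> v r \<noteq> 0"
        using n prime_reg_prime[of r] by (metis multiplicity_eq_zero_iff not_prime_unit not_less_zero)
      have step: "ustep (prog_code p) s =
          (if ?q * (n div ?q) = n then prod_encode (j, n div ?q) else prod_encode (k, n))"
        using True Dec instr_code_pos[of "Dec r j k"] by (simp add: ustep_def n(2) fetch_prog_code)
      show ?thesis
      proof (cases "v r = 0")
        case True': True
        then have "?q * (n div ?q) \<noteq> n" using dvd by (metis dvd_triv_left)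
        then show ?thesis using step True True' Dec n by (auto simp: represents_def c)
      next
        case False
        then have eq: "?q * (n div ?q) = n" using dvd by simp
        then have pos': "n div ?q > 0" using n(1) by (metis gr0I mult_0_right less_irrefl)
        have mult: "v r' = (if r' = r then 1 else 0) + multiplicity (reg_prime r') (n div ?q)" for r'
        proof -
          have "v r' = multiplicity (reg_prime r') (?q * (n div ?q))" using eq n(3) by simp
          also have "\<dots> = multiplicity (reg_prime r') ?q + multiplicity (reg_prime r') (n div ?q)"
            using pos pos' prime_reg_prime[of r']
            by (intro prime_elem_multiplicity_mult_distrib) simp_all
          finally show ?thesis by (simp add: multiplicity_reg_prime)
        qed
        have "multiplicity (reg_prime r') (n div ?q) = (v(r := v r - 1)) r'" for r'
          using mult[of r'] by auto
        then show ?thesis using step eq True False Dec pos' by (auto simp: represents_def c)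
      qed
    qed
  qed
qed

lemma represents_urun: "represents (urun (prog_code p) t) ((rm_step p ^^ t) (rm_init (prog_code p)))"
proof (induction t)
  case 0
  have "multiplicity (reg_prime r) (reg_prime 0 ^ x) = (if r = 0 then x else 0)" for r x
    using prime_reg_prime[of r] prime_reg_prime[of 0]
    by (subst prime_elem_multiplicity_power_distrib) (auto simp: multiplicity_reg_prime)
  moreover have "reg_prime 0 ^ x > 0" for x
    using prime_reg_prime prime_gt_0_nat by auto
  ultimately show ?case by (auto simp: represents_def urun_def rm_init_def)
next
  case (Suc t)
  then show ?case using represents_step by (simp add: urun_def)
qed

lemma halting_set_prog_code: "prog_code p \<in> halting_set \<longleftrightarrow> halts p (prog_code p)"
proof -
  have "running (prog_code p) t = 0 \<longleftrightarrow> length p \<le> fst ((rm_step p ^^ t) (rm_init (prog_code p)))" for t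
  proof -
    have "fst (prod_decode (urun (prog_code p) t)) = fst ((rm_step p ^^ t) (rm_init (prog_code p)))"
      using represents_urun[of p t] by (auto simp: represents_def)
    then show ?thesis using instr_code_pos[of "p ! fst ((rm_step p ^^ t) (rm_init (prog_code p)))"]
      by (auto simp: running_def fetch_prog_code)
  qed
  then show ?thesis by (simp add: halting_set_def halts_def)
qed

text \<open>Diagonalisation: with a decider as search predicate, independent of t, the search
  machine halts on x exactly if x lies outside \<open>halting_set\<close>. Its own code is then in
  the set iff it is not.\<close>

lemma halting_set_undecidable: "\<not> (\<forall>x. computes f [x] (if x \<in> halting_set then 1 else 0))"
proof
  assume f: "\<forall>x. computes f [x] (if x \<in> halting_set then 1 else 0)"
  have "computes (Comp f [Proj 0]) [x, t] (if x \<in> halting_set then 1 else 0)" for x t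
    by (rule computes_Comp[where ys = "[x]"]) (use f computes_Proj[of 0 "[x, t]"] in auto)
  then obtain p where "\<forall>x. halts p x \<longleftrightarrow> (\<exists>t::nat. (if x \<in> halting_set then 1 else 0) = (0::nat))"
    using machine_for_search[of _ "\<lambda>x t. if x \<in> halting_set then 1 else 0"] by fastforce
  then show False using halting_set_prog_code[of p] by (auto split: if_splits)
qed

text \<open>Membership is the existence of a halting time, which a machine finds by trying all
  times.\<close>

lemma machine_for_halting_set: "\<exists>p. \<forall>x. halts p x \<longleftrightarrow> x \<in> halting_set"
proof -
  obtain f where f: "\<And>xs. length xs = 2 \<Longrightarrow> computes f xs (running (xs ! 0) (xs ! 1))"
    using total_rec_running unfolding total_rec_def by blast
  have "computes f [x, t] (running x t)" for x t using f[of "[x, t]"] by simp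
  moreover have "running x t \<le> 1" for x t by (simp add: running_def)
  ultimately show ?thesis using machine_for_search[of f running] by (simp add: halting_set_def)
qed

section \<open>Token systems\<close>

text \<open>
  A configuration counts, for every set \<open>X\<close> of actions, the tokens that have performed exactly the
  actions in \<open>X\<close>. A rule \<open>(X, s, g)\<close> lets one token perform \<open>s\<close> after \<open>X\<close>, provided that the other
  tokens satisfy the exact counts prescribed by \<open>g\<close>.
\<close>

type_synonym rule = "nat set \<times> nat \<times> (nat set \<Rightarrow> nat option)"

definition guard_ok :: "(nat set \<Rightarrow> nat option) \<Rightarrow> (nat set \<Rightarrow> nat) \<Rightarrow> bool" where
  "guard_ok g c \<longleftrightarrow> (\<forall>Y n. g Y = Some n \<longrightarrow> c Y = n)"

definition take_token :: "nat set \<Rightarrow> (nat set \<Rightarrow> nat) \<Rightarrow> nat set \<Rightarrow> nat" where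
  "take_token X c = c(X := c X - 1)"

definition move_token :: "nat set \<Rightarrow> nat \<Rightarrow> (nat set \<Rightarrow> nat) \<Rightarrow> nat set \<Rightarrow> nat" where
  "move_token X s c = (take_token X c)(insert s X := Suc (c (insert s X)))"

inductive ts_reach :: "rule set \<Rightarrow> nat \<Rightarrow> (nat set \<Rightarrow> nat) \<Rightarrow> bool" for R k where
  ts_init: "ts_reach R k (\<lambda>Y. if Y = {} then k else 0)"
| ts_step: "ts_reach R k c \<Longrightarrow> (X, s, g) \<in> R \<Longrightarrow> 0 < c X \<Longrightarrow> guard_ok g (take_token X c)
    \<Longrightarrow> ts_reach R k (move_token X s c)"

definition ts_wins :: "rule set \<Rightarrow> nat set set \<Rightarrow> nat \<Rightarrow> bool" where
  "ts_wins R W k \<longleftrightarrow> (\<exists>c X. ts_reach R k c \<and> X \<in> W \<and> 0 < c X)"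

text \<open>With \<open>s\<close> outside \<open>X\<close> every move enlarges the action set of a
  token, which bounds runs. The empty set is not a target because the system has to make the first
  move of the game, so the initial configuration must not be won already.\<close>

locale token_system =
  fixes S :: "nat set" and R :: "rule set" and W :: "nat set set"
  assumes finite_S: "finite S" and finite_R: "finite R" and W: "W \<subseteq> Pow S" "{} \<notin> W"
    and rules: "(X, s, g) \<in> R \<Longrightarrow> X \<subseteq> S \<and> s \<in> S \<and> s \<notin> X \<and> dom g \<subseteq> Pow S"

section \<open>Edge machines and their encoding by tokens\<close>

datatype op = OInc nat | ODec nat | OTest nat nat

fun op_reg :: "op \<Rightarrow> nat" where
  "op_reg (OInc r) = r" | "op_reg (ODec r) = r" | "op_reg (OTest r n) = r"

fun op_sem :: "op \<Rightarrow> (nat \<Rightarrow> nat) \<Rightarrow> (nat \<Rightarrow> nat) \<Rightarrow> bool" where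
  "op_sem (OInc r) v v' \<longleftrightarrow> v' = v(r := Suc (v r))"
| "op_sem (ODec r) v v' \<longleftrightarrow> 0 < v r \<and> v' = v(r := v r - 1)"
| "op_sem (OTest r n) v v' \<longleftrightarrow> v r = n \<and> v' = v"

type_synonym edge = "nat \<times> op \<times> nat"

abbreviation (input) src :: "edge \<Rightarrow> nat" where "src e \<equiv> fst e"
abbreviation (input) eop :: "edge \<Rightarrow> op" where "eop e \<equiv> fst (snd e)"
abbreviation (input) tgt :: "edge \<Rightarrow> nat" where "tgt e \<equiv> snd (snd e)"

inductive em_reach :: "edge list \<Rightarrow> nat \<Rightarrow> (nat \<Rightarrow> nat) \<Rightarrow> bool" for es where
  em_init: "em_reach es 0 (\<lambda>_. 0)"
| em_step: "em_reach es (src (es ! j)) v \<Longrightarrow> j < length es \<Longrightarrow> op_sem (eop (es ! j)) v v'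
    \<Longrightarrow> em_reach es (tgt (es ! j)) v'"

text \<open>
  A token of edge \<open>j\<close> is born in \<open>LI j\<close>, is the current control state in \<open>LS j\<close>, and ends in
  \<open>LDead j\<close>. A token of register \<open>r\<close> counts for the value of the register while it is in \<open>LReg r\<close>.
\<close>

datatype loc = LFree | LI nat | LS nat | LDead nat | LInc nat | LReg nat | LDec nat | LGone nat

text \<open>The largest action is the first one performed and names the token: odd for an edge, even
  for a register. It is at least 4, so the actions 0 to 3, shared by all tokens, can record how far
  the token has come. This makes the map injective.\<close>

fun acts_of :: "loc \<Rightarrow> nat set" where
  "acts_of LFree = {}"
| "acts_of (LI j) = {5 + 2 * j}"
| "acts_of (LS j) = {0, 5 + 2 * j}"
| "acts_of (LDead j) = {1, 0, 5 + 2 * j}"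
| "acts_of (LInc r) = {4 + 2 * r}"
| "acts_of (LReg r) = {1, 4 + 2 * r}"
| "acts_of (LDec r) = {2, 1, 4 + 2 * r}"
| "acts_of (LGone r) = {3, 2, 1, 4 + 2 * r}"

fun new_act :: "loc \<Rightarrow> nat" where
  "new_act LFree = 0"
| "new_act (LI j) = 5 + 2 * j"
| "new_act (LS j) = 0"
| "new_act (LDead j) = 1"
| "new_act (LInc r) = 4 + 2 * r"
| "new_act (LReg r) = 1"
| "new_act (LDec r) = 2"
| "new_act (LGone r) = 3"

fun parent :: "loc \<Rightarrow> loc" where
  "parent LFree = LFree"
| "parent (LI j) = LFree"
| "parent (LS j) = LI j"
| "parent (LDead j) = LS j"
| "parent (LInc r) = LFree"
| "parent (LReg r) = LInc r"
| "parent (LDec r) = LReg r"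
| "parent (LGone r) = LDec r"

fun loc_of_acts :: "nat set \<Rightarrow> loc" where
  "loc_of_acts X = (if X = {} then LFree
     else if odd (Max X) then
       (let j = (Max X - 5) div 2 in if 1 \<in> X then LDead j else if 0 \<in> X then LS j else LI j)
     else (let r = (Max X - 4) div 2 in
       if 3 \<in> X then LGone r else if 2 \<in> X then LDec r else if 1 \<in> X then LReg r else LInc r))"

lemma loc_of_acts_of: "loc_of_acts (acts_of l) = l"
  by (cases l) (simp_all add: Let_def max_def)

lemma enc_eq_iff: "acts_of l = acts_of l' \<longleftrightarrow> l = l'"
  by (metis loc_of_acts_of)

lemma enc_child: "l' \<noteq> LFree \<Longrightarrow> acts_of l' = insert (new_act l') (acts_of (parent l')) \<and> new_act l' \<notin> acts_of (parent l')"
  by (cases l') auto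

type_synonym lrule = "loc \<times> loc set \<times> (nat \<times> nat) option"

locale edge_machine =
  fixes es :: "edge list" and nr :: nat
  assumes nr: "j < length es \<Longrightarrow> op_reg (eop (es ! j)) < nr"
begin

text \<open>On these locations every rule prescribes the exact number of tokens. The pool, the
  registers and the two final kinds of location hold arbitrarily many tokens and are left open,
  except for the register of a test.\<close>

definition ctl :: "loc set" where
  "ctl = LI ` {..<length es} \<union> LS ` {..<length es} \<union> LInc ` {..<nr} \<union> LDec ` {..<nr}"

definition ctl_is :: "loc set \<Rightarrow> (loc \<Rightarrow> nat) \<Rightarrow> bool" where
  "ctl_is A c \<longleftrightarrow> (\<forall>l\<in>ctl. c l = (if l \<in> A then 1 else 0))"

text \<open>
  A rule \<open>(l, A, T)\<close> moves a token from the parent of \<open>l\<close> to \<open>l\<close> when the control tokens other than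
  the moved one are exactly those of \<open>A\<close>, one each.
\<close>

fun op_rules :: "nat \<Rightarrow> op \<Rightarrow> lrule set" where
  "op_rules j (OInc r) = {(LInc r, {LI j}, None), (LS j, {LInc r}, None), (LReg r, {LS j}, None)}"
| "op_rules j (ODec r) = {(LDec r, {LI j}, None), (LS j, {LDec r}, None), (LGone r, {LS j}, None)}"
| "op_rules j (OTest r n) = {(LS j, {}, Some (r, n))}"

text \<open>An edge token serves for one step only. Its successor is born next to it before it dies,
  so after the start some control token is always present, and the rules with empty control
  condition for \<open>LI\<close> fire only at the start. \<open>LS i\<close> and
  \<open>LI j\<close> occur together only for consecutive edges, so dying needs no such
  condition.\<close>

definition flow_rules :: "lrule set" where
  "flow_rules = {(LI j, {}, None) |j. j < length es \<and> src (es ! j) = 0} \<union>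
     {(LI j, {LS i}, None) |i j. i < length es \<and> j < length es \<and> tgt (es ! i) = src (es ! j)} \<union>
     {(LDead i, {LI j}, None) |i j. i < length es \<and> j < length es}"

text \<open>In \<open>op_rules\<close> an increment or decrement takes three moves: the register
  token enters \<open>LInc\<close> or \<open>LDec\<close>, the edge token answers by entering
  \<open>LS\<close>, and the register token moves on. Each move is enabled by exactly the control
  tokens that the previous one leaves. A test changes no register, so it guards the move of the edge
  token directly.\<close>

definition lrules :: "lrule set" where
  "lrules = flow_rules \<union> (\<Union>j<length es. op_rules j (eop (es ! j)))"

definition lmove :: "loc \<Rightarrow> (loc \<Rightarrow> nat) \<Rightarrow> loc \<Rightarrow> nat" where
  "lmove l c = c(parent l := c (parent l) - 1, l := Suc (c l))"

definition enabled :: "lrule \<Rightarrow> (loc \<Rightarrow> nat) \<Rightarrow> bool" where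
  "enabled \<rho> c \<longleftrightarrow> (case \<rho> of (l, A, T) \<Rightarrow> 0 < c (parent l) \<and>
     ctl_is A (c(parent l := c (parent l) - 1)) \<and>
     (\<forall>r n. T = Some (r, n) \<longrightarrow> (c(parent l := c (parent l) - 1)) (LReg r) = n))"

inductive lreach :: "nat \<Rightarrow> (loc \<Rightarrow> nat) \<Rightarrow> bool" for k where
  lreach_init: "lreach k (\<lambda>l. if l = LFree then k else 0)"
| lreach_step: "lreach k c \<Longrightarrow> \<rho> \<in> lrules \<Longrightarrow> enabled \<rho> c \<Longrightarrow> lreach k (lmove (fst \<rho>) c)"

text \<open>The two clauses do not compete, since \<open>LReg r\<close> is never a control location
  (\<open>LReg_notin_ctl\<close>).\<close>

definition guard :: "loc set \<Rightarrow> (nat \<times> nat) option \<Rightarrow> nat set \<Rightarrow> nat option" where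
  "guard A T Y = (if Y \<in> acts_of ` ctl then Some (if Y \<in> acts_of ` A then 1 else 0)
     else case T of None \<Rightarrow> None | Some (r, n) \<Rightarrow> if Y = acts_of (LReg r) then Some n else None)"

definition rule_of :: "lrule \<Rightarrow> rule" where
  "rule_of \<rho> = (case \<rho> of (l, A, T) \<Rightarrow> (acts_of (parent l), new_act l, guard A T))"

definition acts_bound :: "nat set" where
  "acts_bound = {..<5 + 2 * (length es + nr)}"

definition target_locs :: "nat set \<Rightarrow> nat set set" where
  "target_locs H = {acts_of (LS j) |j. j < length es \<and> tgt (es ! j) \<in> H}"

lemma LReg_notin_ctl: "LReg r \<notin> ctl"
  unfolding ctl_def by auto

lemma guard_ok_iff:
  "guard_ok (guard A T) c \<longleftrightarrow>
    ctl_is A (c \<circ> acts_of) \<and> (\<forall>r n. T = Some (r, n) \<longrightarrow> c (acts_of (LReg r)) = n)"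
proof
  assume g: "guard_ok (guard A T) c"
  have "ctl_is A (c \<circ> acts_of)"
    unfolding ctl_is_def
  proof
    fix l assume l: "l \<in> ctl"
    then have "guard A T (acts_of l) = Some (if l \<in> A then 1 else 0)"
      by (auto simp: guard_def enc_eq_iff simp del: acts_of.simps)
    then show "(c \<circ> acts_of) l = (if l \<in> A then 1 else 0)" using g unfolding guard_ok_def by auto
  qed
  moreover have "c (acts_of (LReg r)) = n" if "T = Some (r, n)" for r n
  proof -
    have "guard A T (acts_of (LReg r)) = Some n"
      using that LReg_notin_ctl by (auto simp: guard_def enc_eq_iff simp del: acts_of.simps)
    then show ?thesis using g unfolding guard_ok_def by auto
  qed
  ultimately show "ctl_is A (c \<circ> acts_of) \<and> (\<forall>r n. T = Some (r, n) \<longrightarrow> c (acts_of (LReg r)) = n)" by blast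
next
  assume *: "ctl_is A (c \<circ> acts_of) \<and> (\<forall>r n. T = Some (r, n) \<longrightarrow> c (acts_of (LReg r)) = n)"
  show "guard_ok (guard A T) c"
    unfolding guard_ok_def
  proof (intro allI impI)
    fix Y n assume Y: "guard A T Y = Some n"
    show "c Y = n"
    proof (cases "Y \<in> acts_of ` ctl")
      case True
      then obtain l where "l \<in> ctl" "Y = acts_of l" by blast
      then show ?thesis
        using Y * True by (auto simp: guard_def ctl_is_def enc_eq_iff simp del: acts_of.simps split: if_splits)
    next
      case False
      then show ?thesis using Y * by (auto simp: guard_def simp del: acts_of.simps split: option.splits if_splits)
    qed
  qed
qed

lemma lrules_child: "\<rho> \<in> lrules \<Longrightarrow> fst \<rho> \<noteq> LFree"
proof -
  have "\<rho> \<in> op_rules j q \<Longrightarrow> fst \<rho> \<noteq> LFree" for j q by (cases q) auto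
  then show "\<rho> \<in> lrules \<Longrightarrow> fst \<rho> \<noteq> LFree" unfolding lrules_def flow_rules_def by auto
qed

lemma take_token_enc:
  "take_token (acts_of l) c \<circ> acts_of = (c \<circ> acts_of)(l := (c \<circ> acts_of) l - 1)"
  by (auto simp: take_token_def fun_eq_iff enc_eq_iff simp del: acts_of.simps)

lemma move_token_enc:
  assumes "l \<noteq> LFree"
  shows "move_token (acts_of (parent l)) (new_act l) c \<circ> acts_of = lmove l (c \<circ> acts_of)"
  using enc_child[OF assms]
  by (auto simp: move_token_def take_token_def lmove_def fun_eq_iff enc_eq_iff simp del: acts_of.simps
      dest!: sym[of "acts_of l"])

lemma enabled_iff:
  "enabled (l, A, T) (c \<circ> acts_of) \<longleftrightarrow>
    0 < c (acts_of (parent l)) \<and> guard_ok (guard A T) (take_token (acts_of (parent l)) c)"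
proof -
  have "take_token (acts_of (parent l)) c (acts_of (LReg r)) =
      ((c \<circ> acts_of)(parent l := (c \<circ> acts_of) (parent l) - 1)) (LReg r)" for r
    by (metis take_token_enc comp_apply)
  then show ?thesis unfolding enabled_def guard_ok_iff take_token_enc by simp
qed

text \<open>Moves commute with reading a configuration through \<open>acts_of\<close>. Sets that
  encode no location are forgotten in this reading, hence the existential quantifier.\<close>

lemma lreach_imp_ts_reach:
  "lreach k c \<Longrightarrow> \<exists>c'. ts_reach (rule_of ` lrules) k c' \<and> c' \<circ> acts_of = c"
proof (induction rule: lreach.induct)
  case lreach_init
  have "(\<lambda>Y. if Y = {} then k else 0) \<circ> acts_of = (\<lambda>l. if l = LFree then k else 0)"
    using enc_eq_iff[of _ LFree] by (auto simp: fun_eq_iff)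
  then show ?case using ts_init by blast
next
  case (lreach_step c \<rho>)
  then obtain c' where c': "ts_reach (rule_of ` lrules) k c'" "c' \<circ> acts_of = c" by blast
  obtain l A T where \<rho>: "\<rho> = (l, A, T)" by (metis prod_cases3)
  have "(acts_of (parent l), new_act l, guard A T) \<in> rule_of ` lrules"
    using lreach_step(2) unfolding \<rho> by (force simp: rule_of_def)
  moreover have "0 < c' (acts_of (parent l)) \<and> guard_ok (guard A T) (take_token (acts_of (parent l)) c')"
    using lreach_step(3) unfolding \<rho> enabled_iff c'(2)[symmetric] .
  ultimately have "ts_reach (rule_of ` lrules) k (move_token (acts_of (parent l)) (new_act l) c')"
    using c'(1) by (blast intro: ts_step)
  moreover have "move_token (acts_of (parent l)) (new_act l) c' \<circ> acts_of = lmove (fst \<rho>) c"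
    using move_token_enc lrules_child[OF lreach_step(2)] c'(2) by (simp add: \<rho>)
  ultimately show ?case by blast
qed

lemma ts_reach_imp_lreach:
  "ts_reach (rule_of ` lrules) k c \<Longrightarrow> lreach k (c \<circ> acts_of)"
proof (induction rule: ts_reach.induct)
  case ts_init
  have "(\<lambda>Y. if Y = {} then k else 0) \<circ> acts_of = (\<lambda>l. if l = LFree then k else 0)"
    using enc_eq_iff[of _ LFree] by (auto simp: fun_eq_iff)
  then show ?case using lreach_init by metis
next
  case (ts_step c X s g)
  from ts_step(2) obtain \<rho> where \<rho>: "\<rho> \<in> lrules" "(X, s, g) = rule_of \<rho>" by blast
  obtain l A T where l: "\<rho> = (l, A, T)" by (metis prod_cases3)
  have X: "X = acts_of (parent l)" "s = new_act l" "g = guard A T" using \<rho>(2) by (simp_all add: l rule_of_def)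
  have "enabled \<rho> (c \<circ> acts_of)" using ts_step(3,4) unfolding l enabled_iff X by blast
  from lreach_step[OF ts_step(5) \<rho>(1) this] show ?case
    using move_token_enc[of l c] lrules_child[OF \<rho>(1)] by (simp add: X l)
qed

lemma token_system: "token_system acts_bound (rule_of ` lrules) (target_locs H)"
proof
  have "finite (op_rules j q)" for j q by (cases q) auto
  moreover have "finite flow_rules"
  proof (rule finite_subset)
    let ?m = "{..<length es}"
    show "flow_rules \<subseteq> (\<lambda>j. (LI j, {}, None)) ` ?m \<union>
        (\<lambda>(i, j). (LI j, {LS i}, None)) ` (?m \<times> ?m) \<union> (\<lambda>(i, j). (LDead i, {LI j}, None)) ` (?m \<times> ?m)"
      unfolding flow_rules_def by auto
  qed simp
  ultimately show "finite (rule_of ` lrules)" by (simp add: lrules_def)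
  show "finite acts_bound" by (simp add: acts_bound_def)
  show "target_locs H \<subseteq> Pow acts_bound" "{} \<notin> target_locs H"
    by (auto simp: target_locs_def acts_bound_def)
  fix X s g assume "(X, s, g) \<in> rule_of ` lrules"
  then obtain l A T where l: "(l, A, T) \<in> lrules" and
    X: "X = acts_of (parent l)" "s = new_act l" "g = guard A T"
    by (auto simp: rule_of_def)
  have ops: "acts_of l \<subseteq> acts_bound \<and> (\<forall>r n. T = Some (r, n) \<longrightarrow> r < nr)"
    if "j < length es" "(l, A, T) \<in> op_rules j (eop (es ! j))" for j
    using that nr[of j] by (cases "eop (es ! j)") (auto simp: acts_bound_def)
  have l_T: "acts_of l \<subseteq> acts_bound" "\<And>r n. T = Some (r, n) \<Longrightarrow> r < nr"
    using l ops unfolding lrules_def by (auto simp: flow_rules_def acts_bound_def)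
  have ctl: "acts_of ` ctl \<subseteq> Pow acts_bound"
    unfolding ctl_def acts_bound_def by (auto simp: image_Un)
  have reg: "acts_of (LReg r) \<in> Pow acts_bound" if "r < nr" for r
    using that by (auto simp: acts_bound_def)
  have dom: "Y \<in> acts_of ` ctl \<or> (\<exists>r n. T = Some (r, n) \<and> Y = acts_of (LReg r))" if "Y \<in> dom (guard A T)" for Y
    using that by (auto simp: guard_def simp del: acts_of.simps split: option.splits if_splits)
  have "dom (guard A T) \<subseteq> Pow acts_bound"
  proof
    fix Y assume "Y \<in> dom (guard A T)"
    from dom[OF this] show "Y \<in> Pow acts_bound"
    proof (elim disjE exE conjE)
      assume "Y \<in> acts_of ` ctl"
      then show ?thesis using ctl by (rule subsetD[rotated])
    next
      fix r n assume "T = Some (r, n)" "Y = acts_of (LReg r)"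
      then show ?thesis using l_T(2) reg by (simp del: acts_of.simps)
    qed
  qed
  then show "X \<subseteq> acts_bound \<and> s \<in> acts_bound \<and> s \<notin> X \<and> dom g \<subseteq> Pow acts_bound"
    using enc_child[of l] lrules_child[OF l] l_T(1) unfolding X fst_conv by blast
qed

section \<open>Soundness: token runs follow machine runs\<close>

lemma ctl_is_unique: "ctl_is A c \<Longrightarrow> ctl_is B c \<Longrightarrow> A \<subseteq> ctl \<Longrightarrow> B \<subseteq> ctl \<Longrightarrow> A = B"
  unfolding ctl_is_def by (smt (verit) subsetD subsetI subset_antisym zero_neq_one)

text \<open>A register changes only when a token enters or leaves \<open>LReg r\<close>, and
  \<open>LDec r\<close> is the only location with that parent.\<close>

definition vmove :: "loc \<Rightarrow> (nat \<Rightarrow> nat) \<Rightarrow> nat \<Rightarrow> nat" where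
  "vmove l v = (case l of LReg r \<Rightarrow> v(r := Suc (v r)) | LDec r \<Rightarrow> v(r := v r - 1) | _ \<Rightarrow> v)"

lemma lmove_regs: "(\<lambda>r. lmove l c (LReg r)) = vmove l (\<lambda>r. c (LReg r))"
  by (cases l) (auto simp: lmove_def vmove_def fun_eq_iff)

lemma parent_neq: "l \<noteq> LFree \<Longrightarrow> parent l \<noteq> l"
  by (cases l) auto

lemma ctl_is_take:
  assumes "A \<subseteq> ctl" "parent l \<notin> A" "0 < c (parent l)"
    "ctl_is A (c(parent l := c (parent l) - 1))"
  shows "ctl_is (A \<union> ({parent l} \<inter> ctl)) c"
  unfolding ctl_is_def
proof
  fix l' assume l': "l' \<in> ctl"
  with assms(4) have "(c(parent l := c (parent l) - 1)) l' = (if l' \<in> A then 1 else 0)"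
    unfolding ctl_is_def by blast
  then show "c l' = (if l' \<in> A \<union> ({parent l} \<inter> ctl) then 1 else 0)"
    using assms(2,3) l' by (cases "l' = parent l") simp_all
qed

lemma ctl_is_put:
  assumes "ctl_is A (c(parent l := c (parent l) - 1))" "l \<noteq> LFree" "l \<notin> A"
  shows "ctl_is (A \<union> ({l} \<inter> ctl)) (lmove l c)"
  unfolding ctl_is_def
proof
  fix l' assume l': "l' \<in> ctl"
  with assms(1) have "(c(parent l := c (parent l) - 1)) l' = (if l' \<in> A then 1 else 0)"
    unfolding ctl_is_def by blast
  then show "lmove l c l' = (if l' \<in> A \<union> ({l} \<inter> ctl) then 1 else 0)"
    using assms(3) parent_neq[OF assms(2)] l' unfolding lmove_def by (cases "l' = l") simp_all
qed

lemma lrules_cases: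
  assumes "(l, A, T) \<in> lrules"
  obtains (start) j where "l = LI j" "A = {}" "T = None" "j < length es" "src (es ! j) = 0"
  | (cont) i j where "l = LI j" "A = {LS i}" "T = None" "i < length es" "j < length es" "tgt (es ! i) = src (es ! j)"
  | (die) i j where "l = LDead i" "A = {LI j}" "T = None" "i < length es" "j < length es"
  | (inc1) j r where "l = LInc r" "A = {LI j}" "T = None" "j < length es" "eop (es ! j) = OInc r"
  | (inc2) j r where "l = LS j" "A = {LInc r}" "T = None" "j < length es" "eop (es ! j) = OInc r"
  | (inc3) j r where "l = LReg r" "A = {LS j}" "T = None" "j < length es" "eop (es ! j) = OInc r"
  | (dec1) j r where "l = LDec r" "A = {LI j}" "T = None" "j < length es" "eop (es ! j) = ODec r"
  | (dec2) j r where "l = LS j" "A = {LDec r}" "T = None" "j < length es" "eop (es ! j) = ODec r"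
  | (dec3) j r where "l = LGone r" "A = {LS j}" "T = None" "j < length es" "eop (es ! j) = ODec r"
  | (test) j r n where "l = LS j" "A = {}" "T = Some (r, n)" "j < length es" "eop (es ! j) = OTest r n"
proof -
  from assms consider "(l, A, T) \<in> flow_rules" | j where "j < length es" "(l, A, T) \<in> op_rules j (eop (es ! j))"
    unfolding lrules_def by blast
  then show thesis
  proof cases
    case 1
    then show thesis unfolding flow_rules_def using start cont die by blast
  next
    case (2 j)
    then show thesis
      by (cases "eop (es ! j)") (auto intro: inc1 inc2 inc3 dec1 dec2 dec3 test)
  qed
qed

lemma op_rulesD: "j < length es \<Longrightarrow> \<rho> \<in> op_rules j (eop (es ! j)) \<Longrightarrow> \<rho> \<in> lrules"
  unfolding lrules_def by blast

lemma lrules_ctl: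
  assumes "(l, A, T) \<in> lrules"
  shows "A \<subseteq> ctl \<and> parent l \<notin> A \<and> l \<noteq> LFree \<and> l \<notin> A"
  using assms
  by (cases rule: lrules_cases) (use nr in \<open>force simp: ctl_def\<close>)+

text \<open>The invariant ties the set of occupied control locations to a reachable machine
  configuration. A machine step is charged when the handshake begins. In \<open>ph_inc\<close> the
  register token has not yet arrived, so the machine is one ahead of \<open>v\<close>; in
  \<open>ph_dec\<close> it has already left, so the values agree.\<close>

inductive phase :: "loc set \<Rightarrow> (nat \<Rightarrow> nat) \<Rightarrow> bool" where
  ph_init: "phase {} (\<lambda>_. 0)"
| ph_idle: "i < length es \<Longrightarrow> em_reach es (tgt (es ! i)) v \<Longrightarrow> phase {LS i} v"
| ph_next: "i < length es \<Longrightarrow> j < length es \<Longrightarrow> tgt (es ! i) = src (es ! j)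
    \<Longrightarrow> em_reach es (src (es ! j)) v \<Longrightarrow> phase {LS i, LI j} v"
| ph_exec: "j < length es \<Longrightarrow> em_reach es (src (es ! j)) v \<Longrightarrow> phase {LI j} v"
| ph_inc: "j < length es \<Longrightarrow> eop (es ! j) = OInc r \<Longrightarrow> em_reach es (tgt (es ! j)) (v(r := Suc (v r)))
    \<Longrightarrow> l = LI j \<or> l = LS j \<Longrightarrow> phase {l, LInc r} v"
| ph_dec: "j < length es \<Longrightarrow> eop (es ! j) = ODec r \<Longrightarrow> em_reach es (tgt (es ! j)) v
    \<Longrightarrow> l = LI j \<or> l = LS j \<Longrightarrow> phase {l, LDec r} v"

lemma in_ctl [simp]:
  "LI j \<in> ctl \<longleftrightarrow> j < length es" "LS j \<in> ctl \<longleftrightarrow> j < length es"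
  "LInc r \<in> ctl \<longleftrightarrow> r < nr" "LDec r \<in> ctl \<longleftrightarrow> r < nr"
  "LFree \<notin> ctl" "LDead j \<notin> ctl" "LReg r \<notin> ctl" "LGone r \<notin> ctl"
  unfolding ctl_def by auto

lemma phase_idleD: "phase {LS i} v \<Longrightarrow> em_reach es (tgt (es ! i)) v"
  by (erule phase.cases) (auto simp: doubleton_eq_iff)

lemma phase_nextD: "phase {LI j, LS i} v \<Longrightarrow> em_reach es (src (es ! j)) v"
  by (erule phase.cases) (auto simp: doubleton_eq_iff)

lemma phase_execD: "phase {LI j} v \<Longrightarrow> em_reach es (src (es ! j)) v"
  by (erule phase.cases) (auto simp: doubleton_eq_iff)

lemma phase_incD:
  "phase {LInc r, l} v \<Longrightarrow> l = LI j \<or> l = LS j \<Longrightarrow> em_reach es (tgt (es ! j)) (v(r := Suc (v r)))"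
  by (erule phase.cases) (auto simp: doubleton_eq_iff)

lemma phase_decD:
  "phase {LDec r, l} v \<Longrightarrow> l = LI j \<or> l = LS j \<Longrightarrow> em_reach es (tgt (es ! j)) v"
  by (erule phase.cases) (auto simp: doubleton_eq_iff)

lemma phase_emptyD: "phase {} v \<Longrightarrow> v = (\<lambda>_. 0)"
  by (erule phase.cases) auto

text \<open>The control tokens named by a rule, together with the moved one, determine the phase
  before the move. The machine advances in the cases \<open>inc1\<close>, \<open>dec1\<close> and
  \<open>test\<close>; all other moves complete a handshake or pass control on.\<close>

lemma phase_step:
  assumes ph: "phase (A \<union> ({parent l} \<inter> ctl)) v" and rule: "(l, A, T) \<in> lrules"
    and T: "\<And>r n. T = Some (r, n) \<Longrightarrow> v r = n" and pos: "\<And>r. parent l = LReg r \<Longrightarrow> 0 < v r"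
  shows "phase (A \<union> ({l} \<inter> ctl)) (vmove l v)"
  using rule
proof (cases rule: lrules_cases)
  case (start j)
  then have "v = (\<lambda>_. 0)" using ph phase_emptyD by simp
  then show ?thesis using start ph_exec[of j "\<lambda>_. 0"] em_init by (simp add: vmove_def)
next
  case (cont i j)
  then have "em_reach es (tgt (es ! i)) v" using ph phase_idleD[of i v] by simp
  then show ?thesis using cont ph_next[of i j v] by (simp add: vmove_def insert_commute)
next
  case (die i j)
  then have "em_reach es (src (es ! j)) v" using ph phase_nextD[of j i v] by (simp add: insert_commute)
  then show ?thesis using die ph_exec[of j v] by (simp add: vmove_def)
next
  case (inc1 j r)
  then have "em_reach es (src (es ! j)) v" using ph phase_execD by simp
  then have "em_reach es (tgt (es ! j)) (v(r := Suc (v r)))" by (rule em_step) (use inc1 in simp_all)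
  then show ?thesis using inc1 nr[of j] ph_inc[of j r v "LI j"] by (simp add: vmove_def insert_commute)
next
  case (inc2 j r)
  then have "em_reach es (tgt (es ! j)) (v(r := Suc (v r)))"
    using ph phase_incD[of r "LI j" v j] by (simp add: insert_commute)
  then show ?thesis using inc2 ph_inc[of j r v "LS j"] by (simp add: vmove_def insert_commute)
next
  case (inc3 j r)
  then have "em_reach es (tgt (es ! j)) (v(r := Suc (v r)))"
    using ph nr[of j] phase_incD[of r "LS j" v j] by (simp add: insert_commute)
  then show ?thesis using inc3 ph_idle[of j "v(r := Suc (v r))"] by (simp add: vmove_def)
next
  case (dec1 j r)
  then have "em_reach es (src (es ! j)) v" using ph phase_execD by simp
  then have "em_reach es (tgt (es ! j)) (v(r := v r - 1))" by (rule em_step) (use dec1 pos in simp_all)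
  then show ?thesis using dec1 nr[of j] ph_dec[of j r "v(r := v r - 1)" "LI j"] by (simp add: vmove_def insert_commute)
next
  case (dec2 j r)
  then have "em_reach es (tgt (es ! j)) v"
    using ph phase_decD[of r "LI j" v j] by (simp add: insert_commute)
  then show ?thesis using dec2 ph_dec[of j r v "LS j"] by (simp add: vmove_def insert_commute)
next
  case (dec3 j r)
  then have "em_reach es (tgt (es ! j)) v"
    using ph nr[of j] phase_decD[of r "LS j" v j] by (simp add: insert_commute)
  then show ?thesis using dec3 ph_idle[of j v] by (simp add: vmove_def)
next
  case (test j r n)
  then have "em_reach es (src (es ! j)) v" using ph phase_execD by simp
  then have "em_reach es (tgt (es ! j)) v" by (rule em_step) (use test T in simp_all)
  then show ?thesis using test ph_idle[of j v] by (simp add: vmove_def)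
qed

lemma phase_ctl: "phase A v \<Longrightarrow> A \<subseteq> ctl"
proof (erule phase.cases)
  fix j r assume "j < length es" "eop (es ! j) = OInc r \<or> eop (es ! j) = ODec r"
  then have "r < nr" using nr[of j] by auto
qed (use nr in \<open>force+\<close>)

lemma lreach_phase:
  "lreach k c \<Longrightarrow> \<exists>A. ctl_is A c \<and> phase A (\<lambda>r. c (LReg r))"
proof (induction rule: lreach.induct)
  case lreach_init
  show ?case using ph_init by (intro exI[of _ "{}"]) (auto simp: ctl_is_def)
next
  case (lreach_step c \<rho>)
  obtain l A T where \<rho>: "\<rho> = (l, A, T)" by (metis prod_cases3)
  note rule = lreach_step(2)[unfolded \<rho>]
  note A = lrules_ctl[OF rule]
  have en: "0 < c (parent l)" "ctl_is A (c(parent l := c (parent l) - 1))"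
    "\<And>r n. T = Some (r, n) \<Longrightarrow> (c(parent l := c (parent l) - 1)) (LReg r) = n"
    using lreach_step(3) by (auto simp: enabled_def \<rho>)
  have c: "ctl_is (A \<union> ({parent l} \<inter> ctl)) c" using A en by (intro ctl_is_take) auto
  obtain A0 where A0: "ctl_is A0 c" "phase A0 (\<lambda>r. c (LReg r))" using lreach_step.IH by blast
  \<comment> \<open>The control set demanded by the enabled rule and the one known from the
    invariant both describe \<open>c\<close>, so they coincide.\<close>
  have "A0 = A \<union> ({parent l} \<inter> ctl)"
    using A phase_ctl[OF A0(2)] by (intro ctl_is_unique[OF A0(1) c]) auto
  then have ph: "phase (A \<union> ({parent l} \<inter> ctl)) (\<lambda>r. c (LReg r))" using A0(2) by simp
  have "phase (A \<union> ({l} \<inter> ctl)) (vmove l (\<lambda>r. c (LReg r)))"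
  proof (rule phase_step[OF ph rule])
    show "c (LReg r) = n" if "T = Some (r, n)" for r n
    proof -
      have "parent l \<noteq> LReg r" using rule that by (cases rule: lrules_cases) auto
      then show ?thesis using en(3)[OF that] by simp
    qed
    show "0 < c (LReg r)" if "parent l = LReg r" for r using en(1) that by simp
  qed
  moreover have "ctl_is (A \<union> ({l} \<inter> ctl)) (lmove l c)" using en(2) A by (intro ctl_is_put) auto
  ultimately show ?case unfolding \<rho> fst_conv lmove_regs by blast
qed

section \<open>Completeness: machine runs are simulated with enough tokens\<close>

definition good :: "nat \<Rightarrow> loc set \<Rightarrow> (nat \<Rightarrow> nat) \<Rightarrow> nat \<Rightarrow> bool" where
  "good k A v N \<longleftrightarrow> (\<exists>c. lreach k c \<and> ctl_is A c \<and> (\<lambda>r. c (LReg r)) = v \<and> N \<le> c LFree)"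

lemma good_step:
  assumes "good k B v N" and rule: "(l, A, T) \<in> lrules" and B: "B = A \<union> ({parent l} \<inter> ctl)"
    and T: "\<And>r n. T = Some (r, n) \<Longrightarrow> v r = n"
    and pos: "\<And>r. parent l = LReg r \<Longrightarrow> 0 < v r" and N: "0 < N"
    and parent: "parent l \<in> ctl \<or> parent l = LFree \<or> (\<exists>r. parent l = LReg r)"
  shows "good k (A \<union> ({l} \<inter> ctl)) (vmove l v) (if parent l = LFree then N - 1 else N)"
proof -
  note A = lrules_ctl[OF rule]
  obtain c where c: "lreach k c" "ctl_is B c" "(\<lambda>r. c (LReg r)) = v" "N \<le> c LFree"
    using assms(1) unfolding good_def by blast
  have pos': "0 < c (parent l)"
  proof (cases "parent l \<in> ctl")
    case True
    then show ?thesis using c(2) by (simp add: B ctl_is_def)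
  next
    case False
    then show ?thesis using parent pos c(3,4) N by auto
  qed
  have take: "ctl_is A (c(parent l := c (parent l) - 1))"
    using c(2) A unfolding ctl_is_def B by auto
  have noreg: "parent l \<noteq> LReg r" if "T = Some (r, n)" for r n
    using rule that by (cases rule: lrules_cases) auto
  have T': "(c(parent l := c (parent l) - 1)) (LReg r) = n" if "T = Some (r, n)" for r n
    using T[OF that] noreg[OF that] c(3) by auto
  have "enabled (l, A, T) c" using pos' take T' by (simp add: enabled_def)
  then have "lreach k (lmove l c)" using lreach_step[OF c(1) rule] by simp
  moreover have "ctl_is (A \<union> ({l} \<inter> ctl)) (lmove l c)" using take A by (intro ctl_is_put) auto
  moreover have "(if parent l = LFree then N - 1 else N) \<le> lmove l c LFree"
    using c(4) A by (auto simp: lmove_def)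
  ultimately show ?thesis unfolding good_def using lmove_regs c(3) by blast
qed

lemma good_mono: "good k A v N \<Longrightarrow> M \<le> N \<Longrightarrow> good k A v M"
  unfolding good_def using le_trans by blast

lemma good_stepI:
  assumes "good k B v N" "(l, A, T) \<in> lrules" "B = A \<union> ({parent l} \<inter> ctl)"
    "\<And>r n. T = Some (r, n) \<Longrightarrow> v r = n" "\<And>r. parent l = LReg r \<Longrightarrow> 0 < v r" "0 < N"
    "parent l \<in> ctl \<or> parent l = LFree \<or> (\<exists>r. parent l = LReg r)"
    and "B' = A \<union> ({l} \<inter> ctl)" "v' = vmove l v" "M \<le> (if parent l = LFree then N - 1 else N)"
  shows "good k B' v' M"
  using good_mono[OF good_step[OF assms(1-7)] assms(10)] unfolding assms(8,9) .

text \<open>Before the first step no edge token exists; afterwards the state is the target of the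
  edge whose token is in \<open>LS\<close>.\<close>

definition at_state :: "nat \<Rightarrow> nat \<Rightarrow> (nat \<Rightarrow> nat) \<Rightarrow> nat \<Rightarrow> bool" where
  "at_state k p v N \<longleftrightarrow> p = 0 \<and> v = (\<lambda>_. 0) \<and> good k {} v N
     \<or> (\<exists>i<length es. tgt (es ! i) = p \<and> good k {LS i} v N)"

lemma at_state_exec:
  assumes "at_state k (src (es ! j)) v (Suc N)" "j < length es" "0 < N"
  shows "good k {LI j} v N"
  using assms(1) unfolding at_state_def
proof (elim disjE exE conjE)
  assume "src (es ! j) = 0" and g: "good k {} v (Suc N)"
  then have rule: "(LI j, {}, None) \<in> lrules"
    using assms(2) unfolding lrules_def flow_rules_def by blast
  show ?thesis by (rule good_stepI[OF g rule]) (use assms(2) in \<open>simp_all add: vmove_def\<close>)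
next
  fix i assume i: "i < length es" "tgt (es ! i) = src (es ! j)" and g: "good k {LS i} v (Suc N)"
  have r: "(LI j, {LS i}, None) \<in> lrules" "(LDead i, {LI j}, None) \<in> lrules"
    using i assms(2) unfolding lrules_def flow_rules_def by blast+
  have g': "good k {LS i, LI j} v N"
    by (rule good_stepI[OF g r(1)]) (use assms(2) in \<open>auto simp: vmove_def\<close>)
  show ?thesis
    by (rule good_stepI[OF g' r(2)]) (use assms i in \<open>auto simp: vmove_def\<close>)
qed

text \<open>A step takes one fresh edge token and, for an increment, one fresh register token. The
  third unit keeps the lower bound on free tokens positive, as \<open>good_step\<close>
  demands.\<close>

lemma at_state_step:
  assumes "at_state k (src (es ! j)) v (Suc (Suc (Suc N)))" "j < length es" "op_sem (eop (es ! j)) v v'"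
  shows "at_state k (tgt (es ! j)) v' N"
proof -
  have g: "good k {LI j} v (Suc (Suc N))" by (rule at_state_exec) (use assms in simp_all)
  have "good k {LS j} v' N"
  proof (cases "eop (es ! j)")
    case (OInc r)
    have r: "\<rho> \<in> lrules" if "\<rho> \<in> op_rules j (OInc r)" for \<rho>
      using op_rulesD[OF assms(2)] that OInc by simp
    have r1: "(LInc r, {LI j}, None) \<in> lrules" and r2: "(LS j, {LInc r}, None) \<in> lrules"
      and r3: "(LReg r, {LS j}, None) \<in> lrules" by (rule r, simp)+
    have nr': "r < nr" using nr[OF assms(2)] OInc by simp
    have g1: "good k {LI j, LInc r} v (Suc N)"
      by (rule good_stepI[OF g r1]) (use nr' assms(2) in \<open>auto simp: vmove_def\<close>)
    have g2: "good k {LS j, LInc r} v (Suc N)"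
      by (rule good_stepI[OF g1 r2]) (use nr' assms(2) in \<open>auto simp: vmove_def\<close>)
    show ?thesis
      by (rule good_stepI[OF g2 r3]) (use nr' assms(2,3) OInc in \<open>auto simp: vmove_def\<close>)
  next
    case (ODec r)
    have r: "\<rho> \<in> lrules" if "\<rho> \<in> op_rules j (ODec r)" for \<rho>
      using op_rulesD[OF assms(2)] that ODec by simp
    have r1: "(LDec r, {LI j}, None) \<in> lrules" and r2: "(LS j, {LDec r}, None) \<in> lrules"
      and r3: "(LGone r, {LS j}, None) \<in> lrules" by (rule r, simp)+
    have nr': "r < nr" using nr[OF assms(2)] ODec by simp
    have g1: "good k {LI j, LDec r} v' (Suc N)"
      by (rule good_stepI[OF g r1]) (use nr' assms(2,3) ODec in \<open>auto simp: vmove_def\<close>)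
    have g2: "good k {LS j, LDec r} v' (Suc N)"
      by (rule good_stepI[OF g1 r2]) (use nr' assms(2) in \<open>auto simp: vmove_def\<close>)
    show ?thesis
      by (rule good_stepI[OF g2 r3]) (use nr' assms(2,3) in \<open>auto simp: vmove_def\<close>)
  next
    case (OTest r n)
    have "(LS j, {}, Some (r, n)) \<in> lrules"
      by (rule op_rulesD[OF assms(2)]) (simp add: OTest)
    from g this show ?thesis
      by (rule good_stepI) (use assms(2,3) OTest in \<open>auto simp: vmove_def\<close>)
  qed
  then show ?thesis using assms(2) unfolding at_state_def by blast
qed

text \<open>The surplus \<open>N\<close> is arbitrary in the induction, so an earlier state can be
  requested with three more free tokens than the next one.\<close>

lemma em_reach_at_state: "em_reach es p v \<Longrightarrow> \<exists>k. at_state k p v N"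
proof (induction arbitrary: N rule: em_reach.induct)
  case em_init
  have "good N {} (\<lambda>_. 0) N"
    unfolding good_def using lreach_init by (force simp: ctl_is_def)
  then show ?case unfolding at_state_def by blast
next
  case (em_step j v v')
  then show ?case using at_state_step by blast
qed

text \<open>A target is recognised by a token in \<open>LS\<close>, which the initial state 0 lacks;
  hence 0 must not be a target.\<close>

theorem ts_wins_iff:
  assumes "0 \<notin> H"
  shows "(\<exists>k. ts_wins (rule_of ` lrules) (target_locs H) k) \<longleftrightarrow> (\<exists>p v. em_reach es p v \<and> p \<in> H)"
proof
  assume "\<exists>k. ts_wins (rule_of ` lrules) (target_locs H) k"
  then obtain k c j where c: "ts_reach (rule_of ` lrules) k c"
    and j: "j < length es" "tgt (es ! j) \<in> H" "0 < c (acts_of (LS j))"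
    unfolding ts_wins_def target_locs_def by blast
  obtain A where A: "ctl_is A (c \<circ> acts_of)" "phase A (\<lambda>r. (c \<circ> acts_of) (LReg r))"
    using lreach_phase[OF ts_reach_imp_lreach[OF c]] by blast
  have "LS j \<in> A" using A(1) j unfolding ctl_is_def by (metis comp_apply in_ctl(2) less_irrefl)
  with A(2) have "\<exists>v. em_reach es (tgt (es ! j)) v"
    by cases auto
  then show "\<exists>p v. em_reach es p v \<and> p \<in> H" using j(2) by blast
next
  assume "\<exists>p v. em_reach es p v \<and> p \<in> H"
  then obtain p v where p: "em_reach es p v" "p \<in> H" by blast
  obtain k where "at_state k p v 0" using em_reach_at_state[OF p(1)] by blast
  then obtain i where i: "i < length es" "tgt (es ! i) = p" "good k {LS i} v 0"
    using assms p(2) unfolding at_state_def by auto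
  obtain c where c: "lreach k c" "ctl_is {LS i} c" using i(3) unfolding good_def by blast
  obtain c' where c': "ts_reach (rule_of ` lrules) k c'" "c' \<circ> acts_of = c"
    using lreach_imp_ts_reach[OF c(1)] by blast
  have "c' (acts_of (LS i)) = 1" using c(2) i(1) c'(2) unfolding ctl_is_def by (metis comp_apply in_ctl(2) insertI1)
  then show "\<exists>k. ts_wins (rule_of ` lrules) (target_locs H) k"
    unfolding ts_wins_def target_locs_def using c'(1) i p(2)
    by (intro exI[of _ k] exI[of _ c'] exI[of _ "acts_of (LS i)"]) auto
qed

end

section \<open>Edge machines for register programs\<close>

fun instr_edges :: "nat \<Rightarrow> instr \<Rightarrow> edge list" where
  "instr_edges i (Inc r j) = [(Suc i, OInc r, Suc j)]"
| "instr_edges i (Dec r j k) = [(Suc i, ODec r, Suc j), (Suc i, OTest r 0, Suc k)]"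

text \<open>State 0 is a loading state and address i becomes state i + 1. The loop at 0 guesses the
  content of register 0, and the test accepts only the guess x, so the input is written nowhere
  else. The test is edge 1 for every program.\<close>

definition prog_edges :: "instr list \<Rightarrow> nat \<Rightarrow> edge list" where
  "prog_edges p x = (0, OInc 0, 0) # (0, OTest 0 x, 1) # concat (map (\<lambda>i. instr_edges i (p ! i)) [0..<length p])"

lemma prog_edges_cases:
  assumes "e \<in> set (prog_edges p x)"
  obtains "e = (0, OInc 0, 0)" | "e = (0, OTest 0 x, 1)"
  | i r j where "i < length p" "p ! i = Inc r j" "e = (Suc i, OInc r, Suc j)"
  | i r j k where "i < length p" "p ! i = Dec r j k" "e = (Suc i, ODec r, Suc j)"
  | i r j k where "i < length p" "p ! i = Dec r j k" "e = (Suc i, OTest r 0, Suc k)"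
proof -
  from assms consider "e = (0, OInc 0, 0)" | "e = (0, OTest 0 x, 1)"
    | i where "i < length p" "e \<in> set (instr_edges i (p ! i))"
    unfolding prog_edges_def by auto
  then show thesis
  proof cases
    case (3 i)
    then show thesis using that by (cases "p ! i") auto
  qed (use that in auto)
qed

lemma em_reach_edge:
  "em_reach es a v \<Longrightarrow> (a, q, b) \<in> set es \<Longrightarrow> op_sem q v v' \<Longrightarrow> em_reach es b v'"
  using em_step by (metis fst_conv in_set_conv_nth snd_conv)

lemma prog_edges_correct:
  "(\<exists>q v. em_reach (prog_edges p x) q v \<and> q \<in> {length p<..}) \<longleftrightarrow> halts p x"
proof
  \<comment> \<open>Either the guess is still growing and all other registers are 0, or the
    configuration occurs in the deterministic run on x.\<close>
  have inv: "(q = 0 \<and> (\<exists>n. v = (\<lambda>_. 0)(0 := n))) \<or> (\<exists>i t. q = Suc i \<and> (rm_step p ^^ t) (rm_init x) = (i, v))"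
    if "em_reach (prog_edges p x) q v" for q v
    using that
  proof (induction rule: em_reach.induct)
    case em_init
    show ?case by (auto intro!: exI[of _ 0])
  next
    case (em_step j v v')
    have step: "\<exists>t. (rm_step p ^^ t) (rm_init x) = rm_step p (i, v)"
      if "src (prog_edges p x ! j) = Suc i" for i
    proof -
      from em_step.IH that obtain t where "(rm_step p ^^ t) (rm_init x) = (i, v)" by auto
      then have "(rm_step p ^^ Suc t) (rm_init x) = rm_step p (i, v)" by simp
      then show ?thesis by blast
    qed
    have "prog_edges p x ! j \<in> set (prog_edges p x)" using em_step.hyps(2) by simp
    then show ?case
    proof (cases rule: prog_edges_cases)
      case 1
      then obtain n where "v = (\<lambda>_. 0)(0 := n)"
        using em_step.IH unfolding 1 fst_conv using nat.distinct(1) by metis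
      then have "v' = (\<lambda>_. 0)(0 := Suc n)" using em_step.hyps(3) 1 by (auto simp: fun_eq_iff)
      then show ?thesis using 1 by auto
    next
      case 2
      then have "v' = (\<lambda>_. 0)(0 := x)" using em_step by auto
      then have "(rm_step p ^^ 0) (rm_init x) = (0, v')" by (simp add: rm_init_def)
      then show ?thesis using 2 by (metis One_nat_def snd_conv)
    next
      case (3 i r k)
      then have "rm_step p (i, v) = (k, v')" using em_step.hyps(3) by simp
      then show ?thesis using step[of i] 3 by (metis fst_conv snd_conv)
    next
      case (4 i r k l)
      then have "rm_step p (i, v) = (k, v')" using em_step.hyps(3) by simp
      then show ?thesis using step[of i] 4 by (metis fst_conv snd_conv)
    next
      case (5 i r k l)
      then have "rm_step p (i, v) = (l, v')" using em_step.hyps(3) by simp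
      then show ?thesis using step[of i] 5 by (metis fst_conv snd_conv)
    qed
  qed
  assume "\<exists>q v. em_reach (prog_edges p x) q v \<and> q \<in> {length p<..}"
  then obtain q v where q: "em_reach (prog_edges p x) q v" "length p < q" by auto
  then obtain i t where "q = Suc i" "(rm_step p ^^ t) (rm_init x) = (i, v)" using inv[OF q(1)] by auto
  then show "halts p x" unfolding halts_def using q(2) by (intro exI[of _ t]) simp
next
  have edge0: "(0, OInc 0, 0) \<in> set (prog_edges p x)" and edge1: "(0, OTest 0 x, 1) \<in> set (prog_edges p x)"
    by (simp_all add: prog_edges_def)
  have edges: "set (instr_edges i (p ! i)) \<subseteq> set (prog_edges p x)" if "i < length p" for i
    using that unfolding prog_edges_def by auto
  have load: "em_reach (prog_edges p x) 0 ((\<lambda>_. 0)(0 := n))" for n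
  proof (induction n)
    case 0
    have "(\<lambda>_. 0)(0 := 0) = (\<lambda>_::nat. 0::nat)" by auto
    then show ?case using em_init by metis
  next
    case (Suc n)
    show ?case by (rule em_reach_edge[OF Suc edge0]) (simp add: fun_eq_iff)
  qed
  have run: "em_reach (prog_edges p x) (Suc i) v" if "(rm_step p ^^ t) (rm_init x) = (i, v)" for i v t
    using that
  proof (induction t arbitrary: i v)
    case 0
    then have iv: "i = 0" "v = (\<lambda>_. 0)(0 := x)" by (auto simp: rm_init_def)
    have "em_reach (prog_edges p x) 1 v" unfolding iv by (rule em_reach_edge[OF load edge1]) simp
    then show ?case using iv(1) by simp
  next
    case (Suc t)
    obtain j u where j: "(rm_step p ^^ t) (rm_init x) = (j, u)" by fastforce
    then have step: "rm_step p (j, u) = (i, v)" using Suc.prems by simp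
    note reach = Suc.IH[OF j]
    show ?case
    proof (cases "j < length p")
      case False
      then show ?thesis using step reach by simp
    next
      case True
      note sub = edges[OF True]
      show ?thesis
      proof (cases "p ! j")
        case (Inc r k)
        then have iv: "i = k" "v = u(r := Suc (u r))"
          and e: "(Suc j, OInc r, Suc k) \<in> set (prog_edges p x)"
          using step True sub by auto
        show ?thesis unfolding iv by (rule em_reach_edge[OF reach e]) (simp add: fun_eq_iff)
      next
        case (Dec r k l)
        then have e: "(Suc j, ODec r, Suc k) \<in> set (prog_edges p x)"
          "(Suc j, OTest r 0, Suc l) \<in> set (prog_edges p x)" using sub by auto
        show ?thesis
        proof (cases "u r = 0")
          case z: True
          then have iv: "i = l" "v = u" using step True Dec by auto
          show ?thesis unfolding iv by (rule em_reach_edge[OF reach e(2)]) (simp add: z)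
        next
          case nz: False
          then have iv: "i = k" "v = u(r := u r - 1)" using step True Dec by auto
          show ?thesis unfolding iv by (rule em_reach_edge[OF reach e(1)]) (use nz in \<open>simp add: fun_eq_iff\<close>)
        qed
      qed
    qed
  qed
  assume "halts p x"
  then obtain t i v where "(rm_step p ^^ t) (rm_init x) = (i, v)" "length p \<le> i"
    unfolding halts_def by (metis prod.collapse)
  then have "em_reach (prog_edges p x) (Suc i) v" "Suc i \<in> {length p<..}" using run by auto
  then show "\<exists>q v. em_reach (prog_edges p x) q v \<and> q \<in> {length p<..}" by blast
qed

text \<open>Everything except one guard value is chosen before x, which is what makes the instance
  codes recursive in x. The machine is fixed, and of its edges only the loading test mentions x; the
  remaining data are computed at x = 0 and shown to be the same for all x.\<close>

theorem token_system_for_halting_set: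
  "\<exists>S R W X s g Y. (\<forall>x. token_system S (insert (X, s, g(Y \<mapsto> x)) R) W) \<and>
     (\<forall>x. (\<exists>k. ts_wins (insert (X, s, g(Y \<mapsto> x)) R) W k) \<longleftrightarrow> x \<in> halting_set)"
proof -
  obtain p where p: "\<And>x. halts p x \<longleftrightarrow> x \<in> halting_set" using machine_for_halting_set by blast
  let ?es = "prog_edges p"
  let ?H = "{length p<..}"
  have len: "length (?es x) = length (?es 0)" for x by (simp add: prog_edges_def)
  have nth: "?es x ! j = (if j = 1 then (0, OTest 0 x, 1) else ?es 0 ! j)" for x j
    by (cases j) (auto simp: prog_edges_def nth_Cons')
  have one: "1 < length (?es 0)" by (simp add: prog_edges_def)
  have "\<exists>nr. \<forall>j<length (?es 0). op_reg (eop (?es 0 ! j)) < nr"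
    using finite_nat_set_iff_bounded[of "(\<lambda>j. op_reg (eop (?es 0 ! j))) ` {..<length (?es 0)}"] by auto
  then obtain nr where nr0: "\<And>j. j < length (?es 0) \<Longrightarrow> op_reg (eop (?es 0 ! j)) < nr" by blast
  have nr: "op_reg (eop (?es x ! j)) < nr" if "j < length (?es x)" for x j
    using nr0[of j] nr0[OF one] that nth[of x j] nth[of 0 1] by (cases "j = 1") (simp_all add: len[of x])
  have em: "edge_machine (?es x) nr" for x by unfold_locales (rule nr)
  let ?Q = "\<lambda>x. edge_machine.lrules (?es x)"
  let ?R0 = "edge_machine.flow_rules (?es 0) \<union>
    (\<Union>j\<in>{..<length (?es 0)} - {1}. edge_machine.op_rules j (eop (?es 0 ! j)))"
  let ?rule = "edge_machine.rule_of (?es 0) nr"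
  have flow: "edge_machine.flow_rules (?es x) = edge_machine.flow_rules (?es 0)" for x
  proof -
    have "src (?es x ! j) = src (?es 0 ! j) \<and> tgt (?es x ! j) = tgt (?es 0 ! j)" for j
      using nth[of x j] nth[of 0 j] by (cases "j = 1") simp_all
    then show ?thesis
      unfolding edge_machine.flow_rules_def[OF em] len[of x] by simp
  qed
  have Q: "?Q x = insert (LS 1, {}, Some (0, x)) ?R0" for x
  proof -
    have "(\<Union>j<length (?es x). edge_machine.op_rules j (eop (?es x ! j))) =
      edge_machine.op_rules 1 (OTest 0 x) \<union>
      (\<Union>j\<in>{..<length (?es 0)} - {1}. edge_machine.op_rules j (eop (?es 0 ! j)))"
      using one unfolding len[of x] by (auto simp: nth[of x] split: if_splits)
    then show ?thesis
      unfolding edge_machine.lrules_def[OF em] flow[of x] by (simp add: edge_machine.op_rules.simps[OF em])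
  qed
  have ctl: "edge_machine.ctl (?es x) nr = edge_machine.ctl (?es 0) nr" for x
    unfolding edge_machine.ctl_def[OF em] len[of x] ..
  have guard: "edge_machine.guard (?es x) nr = edge_machine.guard (?es 0) nr" for x
    unfolding fun_eq_iff edge_machine.guard_def[OF em] ctl[of x] by simp
  have rule: "edge_machine.rule_of (?es x) nr = ?rule" for x
    unfolding fun_eq_iff edge_machine.rule_of_def[OF em] guard[of x] by simp
  \<comment> \<open>The guard of the loading test without its test part; adding the value x at
    \<open>LReg 0\<close> restores the rule.\<close>
  let ?g = "edge_machine.guard (?es 0) nr {} None"
  have test: "?rule (LS 1, {}, Some (0, x)) = (acts_of (LI 1), 0, ?g(acts_of (LReg 0) \<mapsto> x))" for x
    using edge_machine.LReg_notin_ctl[OF em, of 0 0]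
    by (auto simp: edge_machine.rule_of_def[OF em] edge_machine.guard_def[OF em] fun_eq_iff enc_eq_iff
        simp del: acts_of.simps)
  have R: "edge_machine.rule_of (?es x) nr ` ?Q x = insert (acts_of (LI 1), 0, ?g(acts_of (LReg 0) \<mapsto> x)) (?rule ` ?R0)" for x
    unfolding Q rule[of x] image_insert test ..
  have W: "edge_machine.target_locs (?es x) ?H = edge_machine.target_locs (?es 0) ?H" for x
  proof -
    have "tgt (?es x ! j) = tgt (?es 0 ! j)" for j
      using nth[of x j] nth[of 0 j] by (cases "j = 1") simp_all
    then show ?thesis unfolding edge_machine.target_locs_def[OF em] len[of x] by simp
  qed
  have B: "edge_machine.acts_bound (?es x) nr = edge_machine.acts_bound (?es 0) nr" for x
    unfolding edge_machine.acts_bound_def[OF em] len[of x] ..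
  have "token_system (edge_machine.acts_bound (?es 0) nr)
      (insert (acts_of (LI 1), 0, ?g(acts_of (LReg 0) \<mapsto> x)) (?rule ` ?R0)) (edge_machine.target_locs (?es 0) ?H)" for x
    using edge_machine.token_system[OF em, of x ?H] unfolding R W[of x] B[of x] .
  moreover have "(\<exists>k. ts_wins (insert (acts_of (LI 1), 0, ?g(acts_of (LReg 0) \<mapsto> x)) (?rule ` ?R0))
      (edge_machine.target_locs (?es 0) ?H) k) \<longleftrightarrow> x \<in> halting_set" for x
    using edge_machine.ts_wins_iff[OF em, of ?H x] prog_edges_correct[of p x] p[of x] unfolding R W[of x] by simp
  ultimately show ?thesis by blast
qed

section \<open>Acknowledged moves\<close>

context token_system
begin

text \<open>
  In the game, a token that has performed \<open>X\<close> is a process whose system actions are \<open>X\<close>, all of them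
  acknowledged by matching environment actions. The pair \<open>(X, Y)\<close> stands for the processes with system actions
  \<open>X\<close> and acknowledgements \<open>Y\<close>: the system makes \<open>Y\<close> a proper subset of \<open>X\<close>, the environment
  restores equality, and any unsolicited acknowledgement makes the environment lose for good.
\<close>

definition cheated :: "(nat set \<times> nat set \<Rightarrow> nat) \<Rightarrow> bool" where
  "cheated d \<longleftrightarrow> (\<exists>X\<in>Pow S. \<exists>Y\<in>Pow S. \<not> Y \<subseteq> X \<and> 0 < d (X, Y))"

definition won :: "(nat set \<times> nat set \<Rightarrow> nat) \<Rightarrow> bool" where
  "won d \<longleftrightarrow> (\<exists>X\<in>W. 0 < d (X, X))"

definition pending :: "rule \<Rightarrow> (nat set \<times> nat set \<Rightarrow> nat) \<Rightarrow> bool" where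
  "pending \<rho> d \<longleftrightarrow> (case \<rho> of (X, s, g) \<Rightarrow>
     d (insert s X, X) = 1 \<and>
     (\<forall>X'\<in>Pow S. \<forall>Y'\<in>Pow S. Y' \<subset> X' \<longrightarrow> (X', Y') \<noteq> (insert s X, X) \<longrightarrow> d (X', Y') = 0) \<and>
     (\<forall>Y\<in>Pow S. \<forall>n. g Y = Some n \<longrightarrow> d (Y, Y) = n))"

definition accept :: "(nat set \<times> nat set \<Rightarrow> nat) \<Rightarrow> bool" where
  "accept d \<longleftrightarrow> cheated d \<or> won d \<or> (\<exists>\<rho>\<in>R. pending \<rho> d)"

definition settled :: "(nat set \<Rightarrow> nat) \<Rightarrow> nat set \<times> nat set \<Rightarrow> nat" where
  "settled c = (\<lambda>(X, Y). if X = Y then c X else 0)"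

definition asking :: "nat set \<Rightarrow> nat \<Rightarrow> (nat set \<Rightarrow> nat) \<Rightarrow> nat set \<times> nat set \<Rightarrow> nat" where
  "asking X s c = (settled (take_token X c))((insert s X, X) := 1)"

definition ts_won :: "(nat set \<Rightarrow> nat) \<Rightarrow> bool" where
  "ts_won c \<longleftrightarrow> (\<exists>X\<in>W. 0 < c X)"

definition fires :: "nat set \<Rightarrow> nat \<Rightarrow> (nat set \<Rightarrow> nat) \<Rightarrow> bool" where
  "fires X s c \<longleftrightarrow> (\<exists>g. (X, s, g) \<in> R \<and> 0 < c X \<and> guard_ok g (take_token X c))"

text \<open>This is reachability of a target read backwards. A strategy preserves it by choosing a
  step of a shortest derivation rather than a token run fixed in advance.\<close>

inductive can_win :: "(nat set \<Rightarrow> nat) \<Rightarrow> bool" where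
  can_win_won: "ts_won c \<Longrightarrow> can_win c"
| can_win_step: "fires X s c \<Longrightarrow> can_win (move_token X s c) \<Longrightarrow> can_win c"

lemma ts_wins_iff: "ts_wins R W k \<longleftrightarrow> (\<exists>c. ts_reach R k c \<and> ts_won c)"
  by (auto simp: ts_wins_def ts_won_def)

lemma fires_reach: "ts_reach R k c \<Longrightarrow> fires X s c \<Longrightarrow> ts_reach R k (move_token X s c)"
  unfolding fires_def by (blast intro: ts_step)

lemma can_win_init: "ts_wins R W k \<Longrightarrow> can_win (\<lambda>Y. if Y = {} then k else 0)"
proof -
  have "can_win c \<Longrightarrow> can_win (\<lambda>Y. if Y = {} then k else 0)" if "ts_reach R k c" for c
    using that
  proof (induction rule: ts_reach.induct)
    case (ts_step c X s g)
    have "fires X s c" unfolding fires_def using ts_step.hyps by blast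
    then show ?case using ts_step.IH ts_step.prems can_win_step by blast
  qed
  then show "ts_wins R W k \<Longrightarrow> ?thesis" unfolding ts_wins_iff using can_win_won by blast
qed

lemma not_won_init: "\<not> ts_won (\<lambda>Y. if Y = {} then k else 0)"
  using W(2) by (auto simp: ts_won_def)

lemma fires_wf: "fires X s c \<Longrightarrow> X \<subseteq> S \<and> s \<in> S \<and> s \<notin> X \<and> 0 < c X"
  unfolding fires_def using rules by blast

text \<open>Nothing is unsolicited and nothing awaits an acknowledgement, so only a target can make
  the condition true; an unwon settled position obliges the system to move.\<close>

lemma accept_settled: "accept (settled c) \<longleftrightarrow> ts_won c"
proof -
  have "\<not> cheated (settled c)" by (auto simp: cheated_def settled_def)
  moreover have "won (settled c) \<longleftrightarrow> ts_won c" by (simp add: won_def settled_def ts_won_def)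
  moreover have "\<not> pending \<rho> (settled c)" if "\<rho> \<in> R" for \<rho>
  proof -
    obtain X s g where \<rho>': "\<rho> = (X, s, g)" by (metis prod_cases3)
    then have "insert s X \<noteq> X" using rules that by blast
    then show ?thesis by (simp add: \<rho>' pending_def settled_def)
  qed
  ultimately show ?thesis unfolding accept_def by blast
qed

lemma accept_asking:
  assumes "fires X s c"
  shows "accept (asking X s c)"
proof -
  obtain g where g: "(X, s, g) \<in> R" "guard_ok g (take_token X c)"
    using assms unfolding fires_def by blast
  have "insert s X \<noteq> X" using fires_wf[OF assms] by blast
  then have "pending (X, s, g) (asking X s c)"
    using g(2) by (auto simp: pending_def asking_def settled_def guard_ok_def)
  then show ?thesis unfolding accept_def using g(1) by blast
qed

text \<open>Guards concern diagonal pairs (Y, Y), where \<open>asking\<close> agrees with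
  \<open>take_token\<close>: the moved token sits off the diagonal because \<open>s\<close> is
  new.\<close>

lemma fires_if_pending:
  assumes "pending (X, s, g) (asking X s c)" "(X, s, g) \<in> R" "0 < c X"
  shows "fires X s c"
proof -
  have "guard_ok g (take_token X c)"
    unfolding guard_ok_def
  proof (intro allI impI)
    fix Y n assume Y: "g Y = Some n"
    have "dom g \<subseteq> Pow S" "s \<notin> X" using rules[OF assms(2)] by auto
    then have "Y \<in> Pow S" "(Y, Y) \<noteq> (insert s X, X)" using Y by auto
    moreover from calculation(1) have "asking X s c (Y, Y) = n" using assms(1) Y by (auto simp: pending_def)
    moreover from calculation(2) have "asking X s c (Y, Y) = take_token X c Y"
      unfolding asking_def by (subst fun_upd_other) (simp_all add: settled_def)
    ultimately show "take_token X c Y = n" by simp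
  qed
  then show ?thesis unfolding fires_def using assms by blast
qed

text \<open>The hypothesis \<open>le\<close> describes what system moves can do to settled tokens:
  acknowledgements keep their old value Y, a populated state. So nobody has cheated, and a target on
  the diagonal would already have been populated in \<open>c\<close>; only a pending rule is
  left.\<close>

lemma asking_if_accept:
  assumes "accept d" "\<not> ts_won c"
    and le: "\<And>X Y. X \<subseteq> S \<Longrightarrow> Y \<subseteq> S \<Longrightarrow> 0 < d (X, Y) \<Longrightarrow> Y \<subseteq> X \<and> 0 < c Y"
  obtains X s g where "(X, s, g) \<in> R" "pending (X, s, g) d"
proof -
  have "\<not> cheated d" using le by (auto simp: cheated_def)
  moreover have "\<not> won d"
  proof
    assume "won d"
    then obtain X where "X \<in> W" "0 < d (X, X)" unfolding won_def by blast
    then show False using le[of X X] W(1) assms(2) by (auto simp: ts_won_def)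
  qed
  ultimately show thesis using assms(1) that unfolding accept_def by (metis prod_cases3)
qed

text \<open>The lost term is added on the left to avoid truncated subtraction. With h =
  \<open>card\<close> the identity gives the growth of \<open>weight\<close>, with h constant the
  conservation of tokens.\<close>

lemma sum_move_token:
  assumes "X \<subseteq> S" "s \<in> S" "s \<notin> X" "0 < c X"
  shows "(\<Sum>Y\<in>Pow S. h Y * move_token X s c Y) + h X = (\<Sum>Y\<in>Pow S. h Y * c Y) + h (insert s X)"
proof -
  have neq: "insert s X \<noteq> X" using assms by blast
  have "h Y * move_token X s c Y + (if Y = X then h X else 0) =
      h Y * c Y + (if Y = insert s X then h (insert s X) else 0)" for Y
    using assms(4) neq by (cases "c X") (auto simp: move_token_def take_token_def)
  then have "(\<Sum>Y\<in>Pow S. h Y * move_token X s c Y + (if Y = X then h X else 0)) =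
      (\<Sum>Y\<in>Pow S. h Y * c Y + (if Y = insert s X then h (insert s X) else 0))"
    by simp
  then show ?thesis using assms(1,2) finite_S by (simp add: sum.distrib)
qed

definition weight :: "(nat set \<Rightarrow> nat) \<Rightarrow> nat" where
  "weight c = (\<Sum>Y\<in>Pow S. card Y * c Y)"

lemma weight_move_token:
  assumes "fires X s c"
  shows "weight (move_token X s c) = Suc (weight c)"
proof -
  have wf: "X \<subseteq> S" "s \<in> S" "s \<notin> X" "0 < c X" using fires_wf[OF assms] by auto
  then have "card (insert s X) = Suc (card X)" using finite_S finite_subset by fastforce
  then show ?thesis using sum_move_token[of X s c card] wf by (simp add: weight_def)
qed

lemma weight_le: "ts_reach R k c \<Longrightarrow> weight c \<le> card S * k"
proof -
  assume c: "ts_reach R k c"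
  then have "(\<Sum>Y\<in>Pow S. c Y) = k"
  proof (induction rule: ts_reach.induct)
    case ts_init
    show ?case using finite_S by simp
  next
    case (ts_step c X s g)
    then show ?case using sum_move_token[of X s c "\<lambda>_. 1"] rules[OF ts_step.hyps(2)] by simp
  qed
  moreover have "weight c \<le> (\<Sum>Y\<in>Pow S. card S * c Y)"
    unfolding weight_def by (intro sum_mono mult_right_mono card_mono finite_S) auto
  ultimately show ?thesis by (simp flip: sum_distrib_left)
qed

text \<open>Every move increases the weight, which the number of tokens bounds.\<close>

lemma progress_terminates:
  assumes init: "P (\<lambda>Y. if Y = {} then k else 0)"
    and step: "\<And>c. ts_reach R k c \<Longrightarrow> P c \<Longrightarrow> \<not> ts_won c \<Longrightarrow>
      \<exists>X s. fires X s c \<and> (ts_won (move_token X s c) \<or> P (move_token X s c))"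
  shows "ts_wins R W k"
proof (rule ccontr)
  assume no: "\<not> ts_wins R W k"
  have "\<exists>c. ts_reach R k c \<and> P c \<and> weight c \<ge> n" for n
  proof (induction n)
    case 0
    then show ?case using ts_init init by blast
  next
    case (Suc n)
    then obtain c where c: "ts_reach R k c" "P c" "weight c \<ge> n" by blast
    then have "\<not> ts_won c" using no ts_wins_iff by blast
    then obtain X s where X: "fires X s c" "ts_won (move_token X s c) \<or> P (move_token X s c)"
      using step c by blast
    then have "ts_reach R k (move_token X s c)" using c(1) fires_reach by blast
    moreover from this have "P (move_token X s c)" using X(2) no ts_wins_iff by blast
    ultimately show ?case using weight_move_token[OF X(1)] c(3) by (metis Suc_le_mono)
  qed
  from this[of "Suc (card S * k)"] obtain c where "ts_reach R k c" "Suc (card S * k) \<le> weight c"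
    by blast
  then show False using weight_le[of k c] by simp
qed

text \<open>Games and executions determine counts for subsets of \<open>S\<close> only, while
  \<open>settled\<close> and \<open>asking\<close> are functions on all pairs; agreement on the
  relevant pairs replaces equality.\<close>

definition matches :: "(nat set \<times> nat set \<Rightarrow> nat) \<Rightarrow> (nat set \<times> nat set \<Rightarrow> nat) \<Rightarrow> bool" where
  "matches d d' \<longleftrightarrow> (\<forall>X Y. X \<subseteq> S \<and> Y \<subseteq> S \<longrightarrow> d (X, Y) = d' (X, Y))"

lemma matchesD: "matches d d' \<Longrightarrow> X \<subseteq> S \<Longrightarrow> Y \<subseteq> S \<Longrightarrow> d (X, Y) = d' (X, Y)"
  unfolding matches_def by blast

lemma won_cong: "matches d d' \<Longrightarrow> won d \<longleftrightarrow> won d'"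
  unfolding won_def matches_def using W(1) by (metis PowD subsetD)

lemma cheated_cong: "matches d d' \<Longrightarrow> cheated d \<longleftrightarrow> cheated d'"
  unfolding cheated_def matches_def by auto

lemma pending_cong: "matches d d' \<Longrightarrow> \<rho> \<in> R \<Longrightarrow> pending \<rho> d \<longleftrightarrow> pending \<rho> d'"
proof -
  assume m: "matches d d'" and R: "\<rho> \<in> R"
  obtain X s g where \<rho>: "\<rho> = (X, s, g)" by (metis prod_cases3)
  then have "X \<subseteq> S" "insert s X \<subseteq> S" using rules R by blast+
  then show ?thesis unfolding \<rho> pending_def using m unfolding matches_def by auto
qed

lemma accept_cong: "matches d d' \<Longrightarrow> accept d \<longleftrightarrow> accept d'"
  unfolding accept_def using won_cong cheated_cong pending_cong by blast

text \<open>This and the next lemma translate the move of one process into the token view; the game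
  and the synthesis argument share them.\<close>

lemma settled_asking:
  assumes "s \<notin> X"
  shows "(settled c)((X, X) := settled c (X, X) - 1, (insert s X, X) := settled c (insert s X, X) + 1) = asking X s c"
proof -
  have "insert s X \<noteq> X" using assms by blast
  then show ?thesis by (auto simp: fun_eq_iff settled_def asking_def take_token_def)
qed

lemma asking_settled:
  assumes "s \<notin> X"
  shows "(asking X s c)((insert s X, X) := asking X s c (insert s X, X) - 1,
      (insert s X, insert s X) := asking X s c (insert s X, insert s X) + 1) = settled (move_token X s c)"
proof -
  have "insert s X \<noteq> X" using assms by blast
  then show ?thesis by (auto simp: fun_eq_iff settled_def asking_def take_token_def move_token_def)
qed

end

section \<open>Games\<close>

definition sact :: "nat \<Rightarrow> nat" where "sact s = 2 * s"
definition eact :: "nat \<Rightarrow> nat" where "eact s = 2 * s + 1"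

lemma act_inj [simp]: "sact s = sact t \<longleftrightarrow> s = t" "eact s = eact t \<longleftrightarrow> s = t" "sact s \<noteq> eact t" "eact t \<noteq> sact s"
  unfolding sact_def eact_def by presburger+

lemma act_image [simp]: "sact s \<in> sact ` A \<longleftrightarrow> s \<in> A" "eact s \<in> eact ` A \<longleftrightarrow> s \<in> A"
  "sact s \<notin> eact ` A" "eact s \<notin> sact ` A"
  by (auto simp: image_iff)

lemma sum_eq_single:
  fixes \<tau> :: "'b \<Rightarrow> nat"
  assumes "finite L" "a \<in> L" "\<And>y. y \<in> L \<Longrightarrow> y \<noteq> a \<Longrightarrow> \<tau> y = 0"
  shows "sum \<tau> L = \<tau> a"
proof -
  have "sum \<tau> L = sum \<tau> {a}"
    by (rule sum.mono_neutral_right) (use assms in auto)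
  then show ?thesis by simp
qed

lemma sum_eq_pair:
  fixes \<tau> :: "'b \<Rightarrow> nat"
  assumes "finite L" "a \<in> L" "b \<in> L" "a \<noteq> b" "\<And>y. y \<in> L \<Longrightarrow> y \<noteq> a \<Longrightarrow> y \<noteq> b \<Longrightarrow> \<tau> y = 0"
  shows "sum \<tau> L = \<tau> a + \<tau> b"
proof -
  have "sum \<tau> L = sum \<tau> {a, b}"
    by (rule sum.mono_neutral_right) (use assms in auto)
  then show ?thesis using assms(4) by simp
qed

definition move_process :: "'l \<Rightarrow> 'l \<Rightarrow> ('l \<Rightarrow> ptype \<Rightarrow> nat) \<Rightarrow> nat \<Rightarrow> 'l \<Rightarrow> ptype \<Rightarrow> nat" where
  "move_process l l' C n = (\<lambda>a \<theta>. if \<theta> \<noteq> Shared then C a \<theta>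
     else if a = l then C a \<theta> - n else if a = l' then C a \<theta> + n else C a \<theta>)"

definition single :: "('a \<Rightarrow> nat) \<Rightarrow> ('a \<Rightarrow> nat) \<Rightarrow> 'a trans" where
  "single l l' a b \<theta> = (if a = l \<and> b = l' \<and> \<theta> = Shared then 1 else 0)"

text \<open>A flow needs a populated source before and leaves a populated target after. All
  arguments that a move is forced use this to exclude flows.\<close>

lemma transition_le:
  assumes "finite (locations G)" "\<tau> \<in> transitions G A \<theta>0" "applicable G \<tau> C"
  shows "\<tau> a b \<theta> \<le> C a \<theta>" "\<tau> a b \<theta> \<le> apply_trans G \<tau> C b \<theta>"
proof -
  have loc: "a \<in> locations G" "b \<in> locations G" if "\<tau> a b \<theta> \<noteq> 0"
    using assms(2) that unfolding transitions_def by fast+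
  show "\<tau> a b \<theta> \<le> C a \<theta>"
  proof (cases "\<tau> a b \<theta> = 0")
    case False
    have "\<tau> a b \<theta> \<le> (\<Sum>b\<in>locations G. \<tau> a b \<theta>)"
      by (rule member_le_sum[of b]) (use loc[OF False] assms(1) in auto)
    also have "\<dots> \<le> C a \<theta>" using assms(3) loc[OF False] unfolding applicable_def by blast
    finally show ?thesis .
  qed simp
  show "\<tau> a b \<theta> \<le> apply_trans G \<tau> C b \<theta>"
  proof (cases "\<tau> a b \<theta> = 0")
    case False
    have "\<tau> a b \<theta> \<le> (\<Sum>a\<in>locations G. \<tau> a b \<theta>)"
      by (rule member_le_sum[of a "locations G" "\<lambda>a. \<tau> a b \<theta>"]) (use loc[OF False] assms(1) in auto)
    then show ?thesis by (simp add: apply_trans_def)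
  qed simp
qed

lemma apply_trans_pos:
  assumes "0 < apply_trans G \<tau> C b \<theta>"
  shows "0 < C b \<theta> \<or> (\<exists>a. 0 < \<tau> a b \<theta>)"
proof (rule ccontr)
  assume "\<not> ?thesis"
  then have "C b \<theta> = 0" "(\<Sum>a\<in>locations G. \<tau> a b \<theta>) = 0" by simp_all
  then show False using assms by (simp add: apply_trans_def)
qed

text \<open>Processes that stay in place may still be listed in \<tau>, because the empty word is
  allowed. Such flows occur in both sums and cancel, the subtraction being exact by
  applicability.\<close>

lemma apply_trans_move:
  assumes fin: "finite (locations G)" and \<tau>: "\<tau> \<in> transitions G A \<theta>0" and app: "applicable G \<tau> C"
    and l: "l \<in> locations G" "l' \<in> locations G" "l \<noteq> l'"
    and only: "\<And>a b \<theta>. 0 < \<tau> a b \<theta> \<Longrightarrow> a \<noteq> b \<Longrightarrow> a = l \<and> b = l' \<and> \<theta> = Shared"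
  shows "apply_trans G \<tau> C = move_process l l' C (\<tau> l l' Shared)"
proof (intro ext)
  fix a \<theta>
  have zero: "\<tau> a b \<theta> = 0" if "a \<noteq> b" "\<not> (a = l \<and> b = l' \<and> \<theta> = Shared)" for a b \<theta>
    using only that by blast
  show "apply_trans G \<tau> C a \<theta> = move_process l l' C (\<tau> l l' Shared) a \<theta>"
  proof (cases "a \<in> locations G")
    case False
    then have "\<tau> a b \<theta> = 0" "\<tau> b a \<theta> = 0" for b using \<tau> unfolding transitions_def by fast+
    then show ?thesis using False l by (auto simp: apply_trans_def move_process_def)
  next
    case True
    have le: "(\<Sum>b\<in>locations G. \<tau> a b \<theta>) \<le> C a \<theta>" using app True unfolding applicable_def by blast
    consider "a = l" "\<theta> = Shared" | "a = l'" "\<theta> = Shared" | "a \<noteq> l \<and> a \<noteq> l' \<or> \<theta> \<noteq> Shared" by blast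
    then show ?thesis
    proof cases
      case 1
      have "(\<Sum>b\<in>locations G. \<tau> a b \<theta>) = \<tau> l l Shared + \<tau> l l' Shared"
        unfolding 1 by (rule sum_eq_pair) (use fin l zero in auto)
      moreover have "(\<Sum>b\<in>locations G. \<tau> b a \<theta>) = \<tau> l l Shared"
        unfolding 1 by (rule sum_eq_single) (use fin l zero in auto)
      ultimately show ?thesis using le l(3) 1 by (simp add: apply_trans_def move_process_def)
    next
      case 2
      have "(\<Sum>b\<in>locations G. \<tau> b a \<theta>) = \<tau> l l' Shared + \<tau> l' l' Shared"
        unfolding 2 by (rule sum_eq_pair) (use fin l zero in auto)
      moreover have "(\<Sum>b\<in>locations G. \<tau> a b \<theta>) = \<tau> l' l' Shared"
        unfolding 2 by (rule sum_eq_single) (use fin l zero in auto)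
      ultimately show ?thesis using le l(3) 2 by (simp add: apply_trans_def move_process_def)
    next
      case 3
      have "(\<Sum>b\<in>locations G. \<tau> a b \<theta>) = \<tau> a a \<theta>"
        by (rule sum_eq_single) (use fin True zero 3 in auto)
      moreover have "(\<Sum>b\<in>locations G. \<tau> b a \<theta>) = \<tau> a a \<theta>"
        by (rule sum_eq_single) (use fin True zero 3 in auto)
      ultimately show ?thesis using le 3 by (auto simp: apply_trans_def move_process_def)
    qed
  qed
qed

lemma single_transition:
  assumes fin: "finite (locations G)" and l: "l \<in> locations G" "l' \<in> locations G" "l \<noteq> l'"
    and w: "w \<in> lists A" "l' = steps_loc G l w" and "\<theta>0 \<noteq> Shared"
  shows "single l l' \<in> transitions G A \<theta>0"
    and "0 < C l Shared \<Longrightarrow> applicable G (single l l') C"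
    and "0 < C l Shared \<Longrightarrow> apply_trans G (single l l') C = move_process l l' C 1"
proof -
  show tr: "single l l' \<in> transitions G A \<theta>0"
    using assms unfolding transitions_def single_def by auto
  have "(\<Sum>b\<in>locations G. single l l' a b \<theta>) = (if a = l \<and> \<theta> = Shared then 1 else 0)" for a \<theta>
    using fin l(2) by (simp add: single_def)
  then show app: "applicable G (single l l') C" if "0 < C l Shared"
    using that unfolding applicable_def by auto
  show "apply_trans G (single l l') C = move_process l l' C 1" if "0 < C l Shared"
    by (subst apply_trans_move[OF fin tr app[OF that] l]) (auto simp: single_def split: if_splits)
qed

text \<open>Plays are defined by conditions on indices; this recursive form at the end is what the
  inductions use. Appending at even length is a system move.\<close>

lemma plays_snoc:
  "\<pi> @ [(\<tau>, D)] \<in> plays G C \<longleftrightarrow> \<pi> \<in> plays G C \<and>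
     applicable G \<tau> (play_config C \<pi> (length \<pi>)) \<and> D = apply_trans G \<tau> (play_config C \<pi> (length \<pi>)) \<and>
     (if even (length \<pi>) then \<tau> \<in> sys_transitions G \<and> accepting G D
      else \<tau> \<in> env_transitions G \<and> \<not> accepting G D)"
proof -
  have set: "{1..length (\<pi> @ [(\<tau>, D)])} = insert (Suc (length \<pi>)) {1..length \<pi>}" by auto
  have conf: "play_config C (\<pi> @ [(\<tau>, D)]) i = play_config C \<pi> i" if "i \<le> length \<pi>" for i
    using that unfolding play_config_def by (cases i) (auto simp: nth_append)
  have tr: "play_trans (\<pi> @ [(\<tau>, D)]) i = play_trans \<pi> i" if "i \<in> {1..length \<pi>}" for i
    using that unfolding play_trans_def by (auto simp: nth_append)
  have last: "play_config C (\<pi> @ [(\<tau>, D)]) (Suc (length \<pi>)) = D"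
    "play_trans (\<pi> @ [(\<tau>, D)]) (Suc (length \<pi>)) = \<tau>"
    unfolding play_config_def play_trans_def by (simp_all add: nth_append)
  let ?Q = "\<lambda>\<pi> i. applicable G (play_trans \<pi> i) (play_config C \<pi> (i - 1)) \<and>
     play_config C \<pi> i = apply_trans G (play_trans \<pi> i) (play_config C \<pi> (i - 1)) \<and>
     (if odd i then play_trans \<pi> i \<in> sys_transitions G \<and> accepting G (play_config C \<pi> i)
      else play_trans \<pi> i \<in> env_transitions G \<and> \<not> accepting G (play_config C \<pi> i))"
  have old: "?Q (\<pi> @ [(\<tau>, D)]) i \<longleftrightarrow> ?Q \<pi> i" if "i \<in> {1..length \<pi>}" for i
  proof -
    have i: "i \<le> length \<pi>" "i - 1 \<le> length \<pi>" using that by auto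
    show ?thesis unfolding conf[OF i(1)] conf[OF i(2)] tr[OF that] ..
  qed
  have "\<pi> @ [(\<tau>, D)] \<in> plays G C \<longleftrightarrow>
      ?Q (\<pi> @ [(\<tau>, D)]) (Suc (length \<pi>)) \<and> (\<forall>i\<in>{1..length \<pi>}. ?Q (\<pi> @ [(\<tau>, D)]) i)"
    unfolding plays_def mem_Collect_eq set by blast
  also have "(\<forall>i\<in>{1..length \<pi>}. ?Q (\<pi> @ [(\<tau>, D)]) i) \<longleftrightarrow> \<pi> \<in> plays G C"
    unfolding plays_def mem_Collect_eq using old by (intro ball_cong refl)
  finally show ?thesis unfolding last using conf[of "length \<pi>"] by auto
qed

lemma follows_snoc:
  "follows f (\<pi> @ [(\<tau>, D)]) \<longleftrightarrow> follows f \<pi> \<and> (even (length \<pi>) \<longrightarrow> f \<pi> = Some \<tau>)"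
proof -
  have set: "{1..length (\<pi> @ [(\<tau>, D)])} = insert (Suc (length \<pi>)) {1..length \<pi>}" by auto
  have tr: "play_trans (\<pi> @ [(\<tau>, D)]) i = play_trans \<pi> i" if "i \<in> {1..length \<pi>}" for i
    using that unfolding play_trans_def by (auto simp: nth_append)
  have last: "play_trans (\<pi> @ [(\<tau>, D)]) (Suc (length \<pi>)) = \<tau>"
    unfolding play_trans_def by (simp add: nth_append)
  have old: "(odd i \<longrightarrow> f (take (i - 1) (\<pi> @ [(\<tau>, D)])) = Some (play_trans (\<pi> @ [(\<tau>, D)]) i)) \<longleftrightarrow>
      (odd i \<longrightarrow> f (take (i - 1) \<pi>) = Some (play_trans \<pi> i))" if "i \<in> {1..length \<pi>}" for i
    using that tr[OF that] by simp
  have "follows f (\<pi> @ [(\<tau>, D)]) \<longleftrightarrow> (even (length \<pi>) \<longrightarrow> f \<pi> = Some \<tau>) \<and>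
      (\<forall>i\<in>{1..length \<pi>}. odd i \<longrightarrow> f (take (i - 1) (\<pi> @ [(\<tau>, D)])) = Some (play_trans (\<pi> @ [(\<tau>, D)]) i))"
    unfolding follows_def set ball_simps(7) last by simp
  also have "(\<forall>i\<in>{1..length \<pi>}. odd i \<longrightarrow>
        f (take (i - 1) (\<pi> @ [(\<tau>, D)])) = Some (play_trans (\<pi> @ [(\<tau>, D)]) i)) \<longleftrightarrow> follows f \<pi>"
    unfolding follows_def using old by (intro ball_cong refl)
  finally show ?thesis by blast
qed

lemma play_config_snoc:
  "play_config C (\<pi> @ [(\<tau>, D)]) (length (\<pi> @ [(\<tau>, D)])) = D"
  unfolding play_config_def by (simp add: nth_append)

lemma play_prefix: "\<pi> @ zs \<in> plays G C \<Longrightarrow> follows f (\<pi> @ zs) \<Longrightarrow> \<pi> \<in> plays G C \<and> follows f \<pi>"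
proof (induction zs rule: rev_induct)
  case (snoc z zs)
  then show ?case
    by (cases z) (simp only: append_assoc[symmetric] plays_snoc follows_snoc)
qed simp

lemma play_extension:
  assumes "\<pi>' \<in> plays G C" "follows f \<pi>'" "strict_prefix \<pi> \<pi>'"
  obtains \<tau> D where "\<pi> @ [(\<tau>, D)] \<in> plays G C" "follows f (\<pi> @ [(\<tau>, D)])"
proof -
  obtain z zs where z: "\<pi>' = \<pi> @ z # zs" using assms(3) by (auto elim: strict_prefixE')
  obtain \<tau> D where "z = (\<tau>, D)" by fastforce
  with z have eq: "\<pi>' = (\<pi> @ [(\<tau>, D)]) @ zs" by simp
  show thesis using play_prefix[OF assms(1,2)[unfolded eq]] that by blast
qed

section \<open>The game of a token system\<close>

context token_system
begin

definition loc_of :: "nat set \<times> nat set \<Rightarrow> nat \<Rightarrow> nat" where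
  "loc_of q = (\<lambda>a\<in>sact ` S \<union> eact ` S. if a \<in> sact ` fst q \<union> eact ` snd q then 1 else 0)"

definition sx :: "(nat \<Rightarrow> nat) \<Rightarrow> nat set" where "sx l = {s\<in>S. l (sact s) = 1}"
definition sy :: "(nat \<Rightarrow> nat) \<Rightarrow> nat set" where "sy l = {s\<in>S. l (eact s) = 1}"

definition locs :: "(nat \<Rightarrow> nat) set" where
  "locs = sact ` S \<union> eact ` S \<rightarrow>\<^sub>E {0..1}"

definition kappa_some :: "nat set \<Rightarrow> nat set \<Rightarrow> (nat \<Rightarrow> nat) \<Rightarrow> ptype \<Rightarrow> cmp \<times> nat" where
  "kappa_some X Y = (\<lambda>l\<in>locs. \<lambda>\<theta>. (CGe, if \<theta> = Shared \<and> sx l = X \<and> sy l = Y then 1 else 0))"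

text \<open>This spells out \<open>pending\<close> location by location. (\<open>CGe\<close>, 0)
  imposes nothing; it also covers locations with unsolicited acknowledgements, which are accepted
  through \<open>kappa_some\<close> anyway.\<close>

definition kappa_rule :: "rule \<Rightarrow> (nat \<Rightarrow> nat) \<Rightarrow> ptype \<Rightarrow> cmp \<times> nat" where
  "kappa_rule \<rho> = (case \<rho> of (X, s, g) \<Rightarrow> \<lambda>l\<in>locs. \<lambda>\<theta>.
     if \<theta> \<noteq> Shared then (CGe, 0)
     else if sx l = sy l then (case g (sy l) of None \<Rightarrow> (CGe, 0) | Some n \<Rightarrow> (CEq, n))
     else if sy l \<subset> sx l then (CEq, if sx l = insert s X \<and> sy l = X then 1 else 0)
     else (CGe, 0))"

definition kappas :: "((nat \<Rightarrow> nat) \<Rightarrow> ptype \<Rightarrow> cmp \<times> nat) set" where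
  "kappas = (\<lambda>(X, Y). kappa_some X Y) ` {(X, Y) \<in> Pow S \<times> Pow S. \<not> Y \<subseteq> X \<or> X = Y \<and> X \<in> W} \<union>
     kappa_rule ` R"

definition game :: "nat game" where
  "game = \<lparr>sys_acts = sact ` S, env_acts = eact ` S, bound = 1, acceptance = kappas\<rparr>"

lemma locations_game: "locations game = locs"
  by (simp add: locations_def game_def locs_def)

lemma is_game: "is_game game"
proof -
  have "finite kappas"
    unfolding kappas_def using finite_S finite_R
    by (intro finite_UnI finite_imageI finite_subset[OF _ finite_cartesian_product[of "Pow S" "Pow S"]]) auto
  moreover have "kappas \<subseteq> locs \<rightarrow>\<^sub>E UNIV"
    unfolding kappas_def kappa_some_def kappa_rule_def by auto
  ultimately show ?thesis
    using finite_S unfolding is_game_def locations_game by (auto simp: game_def)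
qed

lemma finite_locs: "finite (locations game)"
  using is_game by (rule finite_locations)

lemma loc_of_locs [simp]: "loc_of q \<in> locs"
  by (auto simp: loc_of_def locs_def)

lemma sx_loc_of [simp]: "X \<subseteq> S \<Longrightarrow> sx (loc_of (X, Y)) = X"
  by (auto simp: sx_def loc_of_def)

lemma sy_loc_of [simp]: "Y \<subseteq> S \<Longrightarrow> sy (loc_of (X, Y)) = Y"
  by (auto simp: sy_def loc_of_def)

lemma sx_subset [simp]: "sx l \<subseteq> S" and sy_subset [simp]: "sy l \<subseteq> S"
  by (auto simp: sx_def sy_def)

lemma loc_of_sx_sy:
  assumes l: "l \<in> locs"
  shows "loc_of (sx l, sy l) = l"
proof (rule PiE_ext[OF loc_of_locs[unfolded locs_def] l[unfolded locs_def]])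
  fix a assume a: "a \<in> sact ` S \<union> eact ` S"
  then have "l a \<in> {0..1}" using l unfolding locs_def by blast
  then have "l a = 0 \<or> l a = 1" by auto
  then show "loc_of (sx l, sy l) a = l a" using a by (auto simp: loc_of_def sx_def sy_def)
qed

lemma loc_eqI: "l \<in> locs \<Longrightarrow> l' \<in> locs \<Longrightarrow> sx l = sx l' \<Longrightarrow> sy l = sy l' \<Longrightarrow> l = l'"
  by (metis loc_of_sx_sy)

lemma step_sys: "l \<in> locs \<Longrightarrow> s \<in> S \<Longrightarrow> step_loc game l (sact s) = loc_of (insert s (sx l), sy l)"
proof (rule loc_eqI)
  assume l: "l \<in> locs" and s: "s \<in> S"
  have step: "step_loc game l (sact s) = l(sact s := 1)" by (simp add: step_loc_def game_def)
  show "step_loc game l (sact s) \<in> locs" unfolding step using l s by (auto simp: locs_def PiE_def Pi_def extensional_def)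
  show "sx (step_loc game l (sact s)) = sx (loc_of (insert s (sx l), sy l))"
    "sy (step_loc game l (sact s)) = sy (loc_of (insert s (sx l), sy l))"
    unfolding step using s by (simp_all) (auto simp: sx_def sy_def)
qed simp

lemma step_env: "l \<in> locs \<Longrightarrow> s \<in> S \<Longrightarrow> step_loc game l (eact s) = loc_of (sx l, insert s (sy l))"
proof (rule loc_eqI)
  assume l: "l \<in> locs" and s: "s \<in> S"
  have step: "step_loc game l (eact s) = l(eact s := 1)" by (simp add: step_loc_def game_def)
  show "step_loc game l (eact s) \<in> locs" unfolding step using l s by (auto simp: locs_def PiE_def Pi_def extensional_def)
  show "sx (step_loc game l (eact s)) = sx (loc_of (sx l, insert s (sy l)))"
    "sy (step_loc game l (eact s)) = sy (loc_of (sx l, insert s (sy l)))"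
    unfolding step using s by (simp_all) (auto simp: sx_def sy_def)
qed simp

text \<open>System words add to the first component of a location and leave the second alone;
  \<open>steps_env\<close> is the mirror image.\<close>

lemma steps_sys:
  "l \<in> locs \<Longrightarrow> w \<in> lists (sact ` S) \<Longrightarrow> sy (steps_loc game l w) = sy l \<and> sx l \<subseteq> sx (steps_loc game l w)"
proof (induction w arbitrary: l)
  case (Cons a w)
  then obtain s where s: "a = sact s" "s \<in> S" by auto
  have w: "w \<in> lists (sact ` S)" using Cons.prems by simp
  have "steps_loc game l (a # w) = steps_loc game (loc_of (insert s (sx l), sy l)) w"
    using step_sys[OF Cons.prems(1) s(2)] s(1) by (simp add: steps_loc_def)
  then show ?case using Cons.IH[OF loc_of_locs w, of "(insert s (sx l), sy l)"] s(2) by auto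
qed (simp add: steps_loc_def)

lemma steps_env:
  "l \<in> locs \<Longrightarrow> w \<in> lists (eact ` S) \<Longrightarrow> sx (steps_loc game l w) = sx l \<and> sy l \<subseteq> sy (steps_loc game l w)"
proof (induction w arbitrary: l)
  case (Cons a w)
  then obtain s where s: "a = eact s" "s \<in> S" by auto
  have w: "w \<in> lists (eact ` S)" using Cons.prems by simp
  have "steps_loc game l (a # w) = steps_loc game (loc_of (sx l, insert s (sy l))) w"
    using step_env[OF Cons.prems(1) s(2)] s(1) by (simp add: steps_loc_def)
  then show ?case using Cons.IH[OF loc_of_locs w, of "(sx l, insert s (sy l))"] s(2) by auto
qed (simp add: steps_loc_def)

definition counts :: "nat config \<Rightarrow> nat set \<times> nat set \<Rightarrow> nat" where
  "counts C q = C (loc_of q) Shared"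

definition conf :: "(nat set \<times> nat set \<Rightarrow> nat) \<Rightarrow> nat config" where
  "conf d = (\<lambda>l \<theta>. if \<theta> = Shared \<and> l \<in> locs then d (sx l, sy l) else 0)"

lemma counts_conf: "X \<subseteq> S \<Longrightarrow> Y \<subseteq> S \<Longrightarrow> counts (conf d) (X, Y) = d (X, Y)"
  by (simp add: counts_def conf_def)

lemma satisfies_kappa_some:
  assumes "X \<subseteq> S" "Y \<subseteq> S"
  shows "(\<forall>l\<in>locs. \<forall>\<theta>. satisfies (C l \<theta>) (kappa_some X Y l \<theta>)) \<longleftrightarrow> 0 < counts C (X, Y)"
proof
  assume "\<forall>l\<in>locs. \<forall>\<theta>. satisfies (C l \<theta>) (kappa_some X Y l \<theta>)"
  then have "satisfies (C (loc_of (X, Y)) Shared) (kappa_some X Y (loc_of (X, Y)) Shared)" by simp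
  then show "0 < counts C (X, Y)" using assms by (simp add: kappa_some_def counts_def)
next
  assume "0 < counts C (X, Y)"
  then show "\<forall>l\<in>locs. \<forall>\<theta>. satisfies (C l \<theta>) (kappa_some X Y l \<theta>)"
    using loc_of_sx_sy by (auto simp: kappa_some_def counts_def)
qed

lemma satisfies_kappa_rule:
  assumes "(X, s, g) \<in> R"
  shows "(\<forall>l\<in>locs. \<forall>\<theta>. satisfies (C l \<theta>) (kappa_rule (X, s, g) l \<theta>)) \<longleftrightarrow> pending (X, s, g) (counts C)"
    (is "?L \<longleftrightarrow> ?R")
proof -
  have X: "X \<subseteq> S" "insert s X \<subseteq> S" "X \<subset> insert s X" using rules[OF assms] by auto
  have "?L \<longleftrightarrow> (\<forall>l\<in>locs. satisfies (counts C (sx l, sy l)) (kappa_rule (X, s, g) l Shared))"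
  proof
    assume ?L
    then show "\<forall>l\<in>locs. satisfies (counts C (sx l, sy l)) (kappa_rule (X, s, g) l Shared)"
      by (simp add: counts_def loc_of_sx_sy)
  next
    assume *: "\<forall>l\<in>locs. satisfies (counts C (sx l, sy l)) (kappa_rule (X, s, g) l Shared)"
    show ?L
    proof (intro ballI allI)
      fix l \<theta> assume l: "l \<in> locs"
      show "satisfies (C l \<theta>) (kappa_rule (X, s, g) l \<theta>)"
        using * l by (cases "\<theta> = Shared") (auto simp: counts_def loc_of_sx_sy kappa_rule_def)
    qed
  qed
  also have "\<dots> \<longleftrightarrow> (\<forall>X'\<in>Pow S. \<forall>Y'\<in>Pow S.
      satisfies (counts C (X', Y')) (kappa_rule (X, s, g) (loc_of (X', Y')) Shared))"
  proof
    assume "\<forall>l\<in>locs. satisfies (counts C (sx l, sy l)) (kappa_rule (X, s, g) l Shared)"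
    then show "\<forall>X'\<in>Pow S. \<forall>Y'\<in>Pow S.
      satisfies (counts C (X', Y')) (kappa_rule (X, s, g) (loc_of (X', Y')) Shared)"
      by (metis PowD loc_of_locs sx_loc_of sy_loc_of)
  next
    assume "\<forall>X'\<in>Pow S. \<forall>Y'\<in>Pow S.
      satisfies (counts C (X', Y')) (kappa_rule (X, s, g) (loc_of (X', Y')) Shared)"
    then show "\<forall>l\<in>locs. satisfies (counts C (sx l, sy l)) (kappa_rule (X, s, g) l Shared)"
      by (metis PowI loc_of_sx_sy sx_subset sy_subset)
  qed
  also have "\<dots> \<longleftrightarrow> ?R"
  proof
    assume *: "\<forall>X'\<in>Pow S. \<forall>Y'\<in>Pow S.
      satisfies (counts C (X', Y')) (kappa_rule (X, s, g) (loc_of (X', Y')) Shared)"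
    have "counts C (insert s X, X) = 1"
      using *[rule_format, of "insert s X" X] X by (simp add: kappa_rule_def psubset_eq eq_commute[of X])
    moreover have "counts C (X', Y') = 0"
      if "X' \<in> Pow S" "Y' \<in> Pow S" "Y' \<subset> X'" "(X', Y') \<noteq> (insert s X, X)" for X' Y'
      using *[rule_format, of X' Y'] that by (auto simp: kappa_rule_def split: if_splits)
    moreover have "counts C (Y, Y) = n" if "Y \<in> Pow S" "g Y = Some n" for Y n
      using *[rule_format, of Y Y] that by (simp add: kappa_rule_def)
    ultimately show ?R by (simp add: pending_def)
  next
    assume R: ?R
    show "\<forall>X'\<in>Pow S. \<forall>Y'\<in>Pow S.
      satisfies (counts C (X', Y')) (kappa_rule (X, s, g) (loc_of (X', Y')) Shared)"
    proof (intro ballI)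
      fix X' Y' assume XY: "X' \<in> Pow S" "Y' \<in> Pow S"
      show "satisfies (counts C (X', Y')) (kappa_rule (X, s, g) (loc_of (X', Y')) Shared)"
        using R XY by (auto simp: kappa_rule_def pending_def split: option.split)
    qed
  qed
  finally show ?thesis .
qed

lemma accepting_game: "accepting game C \<longleftrightarrow> accept (counts C)"
proof -
  have acc: "accepting game C \<longleftrightarrow> (\<exists>\<kappa>\<in>kappas. \<forall>l\<in>locs. \<forall>\<theta>. satisfies (C l \<theta>) (\<kappa> l \<theta>))"
    unfolding accepting_def locations_game by (simp add: game_def)
  show ?thesis
  proof
    assume "accepting game C"
    then obtain \<kappa> where \<kappa>: "\<kappa> \<in> kappas" and sat: "\<forall>l\<in>locs. \<forall>\<theta>. satisfies (C l \<theta>) (\<kappa> l \<theta>)"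
      unfolding acc by blast
    from \<kappa> consider X Y where "\<kappa> = kappa_some X Y" "X \<subseteq> S" "Y \<subseteq> S" "\<not> Y \<subseteq> X \<or> X = Y \<and> X \<in> W"
      | X s g where "\<kappa> = kappa_rule (X, s, g)" "(X, s, g) \<in> R"
      unfolding kappas_def by fast
    then show "accept (counts C)"
    proof cases
      case 1
      then have "0 < counts C (X, Y)" using sat satisfies_kappa_some[OF 1(2,3)] by simp
      then show ?thesis using 1(2-4) unfolding accept_def cheated_def won_def by blast
    next
      case 2
      then have "pending (X, s, g) (counts C)" using sat satisfies_kappa_rule[OF 2(2)] by simp
      then show ?thesis using 2(2) unfolding accept_def by blast
    qed
  next
    have some: "accepting game C"
      if "0 < counts C (X, Y)" "X \<subseteq> S" "Y \<subseteq> S" "\<not> Y \<subseteq> X \<or> X = Y \<and> X \<in> W" for X Y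
    proof -
      have "kappa_some X Y \<in> kappas" unfolding kappas_def using that
        by (intro UnI1 image_eqI[of _ _ "(X, Y)"]) auto
      then show ?thesis unfolding acc
        by (rule bexI[rotated]) (simp only: satisfies_kappa_some[OF that(2,3)] that(1))
    qed
    have rule: "accepting game C" if "(X, s, g) \<in> R" "pending (X, s, g) (counts C)" for X s g
    proof -
      have "kappa_rule (X, s, g) \<in> kappas" unfolding kappas_def using that
        by (intro UnI2 imageI)
      then show ?thesis unfolding acc
        by (rule bexI[rotated]) (simp only: satisfies_kappa_rule[OF that(1)] that(2))
    qed
    assume "accept (counts C)"
    then consider "cheated (counts C)" | "won (counts C)" | \<rho> where "\<rho> \<in> R" "pending \<rho> (counts C)"
      unfolding accept_def by blast
    then show "accepting game C"
    proof cases
      case 1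
      then obtain X Y where "X \<subseteq> S" "Y \<subseteq> S" "\<not> Y \<subseteq> X" "0 < counts C (X, Y)"
        unfolding cheated_def by auto
      then show ?thesis using some[of X Y] by simp
    next
      case 2
      then obtain X where X: "X \<in> W" "0 < counts C (X, X)" unfolding won_def by blast
      then have "X \<subseteq> S" using W(1) by blast
      then show ?thesis using some[of X X] X by simp
    next
      case (3 \<rho>)
      then show ?thesis using rule by (metis prod_cases3)
    qed
  qed
qed

lemma accepting_conf: "accepting game (conf d) \<longleftrightarrow> accept d"
proof -
  have "matches (counts (conf d)) d" unfolding matches_def using counts_conf by blast
  then show ?thesis unfolding accepting_game by (rule accept_cong)
qed

lemma init_config_game:
  "init_config game (0, 0, k) = conf (settled (\<lambda>Y. if Y = {} then k else 0))"
proof (intro ext)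
  fix l \<theta>
  have init: "init_loc game = loc_of ({}, {})"
    by (simp add: init_loc_def game_def loc_of_def)
  have "l = init_loc game \<longleftrightarrow> l \<in> locs \<and> sx l = {} \<and> sy l = {}"
    unfolding init by (metis empty_subsetI loc_of_locs loc_of_sx_sy sx_loc_of sy_loc_of)
  then show "init_config game (0, 0, k) l \<theta> = conf (settled (\<lambda>Y. if Y = {} then k else 0)) l \<theta>"
    by (cases \<theta>) (auto simp: init_config_def conf_def settled_def)
qed

lemma move_conf:
  assumes "X \<subseteq> S" "Y \<subseteq> S" "X' \<subseteq> S" "Y' \<subseteq> S" "(X, Y) \<noteq> (X', Y')"
  shows "move_process (loc_of (X, Y)) (loc_of (X', Y')) (conf d) n =
    conf (d((X, Y) := d (X, Y) - n, (X', Y') := d (X', Y') + n))"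
proof (intro ext)
  fix l \<theta>
  have "l = loc_of (X, Y) \<longleftrightarrow> l \<in> locs \<and> sx l = X \<and> sy l = Y"
    "l = loc_of (X', Y') \<longleftrightarrow> l \<in> locs \<and> sx l = X' \<and> sy l = Y'"
    using assms by (metis loc_of_locs loc_of_sx_sy sx_loc_of sy_loc_of)+
  then show "move_process (loc_of (X, Y)) (loc_of (X', Y')) (conf d) n l \<theta> =
    conf (d((X, Y) := d (X, Y) - n, (X', Y') := d (X', Y') + n)) l \<theta>"
    using assms(5) by (auto simp: move_process_def conf_def)
qed

section \<open>Available and forced moves\<close>

lemma system_move:
  assumes "fires X s c"
  defines "\<tau> \<equiv> single (loc_of (X, X)) (loc_of (insert s X, X))"
  shows "\<tau> \<in> sys_transitions game" "applicable game \<tau> (conf (settled c))"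
    "apply_trans game \<tau> (conf (settled c)) = conf (asking X s c)"
proof -
  have wf: "X \<subseteq> S" "s \<in> S" "s \<notin> X" "0 < c X" using fires_wf[OF assms(1)] by auto
  have neq: "loc_of (X, X) \<noteq> loc_of (insert s X, X)" "(X, X) \<noteq> (insert s X, X)"
    using wf by (metis insertI1 insert_subset sx_loc_of) (use wf in blast)
  have step: "[sact s] \<in> lists (sact ` S)" "loc_of (insert s X, X) = steps_loc game (loc_of (X, X)) [sact s]"
    using wf step_sys[of "loc_of (X, X)" s] by (simp_all add: steps_loc_def)
  have pos: "0 < conf (settled c) (loc_of (X, X)) Shared" using wf by (simp add: conf_def settled_def)
  have locs: "loc_of (X, X) \<in> locations game" "loc_of (insert s X, X) \<in> locations game"
    by (simp_all add: locations_game)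
  note tr = single_transition[OF finite_locs locs neq(1) step]
  show "\<tau> \<in> sys_transitions game"
    unfolding \<tau>_def sys_transitions_def using tr(1)[of Env] by (simp add: game_def)
  show "applicable game \<tau> (conf (settled c))"
    unfolding \<tau>_def by (rule tr(2)[of Env]) (use pos in simp_all)
  have "apply_trans game \<tau> (conf (settled c)) =
      move_process (loc_of (X, X)) (loc_of (insert s X, X)) (conf (settled c)) 1"
    unfolding \<tau>_def by (rule tr(3)[of Env]) (use pos in simp_all)
  then show "apply_trans game \<tau> (conf (settled c)) = conf (asking X s c)"
    using move_conf[of X X "insert s X" X "settled c" 1] neq(2) wf settled_asking[OF wf(3), of c] by simp
qed

lemma environment_move:
  assumes "fires X s c"
  defines "\<tau> \<equiv> single (loc_of (insert s X, X)) (loc_of (insert s X, insert s X))"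
  shows "\<tau> \<in> env_transitions game" "applicable game \<tau> (conf (asking X s c))"
    "apply_trans game \<tau> (conf (asking X s c)) = conf (settled (move_token X s c))"
proof -
  have wf: "X \<subseteq> S" "s \<in> S" "s \<notin> X" "0 < c X" using fires_wf[OF assms(1)] by auto
  have neq: "loc_of (insert s X, X) \<noteq> loc_of (insert s X, insert s X)" "(insert s X, X) \<noteq> (insert s X, insert s X)"
    using wf by (metis insertI1 insert_subset sy_loc_of) (use wf in blast)
  have step: "[eact s] \<in> lists (eact ` S)"
    "loc_of (insert s X, insert s X) = steps_loc game (loc_of (insert s X, X)) [eact s]"
    using wf step_env[of "loc_of (insert s X, X)" s] by (simp_all add: steps_loc_def)
  have pos: "0 < conf (asking X s c) (loc_of (insert s X, X)) Shared" using wf by (simp add: conf_def asking_def)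
  have locs: "loc_of (insert s X, X) \<in> locations game" "loc_of (insert s X, insert s X) \<in> locations game"
    by (simp_all add: locations_game)
  note tr = single_transition[OF finite_locs locs neq(1) step]
  show "\<tau> \<in> env_transitions game"
    unfolding \<tau>_def env_transitions_def using tr(1)[of Sys] by (simp add: game_def)
  show "applicable game \<tau> (conf (asking X s c))"
    unfolding \<tau>_def by (rule tr(2)[of Sys]) (use pos in simp_all)
  have "apply_trans game \<tau> (conf (asking X s c)) =
      move_process (loc_of (insert s X, X)) (loc_of (insert s X, insert s X)) (conf (asking X s c)) 1"
    unfolding \<tau>_def by (rule tr(3)[of Sys]) (use pos in simp_all)
  then show "apply_trans game \<tau> (conf (asking X s c)) = conf (settled (move_token X s c))"
    using move_conf[of "insert s X" X "insert s X" "insert s X" "asking X s c" 1] neq(2) wf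
      asking_settled[OF wf(3), of c] by simp
qed

lemma transition_locs:
  assumes "\<tau> \<in> transitions game A \<theta>0" "0 < \<tau> a b \<theta>"
  obtains w where "a \<in> locs" "b \<in> locs" "w \<in> lists A" "b = steps_loc game a w"
proof -
  have "\<tau> a b \<theta> \<noteq> 0" using assms(2) by simp
  moreover have "\<forall>l l' \<theta>. \<tau> l l' \<theta> \<noteq> 0 \<longrightarrow>
      l \<in> locs \<and> l' \<in> locs \<and> (\<exists>w\<in>lists A. l' = steps_loc game l w)"
    using assms(1) unfolding transitions_def locations_game by simp
  ultimately have "a \<in> locs \<and> b \<in> locs \<and> (\<exists>w\<in>lists A. b = steps_loc game a w)"
    by (elim allE impE)
  then show thesis using that by blast
qed

text \<open>A system transition cannot change acknowledgements, so every process that really moves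
  ends with fewer acknowledgements than actions. Acceptance without a win means a pending rule,
  which allows a single process in that situation; hence exactly one token has moved.\<close>

lemma system_forced:
  assumes \<tau>: "\<tau> \<in> sys_transitions game" and app: "applicable game \<tau> (conf (settled c))"
    and acc: "accepting game (apply_trans game \<tau> (conf (settled c)))" and c: "\<not> ts_won c"
  obtains X s where "fires X s c" "apply_trans game \<tau> (conf (settled c)) = conf (asking X s c)"
proof -
  let ?C = "conf (settled c)"
  let ?D = "apply_trans game \<tau> ?C"
  have tr: "\<tau> \<in> transitions game (sact ` S) Env" using \<tau> by (simp add: sys_transitions_def game_def)
  note le = transition_le[OF finite_locs tr app]
  have source: "\<theta> = Shared \<and> a \<in> locs \<and> sx a = sy a \<and> 0 < c (sy a)" if "0 < ?C a \<theta>" for a \<theta>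
    using that by (auto simp: conf_def settled_def split: if_splits)
  have move: "\<theta> = Shared \<and> a \<in> locs \<and> b \<in> locs \<and> sx a = sy a \<and> sy b = sy a \<and> sx a \<subseteq> sx b \<and> 0 < c (sy a)"
    if pos: "0 < \<tau> a b \<theta>" for a b \<theta>
  proof -
    obtain w where w: "a \<in> locs" "b \<in> locs" "w \<in> lists (sact ` S)" "b = steps_loc game a w"
      by (rule transition_locs[OF tr, of a b \<theta>, OF pos])
    have "0 < ?C a \<theta>" using le(1)[of a b \<theta>] pos by simp
    from source[OF this] steps_sys[OF w(1,3)] w show ?thesis by simp
  qed
  obtain X s g where X: "(X, s, g) \<in> R" "pending (X, s, g) (counts ?D)"
  proof (rule asking_if_accept)
    show "accept (counts ?D)" using acc unfolding accepting_game .
    show "\<not> ts_won c" by (rule c)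
    fix X Y assume XY: "X \<subseteq> S" "Y \<subseteq> S" "0 < counts ?D (X, Y)"
    then have "0 < ?D (loc_of (X, Y)) Shared" by (simp add: counts_def)
    from apply_trans_pos[OF this] show "Y \<subseteq> X \<and> 0 < c Y"
    proof
      assume "0 < ?C (loc_of (X, Y)) Shared"
      from source[OF this] show ?thesis using XY by simp
    next
      assume "\<exists>a. 0 < \<tau> a (loc_of (X, Y)) Shared"
      then obtain a where "0 < \<tau> a (loc_of (X, Y)) Shared" ..
      from move[OF this] show ?thesis using XY by auto
    qed
  qed
  have wf: "X \<subseteq> S" "s \<in> S" "s \<notin> X" using rules[OF X(1)] by auto
  let ?l = "loc_of (X, X)" and ?l' = "loc_of (insert s X, X)"
  have neq: "(X, X) \<noteq> (insert s X, X)" "?l \<noteq> ?l'"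
    using wf by blast (use wf in \<open>metis insertI1 insert_subset sx_loc_of\<close>)
  have only: "a = ?l \<and> b = ?l' \<and> \<theta> = Shared" if pos: "0 < \<tau> a b \<theta>" and ab: "a \<noteq> b" for a b \<theta>
  proof -
    note m = move[OF pos]
    have "sx a \<noteq> sx b" using m ab loc_eqI by metis
    then have "sy b \<subset> sx b" using m by auto
    moreover have "counts ?D (sx b, sy b) \<noteq> 0"
    proof -
      have "loc_of (sx b, sy b) = b" using m loc_of_sx_sy by blast
      then show ?thesis unfolding counts_def using le(2)[of a b \<theta>] pos m by simp
    qed
    moreover have "sx b \<in> Pow S" "sy b \<in> Pow S" by simp_all
    moreover have "\<forall>X'\<in>Pow S. \<forall>Y'\<in>Pow S. Y' \<subset> X' \<longrightarrow> (X', Y') \<noteq> (insert s X, X)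
        \<longrightarrow> counts ?D (X', Y') = 0"
      by (rule X(2)[unfolded pending_def prod.case, THEN conjunct2, THEN conjunct1])
    ultimately have "(sx b, sy b) = (insert s X, X)" by meson
    then have "sx b = insert s X" "sy b = X" by simp_all
    then show ?thesis using m loc_of_sx_sy[of a] loc_of_sx_sy[of b] by simp
  qed
  have "?l \<in> locations game" "?l' \<in> locations game" by (simp_all add: locations_game)
  from apply_trans_move[OF finite_locs tr app this neq(2) only]
  have D: "?D = move_process ?l ?l' ?C (\<tau> ?l ?l' Shared)" by simp
  also have "\<dots> = conf ((settled c)((X, X) := settled c (X, X) - \<tau> ?l ?l' Shared,
      (insert s X, X) := settled c (insert s X, X) + \<tau> ?l ?l' Shared))"
    using wf neq(1) by (intro move_conf) auto
  finally have D: "?D = conf ((settled c)((X, X) := settled c (X, X) - \<tau> ?l ?l' Shared,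
      (insert s X, X) := settled c (insert s X, X) + \<tau> ?l ?l' Shared))" .
  \<comment> \<open>Before the transition nobody was at this pair, so the count 1 is the size of the
    flow.\<close>
  have "counts ?D (insert s X, X) = 1" using X(2) by (simp add: pending_def)
  then have n: "\<tau> ?l ?l' Shared = 1"
    unfolding D using wf neq(1) by (subst (asm) counts_conf) (auto simp: settled_def)
  then have D: "?D = conf (asking X s c)" using D settled_asking[OF wf(3), of c] by simp
  have "0 < c X" using move[of ?l ?l' Shared] n wf by simp
  moreover have "pending (X, s, g) (asking X s c)"
  proof -
    have "matches (counts (conf (asking X s c))) (asking X s c)"
      unfolding matches_def using counts_conf by blast
    from pending_cong[OF this X(1)] show ?thesis using X(2) unfolding D by simp
  qed
  ultimately have "fires X s c" using fires_if_pending X(1) by blast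
  then show thesis using that D by blast
qed

text \<open>An acknowledgement to a process that asked for nothing, or one that goes beyond the
  request, is a cheat and keeps the condition true. So does leaving every process in place. The
  requested acknowledgement is all that remains.\<close>

lemma environment_forced:
  assumes fires: "fires X s c" and \<tau>: "\<tau> \<in> env_transitions game"
    and app: "applicable game \<tau> (conf (asking X s c))"
    and acc: "\<not> accepting game (apply_trans game \<tau> (conf (asking X s c)))"
  shows "apply_trans game \<tau> (conf (asking X s c)) = conf (settled (move_token X s c))"
proof -
  let ?C = "conf (asking X s c)"
  let ?D = "apply_trans game \<tau> ?C"
  have wf: "X \<subseteq> S" "s \<in> S" "s \<notin> X" using fires_wf[OF fires] by auto
  have tr: "\<tau> \<in> transitions game (eact ` S) Sys" using \<tau> by (simp add: env_transitions_def game_def)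
  note le = transition_le[OF finite_locs tr app]
  let ?l = "loc_of (insert s X, X)" and ?l' = "loc_of (insert s X, insert s X)"
  have neq: "(insert s X, X) \<noteq> (insert s X, insert s X)" "?l \<noteq> ?l'"
    using wf by blast (use wf in \<open>metis insertI1 insert_subset sy_loc_of\<close>)
  have only: "a = ?l \<and> b = ?l' \<and> \<theta> = Shared" if pos: "0 < \<tau> a b \<theta>" and ab: "a \<noteq> b" for a b \<theta>
  proof -
    obtain w where w: "a \<in> locs" "b \<in> locs" "w \<in> lists (eact ` S)" "b = steps_loc game a w"
      by (rule transition_locs[OF tr, of a b \<theta>, OF pos])
    then have b: "sx b = sx a" "sy a \<subseteq> sy b" using steps_env[OF w(1,3)] by simp_all
    then have "sy a \<noteq> sy b" using w ab loc_eqI by metis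
    have "0 < ?C a \<theta>" using le(1)[of a b \<theta>] pos by simp
    then have \<theta>: "\<theta> = Shared" and a: "sx a = sy a \<or> sx a = insert s X \<and> sy a = X"
      by (auto simp: conf_def asking_def settled_def split: if_splits)
    have "0 < counts ?D (sx b, sy b)"
      using le(2)[of a b \<theta>] pos w(2) loc_of_sx_sy by (simp add: counts_def \<theta>)
    moreover have "\<not> cheated (counts ?D)"
      using acc unfolding accepting_game accept_def by blast
    ultimately have "sy b \<subseteq> sx b"
      unfolding cheated_def using sx_subset[of b] sy_subset[of b] by blast
    then have "sx a = insert s X" "sy a = X" "sy b = insert s X"
      using a b \<open>sy a \<noteq> sy b\<close> by auto
    then show ?thesis using w(1,2) b(1) \<theta> loc_of_sx_sy[of a] loc_of_sx_sy[of b] by simp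
  qed
  have "?l \<in> locations game" "?l' \<in> locations game" by (simp_all add: locations_game)
  from apply_trans_move[OF finite_locs tr app this neq(2) only]
  have D: "?D = move_process ?l ?l' ?C (\<tau> ?l ?l' Shared)" by simp
  also have "\<dots> = conf ((asking X s c)((insert s X, X) := asking X s c (insert s X, X) - \<tau> ?l ?l' Shared,
      (insert s X, insert s X) := asking X s c (insert s X, insert s X) + \<tau> ?l ?l' Shared))"
    using wf neq(1) by (intro move_conf) auto
  finally have D: "?D = conf ((asking X s c)((insert s X, X) := asking X s c (insert s X, X) - \<tau> ?l ?l' Shared,
      (insert s X, insert s X) := asking X s c (insert s X, insert s X) + \<tau> ?l ?l' Shared))" .
  have "\<tau> ?l ?l' Shared \<le> 1"
    using le(1)[of ?l ?l' Shared] wf by (simp add: conf_def asking_def)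
  moreover have "\<tau> ?l ?l' Shared \<noteq> 0"
  proof
    assume "\<tau> ?l ?l' Shared = 0"
    then have "?D = ?C" using D by simp
    then show False using acc accept_asking[OF fires] by (simp add: accepting_conf)
  qed
  ultimately have "\<tau> ?l ?l' Shared = 1" by simp
  then show ?thesis using D asking_settled[OF wf(3), of c] by simp
qed

section \<open>Strategies in the game\<close>

definition good_move :: "nat config \<Rightarrow> nat trans \<Rightarrow> bool" where
  "good_move D \<tau> \<longleftrightarrow> (\<exists>c X s. D = conf (settled c) \<and> fires X s c \<and> can_win (move_token X s c) \<and>
     \<tau> = single (loc_of (X, X)) (loc_of (insert s X, X)))"

definition follow_run :: "nat config \<Rightarrow> nat play \<Rightarrow> nat trans option" where
  "follow_run C \<pi> = (let D = play_config C \<pi> (length \<pi>) in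
     if \<exists>\<tau>. good_move D \<tau> then Some (SOME \<tau>. good_move D \<tau>) else None)"

lemma follow_run_SomeD: "follow_run C \<pi> = Some \<tau> \<Longrightarrow> good_move (play_config C \<pi> (length \<pi>)) \<tau>"
  unfolding follow_run_def Let_def by (metis option.distinct(1) option.inject someI_ex)

lemma good_move_ex: "can_win c \<Longrightarrow> \<not> ts_won c \<Longrightarrow> \<exists>\<tau>. good_move (conf (settled c)) \<tau>"
  unfolding good_move_def by (erule can_win.cases) blast+

lemma good_move_valid:
  assumes "good_move D \<tau>"
  obtains c X s where "D = conf (settled c)" "fires X s c" "can_win (move_token X s c)"
    "\<tau> \<in> sys_transitions game" "applicable game \<tau> D" "apply_trans game \<tau> D = conf (asking X s c)"
    "accepting game (apply_trans game \<tau> D)"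
proof -
  obtain c X s where c: "D = conf (settled c)" "fires X s c" "can_win (move_token X s c)"
    "\<tau> = single (loc_of (X, X)) (loc_of (insert s X, X))"
    using assms unfolding good_move_def by blast
  then show thesis
    using that system_move[OF c(2)] accept_asking[OF c(2)] by (simp add: accepting_conf)
qed

lemma follow_run_invariant:
  assumes win: "ts_wins R W k"
  defines "C0 \<equiv> conf (settled (\<lambda>Y. if Y = {} then k else 0))"
  shows "\<pi> \<in> plays game C0 \<Longrightarrow> follows (follow_run C0) \<pi> \<Longrightarrow>
    (if even (length \<pi>) then \<exists>c. play_config C0 \<pi> (length \<pi>) = conf (settled c) \<and> can_win c \<and> \<not> ts_won c
     else \<exists>c X s. fires X s c \<and> can_win (move_token X s c) \<and>
       play_config C0 \<pi> (length \<pi>) = conf (asking X s c))"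
proof (induction \<pi> rule: rev_induct)
  case Nil
  have "play_config C0 [] (length []) = C0" by (simp add: play_config_def)
  then show ?case unfolding C0_def using can_win_init[OF win] not_won_init by auto
next
  case (snoc z \<pi>)
  obtain \<tau> D where z: "z = (\<tau>, D)" by fastforce
  note pl = snoc.prems[unfolded z plays_snoc follows_snoc]
  note IH = snoc.IH[OF conjunct1[OF pl(1)] conjunct1[OF pl(2)]]
  show ?case
  proof (cases "even (length \<pi>)")
    case True
    then have "good_move (play_config C0 \<pi> (length \<pi>)) \<tau>" using pl(2) follow_run_SomeD by blast
    then obtain c X s where "fires X s c" "can_win (move_token X s c)"
      "apply_trans game \<tau> (play_config C0 \<pi> (length \<pi>)) = conf (asking X s c)"
      by (rule good_move_valid)
    then show ?thesis unfolding z play_config_snoc using True pl(1) by auto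
  next
    case False
    then obtain c X s where c: "fires X s c" "can_win (move_token X s c)"
      "play_config C0 \<pi> (length \<pi>) = conf (asking X s c)" using IH by auto
    \<comment> \<open>An environment move has to falsify the condition, so an acknowledgement that
      completes a target is not a legal move, and the settled configuration reached here is not
      won.\<close>
    have D: "D = conf (settled (move_token X s c))" "\<not> accepting game D"
      using environment_forced[OF c(1), of \<tau>] pl(1) False unfolding c(3) by auto
    then have "\<not> ts_won (move_token X s c)" by (simp add: accepting_conf accept_settled)
    then show ?thesis unfolding z play_config_snoc using False D(1) c(2) by auto
  qed
qed

text \<open>At even length the strategy is defined and the play can be extended, so maximal plays
  have odd length and end in an accepting request.\<close>

lemma game_win_if_ts_wins:
  assumes win: "ts_wins R W k"
  shows "(0, 0, k) \<in> game_win game"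
proof -
  define C0 where "C0 = conf (settled (\<lambda>Y. if Y = {} then k else 0))"
  let ?f = "follow_run C0"
  have "game_strategy game C0 ?f"
    unfolding game_strategy_def
  proof (intro conjI ballI allI impI)
    have "play_config C0 [] (length []) = C0" by (simp add: play_config_def)
    then show "?f [] \<noteq> None"
      using good_move_ex[OF can_win_init[OF win] not_won_init] by (simp add: follow_run_def C0_def)
    fix \<pi> \<tau> assume "?f \<pi> = Some \<tau>"
    then have "good_move (play_config C0 \<pi> (length \<pi>)) \<tau>" by (rule follow_run_SomeD)
    then show "\<tau> \<in> sys_transitions game" "applicable game \<tau> (play_config C0 \<pi> (length \<pi>))"
      "accepting game (apply_trans game \<tau> (play_config C0 \<pi> (length \<pi>)))"
      by (blast elim: good_move_valid)+
  qed
  moreover have "game_winning game C0 ?f"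
    unfolding game_winning_def
  proof (intro ballI impI, elim conjE)
    fix \<pi> assume \<pi>: "\<pi> \<in> plays game C0" "follows ?f \<pi>"
      and max: "\<not> (\<exists>\<pi>'\<in>plays game C0. follows ?f \<pi>' \<and> strict_prefix \<pi> \<pi>')"
    note inv = follow_run_invariant[OF win, folded C0_def, OF \<pi>]
    show "accepting game (play_config C0 \<pi> (length \<pi>))"
    proof (cases "even (length \<pi>)")
      case True
      then obtain c where c: "play_config C0 \<pi> (length \<pi>) = conf (settled c)" "can_win c" "\<not> ts_won c"
        using inv by auto
      then have "?f \<pi> \<noteq> None" using good_move_ex by (simp add: follow_run_def)
      then obtain \<tau> where \<tau>: "?f \<pi> = Some \<tau>" by blast
      from follow_run_SomeD[OF this]
      have "\<pi> @ [(\<tau>, apply_trans game \<tau> (play_config C0 \<pi> (length \<pi>)))] \<in> plays game C0"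
        by (rule good_move_valid) (use \<pi>(1) True in \<open>simp add: plays_snoc\<close>)
      moreover have "follows ?f (\<pi> @ [(\<tau>, apply_trans game \<tau> (play_config C0 \<pi> (length \<pi>)))])"
        using \<pi>(2) \<tau> by (simp add: follows_snoc)
      ultimately show ?thesis using max by (auto simp: strict_prefix_def)
    next
      case False
      then obtain c X s where "fires X s c" "play_config C0 \<pi> (length \<pi>) = conf (asking X s c)"
        using inv by auto
      then show ?thesis using accept_asking by (simp add: accepting_conf)
    qed
  qed
  ultimately show ?thesis unfolding game_win_def init_config_game[folded C0_def, symmetric]
    using C0_def init_config_game by auto
qed

text \<open>An even play that ends unwon is not maximal, so the strategy moves, and
  \<open>system_forced\<close> turns the move into a firing. If its acknowledgement does not reach a
  target, it is a legal answer and the play goes on; this cannot last by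
  \<open>progress_terminates\<close>.\<close>

lemma ts_wins_if_game_win:
  assumes "(0, 0, k) \<in> game_win game"
  shows "ts_wins R W k"
proof -
  define C0 where "C0 = conf (settled (\<lambda>Y. if Y = {} then k else 0))"
  obtain f where f: "game_strategy game C0 f" "game_winning game C0 f"
    using assms unfolding game_win_def C0_def by (auto simp: init_config_game)
  let ?P = "\<lambda>c. \<exists>\<pi>\<in>plays game C0. follows f \<pi> \<and> even (length \<pi>) \<and>
    play_config C0 \<pi> (length \<pi>) = conf (settled c)"
  show ?thesis
  proof (rule progress_terminates[of ?P])
    show "?P (\<lambda>Y. if Y = {} then k else 0)"
      by (rule bexI[of _ "[]"]) (simp_all add: follows_def plays_def play_config_def C0_def)
  next
    fix c assume "ts_reach R k c" "?P c" and c: "\<not> ts_won c"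
    then obtain \<pi> where \<pi>: "\<pi> \<in> plays game C0" "follows f \<pi>" "even (length \<pi>)"
      "play_config C0 \<pi> (length \<pi>) = conf (settled c)" by blast
    have "\<not> accepting game (play_config C0 \<pi> (length \<pi>))"
      using c \<pi>(4) by (simp add: accepting_conf accept_settled)
    then obtain \<pi>' where "\<pi>' \<in> plays game C0" "follows f \<pi>'" "strict_prefix \<pi> \<pi>'"
      using f(2) \<pi>(1,2) unfolding game_winning_def by blast
    then obtain \<tau> D where ext: "\<pi> @ [(\<tau>, D)] \<in> plays game C0" "follows f (\<pi> @ [(\<tau>, D)])"
      by (rule play_extension)
    note pl = ext(1)[unfolded plays_snoc \<pi>(4)]
    obtain X s where X: "fires X s c" and D: "D = conf (asking X s c)"
      using system_forced[of \<tau> c] pl \<pi>(3) c by auto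
    show "\<exists>X s. fires X s c \<and> (ts_won (move_token X s c) \<or> ?P (move_token X s c))"
    proof (cases "ts_won (move_token X s c)")
      case True
      then show ?thesis using X by blast
    next
      case False
      let ?\<tau> = "single (loc_of (insert s X, X)) (loc_of (insert s X, insert s X))"
      let ?\<pi> = "(\<pi> @ [(\<tau>, D)]) @ [(?\<tau>, conf (settled (move_token X s c)))]"
      have "?\<pi> \<in> plays game C0"
        unfolding plays_snoc[of "\<pi> @ [(\<tau>, D)]"] play_config_snoc
        using ext(1) environment_move[OF X] \<pi>(3) False by (simp add: D accepting_conf accept_settled)
      moreover have "follows f ?\<pi>"
        unfolding follows_snoc[of f "\<pi> @ [(\<tau>, D)]"] using ext(2) \<pi>(3) by simp
      moreover have "even (length ?\<pi>)" using \<pi>(3) by simp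
      moreover have "play_config C0 ?\<pi> (length ?\<pi>) = conf (settled (move_token X s c))"
        by (rule play_config_snoc)
      ultimately show ?thesis using X by blast
    qed
  qed
qed

theorem game_iff: "game_win game \<inter> ({0} \<times> {0} \<times> UNIV) \<noteq> {} \<longleftrightarrow> (\<exists>k. ts_wins R W k)"
  using game_win_if_ts_wins ts_wins_if_game_win by auto

end

section \<open>Synthesis\<close>

lemma letter_Fin_eq: "letter (Fin u) = (!) u" and letter_Inf_eq: "letter (Inf g) = g"
  by (simp_all add: fun_eq_iff)

lemma map_nth_take: "n \<le> length u \<Longrightarrow> map ((!) u) [0..<n] = take n u"
  by (rule nth_equalityI) simp_all

lemma word_prefix_Fin: "n \<le> length u \<Longrightarrow> word_prefix (Fin u) n = take n u"
  using map_nth_take[of n u] by (simp add: word_prefix_def letter_Fin_eq)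

lemma compatible_snoc:
  "compatible As P f (Fin (u @ [e])) \<longleftrightarrow>
    compatible As P f (Fin u) \<and> (e \<in> sys_events As P \<longrightarrow> f u = Some e)"
proof -
  have set: "pos (Fin (u @ [e])) = insert (length u) (pos (Fin u))" by auto
  have pre: "word_prefix (Fin (u @ [e])) i = word_prefix (Fin u) i" if "i \<le> length u" for i
    using that by (simp add: word_prefix_Fin)
  have old: "(letter (Fin (u @ [e])) i \<in> sys_events As P \<longrightarrow>
        f (word_prefix (Fin (u @ [e])) i) = Some (letter (Fin (u @ [e])) i)) \<longleftrightarrow>
      (letter (Fin u) i \<in> sys_events As P \<longrightarrow> f (word_prefix (Fin u) i) = Some (letter (Fin u) i))"
    if "i \<in> pos (Fin u)" for i
  proof -
    have i: "i < length u" using that by simp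
    have "letter (Fin (u @ [e])) i = letter (Fin u) i" using i by (simp add: nth_append)
    moreover have "word_prefix (Fin (u @ [e])) i = word_prefix (Fin u) i" by (rule pre) (use i in simp)
    ultimately show ?thesis by (simp only:)
  qed
  have new: "letter (Fin (u @ [e])) (length u) = e" "word_prefix (Fin (u @ [e])) (length u) = u"
    by (simp_all add: word_prefix_Fin)
  have "(\<forall>i\<in>pos (Fin u). letter (Fin (u @ [e])) i \<in> sys_events As P \<longrightarrow>
        f (word_prefix (Fin (u @ [e])) i) = Some (letter (Fin (u @ [e])) i)) \<longleftrightarrow> compatible As P f (Fin u)"
    unfolding compatible_def using old by (rule ball_cong[OF refl])
  then show ?thesis
    unfolding compatible_def[of As P f "Fin (u @ [e])"] set ball_simps(7) new by blast
qed

lemma compatible_prefix: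
  "compatible As P f (Inf g) \<Longrightarrow> compatible As P f (Fin (map g [0..<n]))"
proof (induction n)
  case 0
  show ?case by (simp add: compatible_def)
next
  case (Suc n)
  have "g n \<in> sys_events As P \<Longrightarrow> f (map g [0..<n]) = Some (g n)"
    using Suc.prems by (auto simp: compatible_def word_prefix_def letter_Inf_eq)
  then show ?case using Suc.IH[OF Suc.prems] compatible_snoc[of As P f "map g [0..<n]" "g n"] by simp
qed

text \<open>This is how statements about the event set of an infinite execution are read off a
  finite prefix.\<close>

lemma range_eq_initial:
  assumes "finite (range g)"
  shows "\<exists>n. \<forall>m\<ge>n. g ` {..<m} = range (g :: nat \<Rightarrow> 'b)"
proof -
  obtain J where J: "finite J" "range g = g ` J" using finite_subset_image[OF assms order_refl] by blast
  then obtain n where n: "\<forall>j\<in>J. j < n" using finite_nat_set_iff_bounded[of J] by blast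
  have "g ` {..<m} = range g" if m: "n \<le> m" for m
  proof
    have "J \<subseteq> {..<m}" using n m by fastforce
    then show "range g \<subseteq> g ` {..<m}" unfolding J(2) by (rule image_mono)
  qed blast
  then show ?thesis by blast
qed

section \<open>Executions as token configurations\<close>

context token_system
begin

text \<open>The argument is a set of events: order and repetition are invisible, just as in
  locations with bound 1 and in formulas without an order.\<close>

definition status :: "(nat \<times> nat) set \<Rightarrow> nat \<Rightarrow> nat set \<times> nat set" where
  "status E p = ({s\<in>S. (sact s, p) \<in> E}, {s\<in>S. (eact s, p) \<in> E})"

definition tally :: "nat set \<Rightarrow> (nat \<times> nat) set \<Rightarrow> nat set \<times> nat set \<Rightarrow> nat" where
  "tally Q E q = card {p\<in>Q. status E p = q}"

definition valid :: "(ptype \<Rightarrow> nat set) \<Rightarrow> bool" where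
  "valid P \<longleftrightarrow> P Sys = {} \<and> P Env = {} \<and> finite (P Shared)"

lemma status_subset: "fst (status E p) \<subseteq> S" "snd (status E p) \<subseteq> S"
  by (auto simp: status_def)

lemma status_insert_sys: "s \<in> S \<Longrightarrow> status (insert (sact s, p) E) p' =
    (if p' = p then (insert s (fst (status E p)), snd (status E p)) else status E p')"
  by (auto simp: status_def)

lemma status_insert_env: "s \<in> S \<Longrightarrow> status (insert (eact s, p) E) p' =
    (if p' = p then (fst (status E p), insert s (snd (status E p))) else status E p')"
  by (auto simp: status_def)

lemma tally_pos: "finite Q \<Longrightarrow> 0 < tally Q E q \<longleftrightarrow> (\<exists>p\<in>Q. status E p = q)"
  unfolding tally_def card_gt_0_iff by auto

lemma tally_move:
  assumes Q: "finite Q" "p \<in> Q" and other: "\<And>p'. p' \<in> Q \<Longrightarrow> p' \<noteq> p \<Longrightarrow> status E' p' = status E p'"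
    and q: "status E p = q" "status E' p = q'" "q \<noteq> q'"
  shows "tally Q E' = (tally Q E)(q := tally Q E q - 1, q' := tally Q E q' + 1)"
proof
  fix r
  consider "r = q" | "r = q'" | "r \<noteq> q" "r \<noteq> q'" by blast
  then show "tally Q E' r = ((tally Q E)(q := tally Q E q - 1, q' := tally Q E q' + 1)) r"
  proof cases
    case 1
    have "x \<in> {p\<in>Q. status E' p = q} \<longleftrightarrow> x \<in> {p\<in>Q. status E p = q} - {p}" for x
      by (cases "x = p") (use other q in auto)
    then have "{p\<in>Q. status E' p = q} = {p\<in>Q. status E p = q} - {p}" by blast
    moreover have "p \<in> {p\<in>Q. status E p = q}" using Q q by simp
    ultimately show ?thesis using Q(1) q(3) 1 by (simp add: tally_def)
  next
    case 2
    have "x \<in> {p\<in>Q. status E' p = q'} \<longleftrightarrow> x \<in> insert p {p\<in>Q. status E p = q'}" for x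
      by (cases "x = p") (use other q Q(2) in auto)
    then have "{p\<in>Q. status E' p = q'} = insert p {p\<in>Q. status E p = q'}" by blast
    moreover have "p \<notin> {p\<in>Q. status E p = q'}" using q by simp
    ultimately show ?thesis using Q(1) 2 by (simp add: tally_def)
  next
    case 3
    have "x \<in> {p\<in>Q. status E' p = r} \<longleftrightarrow> x \<in> {p\<in>Q. status E p = r}" for x
      by (cases "x = p") (use other q 3 in auto)
    then have "{p\<in>Q. status E' p = r} = {p\<in>Q. status E p = r}" by blast
    then show ?thesis using 3 by (simp add: tally_def)
  qed
qed

lemma tally_unchanged: "(\<And>p. p \<in> Q \<Longrightarrow> status E' p = status E p) \<Longrightarrow> tally Q E' = tally Q E"
proof
  fix q assume "\<And>p. p \<in> Q \<Longrightarrow> status E' p = status E p"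
  then have "{p\<in>Q. status E' p = q} = {p\<in>Q. status E p = q}" by auto
  then show "tally Q E' q = tally Q E q" by (simp add: tally_def)
qed

lemma matches_upd:
  "matches d d' \<Longrightarrow> fst q \<subseteq> S \<Longrightarrow> snd q \<subseteq> S \<Longrightarrow> fst q' \<subseteq> S \<Longrightarrow> snd q' \<subseteq> S \<Longrightarrow>
    matches (d(q := d q - 1, q' := d q' + 1)) (d'(q := d' q - 1, q' := d' q' + 1))"
  unfolding matches_def by (cases q; cases q') auto

lemma cheatedI:
  assumes "finite Q" "p \<in> Q" "\<not> snd (status E p) \<subseteq> fst (status E p)"
  shows "cheated (tally Q E)"
proof -
  obtain X Y where XY: "status E p = (X, Y)" by fastforce
  have "X \<in> Pow S" "Y \<in> Pow S" using status_subset[of E p] by (simp_all add: XY)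
  moreover have "0 < tally Q E (X, Y)" using tally_pos[OF assms(1)] assms(2) XY by blast
  moreover have "\<not> Y \<subseteq> X" using assms(3) by (simp add: XY)
  ultimately show ?thesis unfolding cheated_def by blast
qed

lemma cheatedE:
  assumes "cheated (tally Q E)" "finite Q"
  obtains p where "p \<in> Q" "\<not> snd (status E p) \<subseteq> fst (status E p)"
proof -
  obtain X Y where XY: "\<not> Y \<subseteq> X" "0 < tally Q E (X, Y)"
    using assms(1) unfolding cheated_def by blast
  then obtain p where "p \<in> Q" "status E p = (X, Y)" using tally_pos[OF assms(2)] by blast
  then show thesis using that[of p] XY(1) by simp
qed

lemma settled_status:
  assumes "matches (tally Q E) (settled c)" "finite Q" "p \<in> Q"
  shows "fst (status E p) = snd (status E p) \<and> 0 < c (snd (status E p))"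
proof -
  obtain X Y where XY: "status E p = (X, Y)" by fastforce
  have "X \<subseteq> S" "Y \<subseteq> S" using status_subset[of E p] by (simp_all add: XY)
  moreover have "0 < tally Q E (X, Y)" using tally_pos[OF assms(2)] assms(3) XY by blast
  ultimately have "0 < settled c (X, Y)" using matchesD[OF assms(1)] by simp
  then show ?thesis by (auto simp: XY settled_def split: if_splits)
qed

lemma sys_events_eq: "valid P \<Longrightarrow> sys_events (sact ` S) P = sact ` S \<times> P Shared"
  and events_eq: "valid P \<Longrightarrow> events (sact ` S) (eact ` S) P = (sact ` S \<union> eact ` S) \<times> P Shared"
  by (auto simp: valid_def sys_events_def env_events_def events_def)

section \<open>A strategy that follows a winning token run\<close>

definition plan :: "nat set \<Rightarrow> (nat \<times> nat) set \<Rightarrow> nat \<times> nat \<Rightarrow> bool" where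
  "plan Q E e \<longleftrightarrow> (\<exists>c X s p. e = (sact s, p) \<and> matches (tally Q E) (settled c) \<and> \<not> ts_won c \<and>
     fires X s c \<and> can_win (move_token X s c) \<and> p \<in> Q \<and> status E p = (X, X))"

text \<open>The answer depends only on the set of past events. It is the same on all prefixes once
  that set has stabilised, which the infinite case of \<open>planned_winning\<close> uses.\<close>

definition planned :: "nat set \<Rightarrow> (nat \<times> nat) list \<Rightarrow> (nat \<times> nat) option" where
  "planned Q u = (if \<exists>e. plan Q (set u) e then Some (SOME e. plan Q (set u) e) else None)"

lemma planned_SomeD: "planned Q u = Some e \<Longrightarrow> plan Q (set u) e"
  unfolding planned_def by (metis option.distinct(1) option.inject someI_ex)

lemma plan_ex:
  assumes "matches (tally Q E) (settled c)" "can_win c" "\<not> ts_won c" "finite Q"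
  shows "\<exists>e. plan Q E e"
proof -
  obtain X s where X: "fires X s c" "can_win (move_token X s c)"
    using assms(2,3) by (auto elim: can_win.cases)
  have "X \<subseteq> S" "0 < c X" using fires_wf[OF X(1)] by auto
  then have "0 < tally Q E (X, X)" using matchesD[OF assms(1)] by (simp add: settled_def)
  then obtain p where "p \<in> Q" "status E p = (X, X)" using tally_pos[OF assms(4)] by blast
  then show ?thesis unfolding plan_def using assms X by blast
qed

text \<open>The last alternative absorbs histories in which the environment has cheated: no plan
  exists any more, and the condition stays true.\<close>

definition on_track :: "nat set \<Rightarrow> (nat \<times> nat) set \<Rightarrow> bool" where
  "on_track Q E \<longleftrightarrow> (\<exists>c. matches (tally Q E) (settled c) \<and> can_win c) \<or>
     (\<exists>c X s. matches (tally Q E) (asking X s c) \<and> fires X s c \<and> can_win (move_token X s c)) \<or>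
     cheated (tally Q E)"

lemma on_track_sys:
  assumes plan: "plan Q E e" and Q: "finite Q"
  shows "on_track Q (insert e E)"
proof -
  obtain c X s p where e: "e = (sact s, p)" and c: "matches (tally Q E) (settled c)" "fires X s c"
    "can_win (move_token X s c)" and p: "p \<in> Q" "status E p = (X, X)"
    using plan unfolding plan_def by blast
  have wf: "X \<subseteq> S" "s \<in> S" "s \<notin> X" "(X, X) \<noteq> (insert s X, X)" using fires_wf[OF c(2)] by auto
  have "tally Q (insert e E) = (tally Q E)((X, X) := tally Q E (X, X) - 1,
      (insert s X, X) := tally Q E (insert s X, X) + 1)"
    by (rule tally_move[OF Q p(1) _ p(2)]) (use wf p in \<open>simp_all add: e status_insert_sys\<close>)
  moreover have "matches \<dots> ((settled c)((X, X) := settled c (X, X) - 1,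
      (insert s X, X) := settled c (insert s X, X) + 1))"
    by (rule matches_upd[OF c(1)]) (use wf in simp_all)
  moreover have "(settled c)((X, X) := settled c (X, X) - 1, (insert s X, X) := settled c (insert s X, X) + 1)
      = asking X s c"
    by (rule settled_asking[OF wf(3)])
  ultimately have "matches (tally Q (insert e E)) (asking X s c)" by simp
  then show ?thesis unfolding on_track_def using c by blast
qed

text \<open>A repeated acknowledgement changes nothing, one without the matching system action is a
  cheat, and the only other possibility is the requested one. A cheat is permanent, since
  environment events only add acknowledgements.\<close>

lemma on_track_env:
  assumes track: "on_track Q E" and s: "s \<in> S" and p: "p \<in> Q" "finite Q"
  shows "on_track Q (insert (eact s, p) E)"
proof -
  let ?E = "insert (eact s, p) E"
  have grow: "status ?E p = (fst (status E p), insert s (snd (status E p)))" "\<And>p'. p' \<noteq> p \<Longrightarrow> status ?E p' = status E p'"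
    using s by (simp_all add: status_insert_env)
  have same: "tally Q ?E = tally Q E" if "s \<in> snd (status E p)"
    by (rule tally_unchanged) (use that grow in \<open>metis insert_absorb prod.collapse\<close>)
  have cheat: "cheated (tally Q ?E)" if "s \<notin> fst (status E p)"
    by (rule cheatedI[OF p(2,1)]) (use that grow(1) in simp)
  from track consider c where "matches (tally Q E) (settled c)" "can_win c"
    | c X t where "matches (tally Q E) (asking X t c)" "fires X t c" "can_win (move_token X t c)"
    | "cheated (tally Q E)"
    unfolding on_track_def by blast
  then show ?thesis
  proof cases
    case 1
    then have "fst (status E p) = snd (status E p)" using settled_status p by blast
    then show ?thesis using same cheat track unfolding on_track_def by metis
  next
    case 3
    then obtain p' where p': "p' \<in> Q" "\<not> snd (status E p') \<subseteq> fst (status E p')" using p(2) by (rule cheatedE)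
    then have "\<not> snd (status ?E p') \<subseteq> fst (status ?E p')" using grow by (cases "p' = p") auto
    then show ?thesis unfolding on_track_def using cheatedI[OF p(2) p'(1)] by blast
  next
    case (2 c X t)
    have wf: "X \<subseteq> S" "t \<in> S" "t \<notin> X" "(insert t X, X) \<noteq> (insert t X, insert t X)"
      using fires_wf[OF 2(2)] by auto
    obtain A B where AB: "status E p = (A, B)" by fastforce
    have "A \<subseteq> S" "B \<subseteq> S" using status_subset[of E p] by (simp_all add: AB)
    moreover have "0 < tally Q E (A, B)" using tally_pos[OF p(2)] p(1) AB by blast
    ultimately have "0 < asking X t c (A, B)" using matchesD[OF 2(1)] by simp
    then consider "fst (status E p) = snd (status E p)" | "status E p = (insert t X, X)"
      by (auto simp: AB asking_def settled_def split: if_splits)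
    then show ?thesis
    proof cases
      case 1
      then show ?thesis using same cheat track unfolding on_track_def by metis
    next
      case at: 2
      show ?thesis
      proof (cases "s = t")
        case False
        then have "s \<in> X \<or> s \<notin> fst (status E p)" using at by auto
        then show ?thesis using same cheat track at unfolding on_track_def by (metis snd_conv)
      next
        case True
        have "tally Q ?E = (tally Q E)((insert t X, X) := tally Q E (insert t X, X) - 1,
            (insert t X, insert t X) := tally Q E (insert t X, insert t X) + 1)"
          by (rule tally_move[OF p(2,1) grow(2) at _ wf(4)]) (use grow(1) at True in simp_all)
        moreover have "matches \<dots> ((asking X t c)((insert t X, X) := asking X t c (insert t X, X) - 1,
            (insert t X, insert t X) := asking X t c (insert t X, insert t X) + 1))"
          by (rule matches_upd[OF 2(1)]) (use wf in simp_all)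
        moreover have "(asking X t c)((insert t X, X) := asking X t c (insert t X, X) - 1,
            (insert t X, insert t X) := asking X t c (insert t X, insert t X) + 1) = settled (move_token X t c)"
          by (rule asking_settled[OF wf(3)])
        ultimately have "matches (tally Q ?E) (settled (move_token X t c))" by simp
        then show ?thesis unfolding on_track_def using 2(3) by blast
      qed
    qed
  qed
qed

lemma tally_init: "finite Q \<Longrightarrow> matches (tally Q {}) (settled (\<lambda>Y. if Y = {} then card Q else 0))"
  by (auto simp: matches_def tally_def status_def settled_def)

lemma on_track_compatible:
  assumes win: "ts_wins R W (card (P Shared))" and P: "valid P"
  shows "set u \<subseteq> events (sact ` S) (eact ` S) P \<Longrightarrow>
    compatible (sact ` S) P (planned (P Shared)) (Fin u) \<Longrightarrow> on_track (P Shared) (set u)"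
proof (induction u rule: rev_induct)
  case Nil
  have "finite (P Shared)" using P by (simp add: valid_def)
  then show ?case unfolding on_track_def using tally_init can_win_init[OF win] by auto
next
  case (snoc e u)
  have fin: "finite (P Shared)" using P by (simp add: valid_def)
  have IH: "on_track (P Shared) (set u)" using snoc by (simp add: compatible_snoc)
  have e: "e \<in> (sact ` S \<union> eact ` S) \<times> P Shared" using snoc.prems(1) events_eq[OF P] by simp
  show ?case
  proof (cases "e \<in> sys_events (sact ` S) P")
    case True
    then have "plan (P Shared) (set u) e"
      using snoc.prems(2) planned_SomeD by (simp add: compatible_snoc)
    then show ?thesis using on_track_sys fin by simp
  next
    case False
    then obtain s p where "e = (eact s, p)" "s \<in> S" "p \<in> P Shared"
      using e sys_events_eq[OF P] by auto
    then show ?thesis using on_track_env[OF IH _ _ fin] by simp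
  qed
qed

text \<open>The strategy is silent in a settled winnable configuration only after a win, because
  otherwise \<open>plan_ex\<close> supplies a move.\<close>

lemma accept_if_on_track:
  assumes "on_track Q E" "finite Q" "\<nexists>e. plan Q E e"
  shows "accept (tally Q E)"
proof -
  from assms(1) consider c where "matches (tally Q E) (settled c)" "can_win c"
    | c X t where "matches (tally Q E) (asking X t c)" "fires X t c" | "cheated (tally Q E)"
    unfolding on_track_def by blast
  then show ?thesis
  proof cases
    case 1
    then have "ts_won c" using plan_ex assms(2,3) by blast
    then show ?thesis using accept_cong[OF 1(1)] accept_settled by blast
  next
    case 2
    then show ?thesis using accept_cong[OF 2(1)] accept_asking by blast
  next
    case 3
    then show ?thesis unfolding accept_def by blast
  qed
qed

lemma planned_strategy: "valid P \<Longrightarrow> synth_strategy (sact ` S) (eact ` S) P (planned (P Shared))"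
  unfolding synth_strategy_def
proof
  fix u assume P: "valid P"
  show "planned (P Shared) u \<in> insert None (Some ` sys_events (sact ` S) P)"
  proof (cases "planned (P Shared) u")
    case (Some e)
    then obtain c X s p where "e = (sact s, p)" "fires X s c" "p \<in> P Shared"
      using planned_SomeD unfolding plan_def by blast
    then show ?thesis using fires_wf[of X s c] Some by (simp add: sys_events_eq[OF P])
  qed simp
qed

lemma planned_winning:
  assumes win: "ts_wins R W (card (P Shared))" and P: "valid P"
    and w: "w \<in> executions (sact ` S) (eact ` S) P"
    and comp: "compatible (sact ` S) P (planned (P Shared)) w" and fair: "fair (sact ` S) P (planned (P Shared)) w"
  shows "accept (tally (P Shared) (letter w ` pos w))"
proof -
  have fin: "finite (P Shared)" using P by (simp add: valid_def)
  show ?thesis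
  proof (cases w)
    case (Fin u)
    have E: "letter w ` pos w = set u" by (simp add: Fin letter_Fin_eq nth_image lessThan_atLeast0)
    have "set u \<subseteq> events (sact ` S) (eact ` S) P"
      unfolding E[symmetric] using w by (auto simp: executions_def)
    then have "on_track (P Shared) (set u)"
      by (rule on_track_compatible[OF win P]) (use comp in \<open>simp add: Fin\<close>)
    moreover have "\<nexists>e. plan (P Shared) (set u) e"
      using fair unfolding Fin planned_def by (auto split: if_splits)
    ultimately show ?thesis unfolding E using accept_if_on_track fin by blast
  next
    case (Inf g)
    have g: "g n \<in> (sact ` S \<union> eact ` S) \<times> P Shared" for n
      using w events_eq[OF P] by (auto simp: Inf executions_def)
    then have "finite (range g)"
      using finite_subset[of "range g" "(sact ` S \<union> eact ` S) \<times> P Shared"] finite_S fin by blast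
    then obtain n0 where n0: "\<And>m. n0 \<le> m \<Longrightarrow> g ` {..<m} = range g" using range_eq_initial by blast
    have pre: "set (map g [0..<m]) = range g" if "n0 \<le> m" for m using n0[OF that] by (simp add: atLeast0LessThan)
    have "range g \<subseteq> events (sact ` S) (eact ` S) P" unfolding events_eq[OF P] using g by blast
    then have "set (map g [0..<n0]) \<subseteq> events (sact ` S) (eact ` S) P" by auto
    then have "on_track (P Shared) (set (map g [0..<n0]))"
      by (rule on_track_compatible[OF win P]) (rule compatible_prefix[OF comp[unfolded Inf]])
    then have track: "on_track (P Shared) (range g)" using pre by simp
    \<comment> \<open>If a plan existed for the limit set, the strategy would want to move from
      \<open>n0\<close> on, and fairness would yield a late system event. That event would be
      planned, hence new to its process, although the limit set already contains it.\<close>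
    have "\<nexists>e. plan (P Shared) (range g) e"
    proof
      assume ex: "\<exists>e. plan (P Shared) (range g) e"
      have "planned (P Shared) (word_prefix (Inf g) n) \<noteq> None" if "n0 \<le> n" for n
        using ex pre[OF that] by (simp add: planned_def word_prefix_def)
      then have "{n0..} \<subseteq> {n. planned (P Shared) (word_prefix (Inf g) n) \<noteq> None}" by auto
      then have "infinite {n. planned (P Shared) (word_prefix (Inf g) n) \<noteq> None}"
        using infinite_Ici infinite_super by blast
      then have "infinite {n. g n \<in> sys_events (sact ` S) P}" using fair by (simp add: Inf)
      then obtain n where n: "n0 \<le> n" "g n \<in> sys_events (sact ` S) P"
        by (metis (mono_tags, lifting) finite_nat_set_iff_bounded linorder_not_le mem_Collect_eq)
      have "planned (P Shared) (map g [0..<n]) = Some (g n)"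
        using comp n(2) by (simp add: Inf compatible_def word_prefix_def letter_Inf_eq)
      then have "plan (P Shared) (range g) (g n)" using planned_SomeD pre[OF n(1)] by metis
      then obtain c X s p where "g n = (sact s, p)" "fires X s c" "status (range g) p = (X, X)"
        unfolding plan_def by blast
      moreover from this(2) have "s \<in> S" "s \<notin> X" using fires_wf by blast+
      moreover have "g n \<in> range g" by simp
      ultimately show False by (auto simp: status_def)
    qed
    then show ?thesis using accept_if_on_track[OF track fin] by (simp add: Inf)
  qed
qed

section \<open>From a winning strategy for synthesis to a token run\<close>

text \<open>The system moves undisturbed after the history \<open>u\<close>.\<close>

fun solo :: "((nat \<times> nat) list \<Rightarrow> (nat \<times> nat) option) \<Rightarrow> (nat \<times> nat) list \<Rightarrow> nat \<Rightarrow> (nat \<times> nat) list" where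
  "solo f u 0 = u"
| "solo f u (Suc n) = (case f (solo f u n) of None \<Rightarrow> solo f u n | Some e \<Rightarrow> solo f u n @ [e])"

lemma solo_invariant:
  assumes f: "synth_strategy (sact ` S) (eact ` S) P f"
    and u: "set u \<subseteq> events (sact ` S) (eact ` S) P" "compatible (sact ` S) P f (Fin u)"
  shows "set (solo f u n) \<subseteq> set u \<union> sys_events (sact ` S) P"
    and "set u \<subseteq> set (solo f u n)"
    and "compatible (sact ` S) P f (Fin (solo f u n))"
proof -
  have "set (solo f u n) \<subseteq> set u \<union> sys_events (sact ` S) P \<and> set u \<subseteq> set (solo f u n) \<and>
      compatible (sact ` S) P f (Fin (solo f u n))"
  proof (induction n)
    case 0
    then show ?case using u by simp
  next
    case (Suc n)
    show ?case
    proof (cases "f (solo f u n)")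
      case None
      then show ?thesis using Suc by simp
    next
      case (Some e)
      have "solo f u n \<in> lists (events (sact ` S) (eact ` S) P)"
        using Suc u(1) by (auto simp: events_def)
      then have "e \<in> sys_events (sact ` S) P" using f Some unfolding synth_strategy_def by force
      then show ?thesis using Suc Some by (auto simp: compatible_snoc)
    qed
  qed
  then show "set (solo f u n) \<subseteq> set u \<union> sys_events (sact ` S) P"
    "set u \<subseteq> set (solo f u n)" "compatible (sact ` S) P f (Fin (solo f u n))" by blast+
qed

lemma solo_prefix: "m \<le> n \<Longrightarrow> prefix (solo f u m) (solo f u n)"
proof (induction n)
  case (Suc n)
  then show ?case by (cases "m = Suc n") (auto split: option.split intro: prefix_order.trans)
qed simp

text \<open>With a silent environment either the strategy stops, giving a fair finite execution, or
  it acts forever, giving an infinite one that is fair because almost all its events are system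
  events. In the second case the full event set already occurs at a finite stage.\<close>

lemma solo_accepts:
  assumes P: "valid P" and f: "synth_strategy (sact ` S) (eact ` S) P f"
    and win: "\<And>w. w \<in> executions (sact ` S) (eact ` S) P \<Longrightarrow> compatible (sact ` S) P f w \<Longrightarrow>
      fair (sact ` S) P f w \<Longrightarrow> accept (tally (P Shared) (letter w ` pos w))"
    and u: "set u \<subseteq> events (sact ` S) (eact ` S) P" "compatible (sact ` S) P f (Fin u)"
  shows "\<exists>n. accept (tally (P Shared) (set (solo f u n)))"
proof (cases "\<exists>n. f (solo f u n) = None")
  case True
  then obtain n where n: "f (solo f u n) = None" ..
  note inv = solo_invariant[OF f u, of n]
  let ?v = "solo f u n"
  have E: "letter (Fin ?v) ` pos (Fin ?v) = set ?v"
    by (simp add: letter_Fin_eq nth_image lessThan_atLeast0)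
  have ev: "set ?v \<subseteq> events (sact ` S) (eact ` S) P" using inv(1) u(1) by (auto simp: events_def)
  have "Fin ?v \<in> executions (sact ` S) (eact ` S) P"
    using ev unfolding E[symmetric] by (auto simp: executions_def)
  from win[OF this inv(3)] n have "accept (tally (P Shared) (set ?v))" unfolding E by simp
  then show ?thesis by blast
next
  case False
  then have some: "f (solo f u n) \<noteq> None" for n by simp
  have len: "length (solo f u n) = length u + n" for n
    by (induction n) (use some in \<open>auto split: option.split\<close>)
  define g where "g i = solo f u (Suc i) ! i" for i
  have g: "solo f u n ! i = g i" if "i < length u + n" for i n
  proof -
    have mono: "solo f u a ! i = solo f u b ! i" if ab: "i < length u + a" "a \<le> b" for a b
    proof -
      obtain zs where "solo f u b = solo f u a @ zs" using solo_prefix[OF ab(2), of f u] unfolding prefix_def by blast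
      then show ?thesis using ab(1) len[of a] by (simp add: nth_append)
    qed
    show ?thesis
    proof (cases "n \<le> Suc i")
      case True
      then show ?thesis unfolding g_def using mono[OF that] by simp
    next
      case False
      then show ?thesis unfolding g_def using mono[of "Suc i" n] by simp
    qed
  qed
  have pre: "map g [0..<length u + n] = solo f u n" for n
  proof (rule nth_equalityI)
    show "length (map g [0..<length u + n]) = length (solo f u n)" by (simp add: len)
    fix i assume "i < length (map g [0..<length u + n])"
    then have "i < length u + n" by simp
    then show "map g [0..<length u + n] ! i = solo f u n ! i" using g[of i n] by simp
  qed
  have step: "f (map g [0..<i]) = Some (g i)" if "length u \<le> i" for i
  proof -
    define n where "n = i - length u"
    have n: "i = length u + n" using that by (simp add: n_def)
    obtain e where e: "f (solo f u n) = Some e" using some[of n] by auto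
    then have "solo f u (Suc n) ! i = e" using len[of n] n by (simp add: nth_append)
    then have "g i = e" using g[of i "Suc n"] n by simp
    then show ?thesis using e pre[of n] n by simp
  qed
  have ev: "g i \<in> events (sact ` S) (eact ` S) P" for i
  proof -
    have "g i \<in> set (solo f u (Suc i))" unfolding g_def using len[of "Suc i"] by (intro nth_mem) simp
    then show ?thesis using solo_invariant(1)[OF f u, of "Suc i"] u(1) by (auto simp: events_def)
  qed
  have exec: "Inf g \<in> executions (sact ` S) (eact ` S) P" using ev by (simp add: executions_def)
  have comp: "compatible (sact ` S) P f (Inf g)"
    unfolding compatible_def
  proof (intro ballI impI)
    fix i assume i: "letter (Inf g) i \<in> sys_events (sact ` S) P"
    show "f (word_prefix (Inf g) i) = Some (letter (Inf g) i)"
    proof (cases "length u \<le> i")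
      case True
      then show ?thesis using step by (simp add: word_prefix_def letter_Inf_eq)
    next
      case False
      have "u ! j = g j" if "j < length u" for j using g[of j 0] that by simp
      then have "take i u = map g [0..<i]" "u ! i = g i" using False by (auto intro: nth_equalityI)
      moreover from this(2) have "f (word_prefix (Fin u) i) = Some (g i)"
        using u(2)[unfolded compatible_def, rule_format, of i] i False by simp
      moreover have "word_prefix (Fin u) i = take i u" by (rule word_prefix_Fin) (use False in simp)
      ultimately show ?thesis by (simp add: word_prefix_def[of "Inf g"] letter_Inf_eq)
    qed
  qed
  have "g i \<in> sys_events (sact ` S) P" if "length u \<le> i" for i
  proof -
    have "map g [0..<i] \<in> lists (events (sact ` S) (eact ` S) P)" using ev by auto
    then have "f (map g [0..<i]) \<in> insert None (Some ` sys_events (sact ` S) P)"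
      using f unfolding synth_strategy_def by blast
    then show ?thesis using step[OF that] by auto
  qed
  then have "{length u..} \<subseteq> {n. g n \<in> sys_events (sact ` S) P}" by auto
  then have "fair (sact ` S) P f (Inf g)" using infinite_Ici infinite_super by auto
  from win[OF exec comp this] have acc: "accept (tally (P Shared) (range g))" by simp
  have "finite (range g)"
    using finite_subset[of "range g" "(sact ` S \<union> eact ` S) \<times> P Shared"] ev finite_S P events_eq[OF P]
    by (auto simp: valid_def)
  then obtain n where "\<forall>m\<ge>n. g ` {..<m} = range g" using range_eq_initial by blast
  then have "g ` {..<length u + n} = range g" by simp
  then have "set (solo f u n) = range g" using pre[of n, symmetric] by (simp add: atLeast0LessThan)
  then show ?thesis using acc by metis
qed

text \<open>The counterpart of \<open>system_forced\<close>. System events leave acknowledgements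
  unchanged, so any process with a new action has fewer acknowledgements than actions; the pending
  rule admits one such process. Repeated events do not matter for \<open>status\<close>.\<close>

lemma solo_asking:
  assumes P: "valid P" and c: "\<not> ts_won c" "matches (tally (P Shared) E) (settled c)"
    and E': "E \<subseteq> E'" "E' \<subseteq> E \<union> sys_events (sact ` S) P" and acc: "accept (tally (P Shared) E')"
  obtains X s p where "fires X s c" "p \<in> P Shared" "status E' p = (insert s X, X)"
    "matches (tally (P Shared) E') (asking X s c)"
proof -
  let ?Q = "P Shared"
  have fin: "finite ?Q" using P by (simp add: valid_def)
  have status: "snd (status E' p) = snd (status E p) \<and> fst (status E p) \<subseteq> fst (status E' p)" for p
    using E' unfolding sys_events_eq[OF P] by (auto simp: status_def)
  have sub: "snd (status E' p) \<subseteq> fst (status E' p) \<and> status E p = (snd (status E' p), snd (status E' p)) \<and> 0 < c (snd (status E' p))"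
    if "p \<in> ?Q" for p
    using settled_status[OF c(2) fin that] status[of p] by (metis prod.collapse)
  obtain X s g where X: "(X, s, g) \<in> R" "pending (X, s, g) (tally ?Q E')"
  proof (rule asking_if_accept[OF acc c(1)])
    fix X Y assume "0 < tally ?Q E' (X, Y)"
    then obtain p where "p \<in> ?Q" "status E' p = (X, Y)" using tally_pos[OF fin] by blast
    then show "Y \<subseteq> X \<and> 0 < c Y" using sub[of p] by simp
  qed
  have wf: "X \<subseteq> S" "s \<in> S" "s \<notin> X" using rules[OF X(1)] by auto
  have one: "card {p\<in>?Q. status E' p = (insert s X, X)} = 1"
    and none: "\<forall>X'\<in>Pow S. \<forall>Y'\<in>Pow S. Y' \<subset> X' \<longrightarrow> (X', Y') \<noteq> (insert s X, X) \<longrightarrow> tally ?Q E' (X', Y') = 0"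
    using X(2) unfolding pending_def prod.case tally_def by blast+
  then obtain p where p: "{p\<in>?Q. status E' p = (insert s X, X)} = {p}" by (auto simp: card_1_singleton_iff)
  then have pQ: "p \<in> ?Q" "status E' p = (insert s X, X)" by blast+
  have other: "status E' p' = status E p'" if p': "p' \<in> ?Q" "p' \<noteq> p" for p'
  proof -
    obtain X' Y' where XY: "status E' p' = (X', Y')" by fastforce
    have "(X', Y') \<noteq> (insert s X, X)" using p p' XY by auto
    moreover have "0 < tally ?Q E' (X', Y')" using tally_pos[OF fin] p' XY by blast
    moreover have "X' \<in> Pow S" "Y' \<in> Pow S" using status_subset[of E' p'] by (simp_all add: XY)
    ultimately have "\<not> Y' \<subset> X'" using none by (metis less_numeral_extra(3))
    then show ?thesis using sub[OF p'(1)] by (auto simp: XY)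
  qed
  have neq: "(X, X) \<noteq> (insert s X, X)" using wf by blast
  have orig: "status E p = (X, X)" "0 < c X" using sub[OF pQ(1)] pQ(2) by simp_all
  have "tally ?Q E' = (tally ?Q E)((X, X) := tally ?Q E (X, X) - 1,
      (insert s X, X) := tally ?Q E (insert s X, X) + 1)"
    by (rule tally_move[OF fin pQ(1) other orig(1) pQ(2) neq])
  moreover have "matches \<dots> ((settled c)((X, X) := settled c (X, X) - 1,
      (insert s X, X) := settled c (insert s X, X) + 1))"
    by (rule matches_upd[OF c(2)]) (use wf in simp_all)
  moreover have "(settled c)((X, X) := settled c (X, X) - 1, (insert s X, X) := settled c (insert s X, X) + 1)
      = asking X s c"
    by (rule settled_asking[OF wf(3)])
  ultimately have m: "matches (tally ?Q E') (asking X s c)" by simp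
  have "fires X s c"
    using fires_if_pending[of X s g c] X orig(2) pending_cong[OF m X(1)] by blast
  then show thesis using that pQ m by blast
qed

text \<open>The environment waits until the condition holds, which forces a request, and then
  acknowledges it. Environment events never violate compatibility, so the extended history is again
  compatible and the argument repeats.\<close>

lemma ts_wins_if_synth:
  assumes P: "valid P" and f: "synth_strategy (sact ` S) (eact ` S) P f"
    and win: "\<And>w. w \<in> executions (sact ` S) (eact ` S) P \<Longrightarrow> compatible (sact ` S) P f w \<Longrightarrow>
      fair (sact ` S) P f w \<Longrightarrow> accept (tally (P Shared) (letter w ` pos w))"
  shows "ts_wins R W (card (P Shared))"
proof -
  let ?Q = "P Shared"
  have fin: "finite ?Q" using P by (simp add: valid_def)
  let ?P = "\<lambda>c. \<exists>u. set u \<subseteq> events (sact ` S) (eact ` S) P \<and> compatible (sact ` S) P f (Fin u) \<and>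
    matches (tally ?Q (set u)) (settled c)"
  show ?thesis
  proof (rule progress_terminates[of ?P])
    show "?P (\<lambda>Y. if Y = {} then card ?Q else 0)"
      using tally_init[OF fin] by (intro exI[of _ "[]"]) (simp add: compatible_def)
  next
    fix c assume "?P c" and c: "\<not> ts_won c"
    then obtain u where u: "set u \<subseteq> events (sact ` S) (eact ` S) P" "compatible (sact ` S) P f (Fin u)"
      "matches (tally ?Q (set u)) (settled c)" by blast
    obtain n where n: "accept (tally ?Q (set (solo f u n)))" using solo_accepts[OF P f win u(1,2)] by blast
    note inv = solo_invariant[OF f u(1,2), of n]
    obtain X s p where X: "fires X s c" "p \<in> ?Q" "status (set (solo f u n)) p = (insert s X, X)"
      "matches (tally ?Q (set (solo f u n))) (asking X s c)"
      using solo_asking[OF P c u(3) inv(2,1) n] by blast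
    have wf: "X \<subseteq> S" "s \<in> S" "s \<notin> X" "(insert s X, X) \<noteq> (insert s X, insert s X)"
      using fires_wf[OF X(1)] by auto
    let ?v = "solo f u n @ [(eact s, p)]"
    have ev: "(eact s, p) \<in> events (sact ` S) (eact ` S) P" "(eact s, p) \<notin> sys_events (sact ` S) P"
      using wf X(2) by (simp_all add: events_eq[OF P] sys_events_eq[OF P])
    have "set ?v \<subseteq> events (sact ` S) (eact ` S) P"
      using inv(1) u(1) ev(1) by (auto simp: events_def)
    moreover have "compatible (sact ` S) P f (Fin ?v)" using inv(3) ev(2) by (simp add: compatible_snoc)
    moreover have "matches (tally ?Q (set ?v)) (settled (move_token X s c))"
    proof -
      have "tally ?Q (set ?v) = (tally ?Q (set (solo f u n)))
          ((insert s X, X) := tally ?Q (set (solo f u n)) (insert s X, X) - 1,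
            (insert s X, insert s X) := tally ?Q (set (solo f u n)) (insert s X, insert s X) + 1)"
        by (rule tally_move[OF fin X(2) _ X(3) _ wf(4)]) (use wf(2) X(3) in \<open>simp_all add: status_insert_env\<close>)
      moreover have "matches \<dots> ((asking X s c)((insert s X, X) := asking X s c (insert s X, X) - 1,
            (insert s X, insert s X) := asking X s c (insert s X, insert s X) + 1))"
        by (rule matches_upd[OF X(4)]) (use wf in simp_all)
      moreover have "(asking X s c)((insert s X, X) := asking X s c (insert s X, X) - 1,
            (insert s X, insert s X) := asking X s c (insert s X, insert s X) + 1) = settled (move_token X s c)"
        by (rule asking_settled[OF wf(3)])
      ultimately show ?thesis by simp
    qed
    ultimately show "\<exists>X s. fires X s c \<and> (ts_won (move_token X s c) \<or> ?P (move_token X s c))"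
      using X(1) by blast
  qed
qed

theorem synth_iff:
  assumes \<phi>: "\<And>P w. valid P \<Longrightarrow> w \<in> executions (sact ` S) (eact ` S) P \<Longrightarrow>
    models P w \<phi> \<longleftrightarrow> accept (tally (P Shared) (letter w ` pos w))"
  shows "synth_win (sact ` S) (eact ` S) \<phi> \<inter> ({0} \<times> {0} \<times> UNIV) \<noteq> {} \<longleftrightarrow> (\<exists>k. ts_wins R W k)"
proof
  assume "synth_win (sact ` S) (eact ` S) \<phi> \<inter> ({0} \<times> {0} \<times> UNIV) \<noteq> {}"
  then obtain k where "(0, 0, k) \<in> synth_win (sact ` S) (eact ` S) \<phi>" by auto
  then obtain P :: "ptype \<Rightarrow> nat set" and f where P: "process_triple P" "\<And>\<theta>. card (P \<theta>) = ptriple (0, 0, k) \<theta>"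
    and f: "synth_strategy (sact ` S) (eact ` S) P f" "synth_winning (sact ` S) (eact ` S) P \<phi> f"
    unfolding synth_win_def by blast
  have "P Sys = {}" "P Env = {}"
    using P(1) P(2)[of Sys] P(2)[of Env] by (simp_all add: process_triple_def)
  then have valid: "valid P" using P(1) by (simp add: valid_def process_triple_def)
  have "ts_wins R W (card (P Shared))"
  proof (rule ts_wins_if_synth[OF valid f(1)])
    fix w assume "w \<in> executions (sact ` S) (eact ` S) P" "compatible (sact ` S) P f w" "fair (sact ` S) P f w"
    then show "accept (tally (P Shared) (letter w ` pos w))"
      using f(2) \<phi>[OF valid] unfolding synth_winning_def by blast
  qed
  then show "\<exists>k. ts_wins R W k" by blast
next
  assume "\<exists>k. ts_wins R W k"
  then obtain k where k: "ts_wins R W k" ..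
  define P where "P \<theta> = (if \<theta> = Shared then {..<k} else {})" for \<theta>
  have valid: "valid P" by (simp add: valid_def P_def)
  have k': "ts_wins R W (card (P Shared))" using k by (simp add: P_def)
  have "process_triple P" by (simp add: process_triple_def P_def)
  moreover have "card (P \<theta>) = ptriple (0, 0, k) \<theta>" for \<theta> by (cases \<theta>) (simp_all add: P_def)
  moreover have "synth_winning (sact ` S) (eact ` S) P \<phi> (planned (P Shared))"
    unfolding synth_winning_def using planned_winning[OF k' valid] \<phi>[OF valid] by blast
  ultimately have "(0, 0, k) \<in> synth_win (sact ` S) (eact ` S) \<phi>"
    unfolding synth_win_def using planned_strategy[OF valid] by blast
  then show "synth_win (sact ` S) (eact ` S) \<phi> \<inter> ({0} \<times> {0} \<times> UNIV) \<noteq> {}" by blast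
qed

end

section \<open>Counting formulas\<close>

text \<open>The relation of having the same \<open>owner\<close> is itself an equivalence of the
  required kind, so it contains the least one; conversely the required pairs, reflexivity and
  symmetry already generate it.\<close>

lemma same_process_iff:
  assumes w: "w \<in> executions As Ae P"
  defines "owner \<equiv> \<lambda>u. case u of Inl p \<Rightarrow> p | Inr i \<Rightarrow> snd (letter w i)"
  shows "(u, v) \<in> same_process P w \<longleftrightarrow> u \<in> universe P w \<and> v \<in> universe P w \<and> owner u = owner v"
    (is "?lhs \<longleftrightarrow> ?rhs")
proof -
  let ?U = "universe P w"
  let ?good = "\<lambda>R. equiv ?U R \<and> (\<forall>i\<in>pos w. (Inl (snd (letter w i)), Inr i) \<in> R) \<and>
     (\<forall>i\<in>pos w. \<forall>j\<in>pos w. snd (letter w i) = snd (letter w j) \<longrightarrow> (Inr i, Inr j) \<in> R)"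
  have mem: "(u, v) \<in> same_process P w \<longleftrightarrow> (\<forall>R. ?good R \<longrightarrow> (u, v) \<in> R)"
    unfolding same_process_def by blast
  have proc: "Inl (snd (letter w i)) \<in> ?U" "Inr i \<in> ?U" if "i \<in> pos w" for i
  proof -
    have "letter w i \<in> events As Ae P" using w that unfolding executions_def by blast
    then show "Inl (snd (letter w i)) \<in> ?U"
      unfolding universe_def by (auto simp: events_def sys_events_def env_events_def)
    show "Inr i \<in> ?U" using that unfolding universe_def by blast
  qed
  show ?thesis
  proof
    let ?R0 = "{(u, v). u \<in> ?U \<and> v \<in> ?U \<and> owner u = owner v}"
    assume ?lhs
    moreover have "?good ?R0"
      using proc by (auto simp: equiv_def refl_on_def sym_def trans_def owner_def)
    ultimately show ?rhs unfolding mem by blast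
  next
    assume R: ?rhs
    show ?lhs
      unfolding mem
    proof (intro allI impI)
      fix R assume good: "?good R"
      then have refl: "(x, x) \<in> R" if "x \<in> ?U" for x using that by (simp add: equiv_def refl_on_def)
      have sym: "(y, x) \<in> R" if "(x, y) \<in> R" for x y
        using that good by (meson equiv_def symD)
      have inr: "i \<in> pos w" if "Inr i \<in> ?U" for i using that unfolding universe_def by blast
      show "(u, v) \<in> R"
        using R good refl sym inr by (cases u; cases v) (auto simp: owner_def)
    qed
  qed
qed

definition FAnd :: "'a fo \<Rightarrow> 'a fo \<Rightarrow> 'a fo" where
  "FAnd \<phi> \<psi> = FNeg (FOr (FNeg \<phi>) (FNeg \<psi>))"

lemma sat_FAnd [simp]: "sat P w \<nu> (FAnd \<phi> \<psi>) \<longleftrightarrow> sat P w \<nu> \<phi> \<and> sat P w \<nu> \<psi>"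
  and free_vars_FAnd [simp]: "free_vars (FAnd \<phi> \<psi>) = free_vars \<phi> \<union> free_vars \<psi>"
  and set_fo_FAnd [simp]: "set_fo (FAnd \<phi> \<psi>) = set_fo \<phi> \<union> set_fo \<psi>"
  by (simp_all add: FAnd_def)

lemma sat_cong: "(\<And>x. x \<in> free_vars \<phi> \<Longrightarrow> \<nu> x = \<nu>' x) \<Longrightarrow> sat P w \<nu> \<phi> \<longleftrightarrow> sat P w \<nu>' \<phi>"
proof (induction \<phi> arbitrary: \<nu> \<nu>')
  case (FNeg \<phi>)
  have "sat P w \<nu> \<phi> \<longleftrightarrow> sat P w \<nu>' \<phi>" by (rule FNeg.IH) (use FNeg.prems in simp)
  then show ?case by simp
next
  case (FOr \<phi> \<psi>)
  have "sat P w \<nu> \<phi> \<longleftrightarrow> sat P w \<nu>' \<phi>" "sat P w \<nu> \<psi> \<longleftrightarrow> sat P w \<nu>' \<psi>"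
    by (rule FOr.IH; use FOr.prems in simp)+
  then show ?case by simp
next
  case (FEx x \<phi>)
  have "sat P w (\<nu>(x := u)) \<phi> \<longleftrightarrow> sat P w (\<nu>'(x := u)) \<phi>" for u
    by (rule FEx.IH) (use FEx.prems in simp)
  then show ?case by simp
qed simp_all

text \<open>
  \<open>exactly n \<psi> n\<close> says that exactly \<open>n\<close> elements of the universe satisfy \<open>\<psi>\<close>, whose only free
  variable is 0. In \<open>exactly n \<psi> r\<close> the variables \<open>1, \<dots>, n - r\<close> already name distinct such
  elements.
\<close>

definition holds_of :: "'a fo \<Rightarrow> nat \<Rightarrow> 'a fo" where
  "holds_of \<psi> v = FEx 0 (FAnd (FEq 0 v) \<psi>)"

fun fresh :: "nat \<Rightarrow> nat \<Rightarrow> 'a fo" where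
  "fresh v 0 = FEq v v"
| "fresh v (Suc m) = FAnd (FNeg (FEq v (Suc m))) (fresh v m)"

fun exactly :: "nat \<Rightarrow> 'a fo \<Rightarrow> nat \<Rightarrow> 'a fo" where
  "exactly n \<psi> 0 = FNeg (FEx (Suc n) (FAnd (holds_of \<psi> (Suc n)) (fresh (Suc n) n)))"
| "exactly n \<psi> (Suc r) =
     FEx (n - r) (FAnd (FAnd (holds_of \<psi> (n - r)) (fresh (n - r) (n - Suc r))) (exactly n \<psi> r))"

lemma sat_fresh: "sat P w \<nu> (fresh v m) \<longleftrightarrow> \<nu> v \<notin> \<nu> ` {1..m}"
proof (induction m)
  case (Suc m)
  have "{1..Suc m} = insert (Suc m) {1..m}" by auto
  then show ?case using Suc by simp
qed simp

lemma free_vars_fresh: "free_vars (fresh v m) \<subseteq> insert v {1..m}"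
  by (induction m) auto

lemma set_fo_fresh: "set_fo (fresh v m) = {}"
  by (induction m) simp_all

text \<open>At r = 0 the n named elements are distinct members of \<open>T\<close>, so the formula
  says that they exhaust it. Before that a further member must exist; if there is none,
  \<open>T\<close> has fewer than n elements and both sides are false. Rebinding variable 0 in
  \<open>holds_of\<close> replaces syntactic substitution.\<close>

lemma sat_exactly:
  assumes \<psi>: "free_vars \<psi> \<subseteq> {0}" and T: "T = {u \<in> universe P w. sat P w (\<nu>0(0 := u)) \<psi>}" "finite T"
  shows "r \<le> n \<Longrightarrow> inj_on \<nu> {1..n - r} \<Longrightarrow> \<nu> ` {1..n - r} \<subseteq> T \<Longrightarrow>
    sat P w \<nu> (exactly n \<psi> r) \<longleftrightarrow> card T = n"
proof (induction r arbitrary: \<nu>)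
  have holds: "sat P w \<nu> (holds_of \<psi> v) \<longleftrightarrow> \<nu> v \<in> T" if "v \<noteq> 0" for \<nu> v
  proof -
    have "sat P w (\<nu>(0 := u)) \<psi> \<longleftrightarrow> sat P w (\<nu>0(0 := u)) \<psi>" for u
      by (rule sat_cong) (use \<psi> in auto)
    then show ?thesis using that by (auto simp: holds_of_def T)
  qed
  {
    case 0
    have card: "card (\<nu> ` {1..n}) = n" using 0 card_image by fastforce
    have upd: "(\<nu>(Suc n := u)) ` {1..n} = \<nu> ` {1..n}" for u by (rule image_cong) auto
    have "sat P w \<nu> (exactly n \<psi> 0) \<longleftrightarrow> T \<subseteq> \<nu> ` {1..n}"
      using T(1) by (auto simp: holds sat_fresh upd simp del: fun_upd_apply) (auto simp: T)
    also have "\<dots> \<longleftrightarrow> card T = n"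
      using 0 card T(2) by (metis card_subset_eq diff_zero finite_atLeastAtMost finite_imageI subset_antisym order_refl)
    finally show ?case .
  next
    case (Suc r)
    let ?v = "n - r"
    have v: "?v \<noteq> 0" "{1..?v} = insert ?v {1..n - Suc r}" "?v \<notin> {1..n - Suc r}"
      using Suc.prems(1) by auto
    have upd: "(\<nu>(?v := u)) ` {1..n - Suc r} = \<nu> ` {1..n - Suc r}" for u
      by (rule image_cong) (use v in auto)
    have IH: "sat P w (\<nu>(?v := u)) (exactly n \<psi> r) \<longleftrightarrow> card T = n"
      if "u \<in> T" "u \<notin> \<nu> ` {1..n - Suc r}" for u
    proof (rule Suc.IH)
      show "r \<le> n" using Suc.prems(1) by simp
      have "inj_on (\<nu>(?v := u)) {1..n - Suc r}"
        using Suc.prems(2) v(3) by (metis fun_upd_other inj_on_cong)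
      then show "inj_on (\<nu>(?v := u)) {1..n - r}"
        unfolding v(2) using that(2) upd[of u] v(3) by (auto simp: inj_on_insert simp del: fun_upd_apply) simp
      show "(\<nu>(?v := u)) ` {1..n - r} \<subseteq> T"
        unfolding v(2) image_insert upd using that(1) Suc.prems(3) by simp
    qed
    have "sat P w \<nu> (exactly n \<psi> (Suc r)) \<longleftrightarrow>
      (\<exists>u\<in>universe P w. u \<in> T \<and> u \<notin> \<nu> ` {1..n - Suc r} \<and> sat P w (\<nu>(?v := u)) (exactly n \<psi> r))"
      unfolding exactly.simps sat.simps sat_FAnd holds[OF v(1)] sat_fresh upd fun_upd_same by blast
    also have "\<dots> \<longleftrightarrow> (\<exists>u. u \<in> T \<and> u \<notin> \<nu> ` {1..n - Suc r}) \<and> card T = n"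
      using IH T(1) by blast
    also have "\<dots> \<longleftrightarrow> card T = n"
    proof -
      have "card (\<nu> ` {1..n - Suc r}) = n - Suc r" using Suc.prems(2) card_image by fastforce
      then have "card T \<noteq> n" if "T \<subseteq> \<nu> ` {1..n - Suc r}"
        using card_mono[OF _ that] Suc.prems(1) by auto
      then show ?thesis by blast
    qed
    finally show ?case .
  }
qed

lemma free_vars_exactly:
  assumes "free_vars \<psi> \<subseteq> {0}"
  shows "r \<le> n \<Longrightarrow> free_vars (exactly n \<psi> r) \<subseteq> {1..n - r}"
proof (induction r)
  case 0
  then show ?case using assms free_vars_fresh[of "Suc n" n] by (auto simp: holds_of_def)
next
  case (Suc r)
  then have "{1..n - r} = insert (n - r) {1..n - Suc r}" by auto
  then show ?case using Suc assms free_vars_fresh[of "n - r" "n - Suc r"] by (auto simp: holds_of_def)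
qed

lemma set_fo_exactly: "set_fo (exactly n \<psi> r) \<subseteq> set_fo \<psi>"
  by (induction r) (auto simp: holds_of_def set_fo_fresh)

section \<open>Expressing the acceptance condition\<close>

context token_system
begin

definition expresses :: "nat set \<Rightarrow> nat fo \<Rightarrow>
    ((ptype \<Rightarrow> nat set) \<Rightarrow> (nat \<times> nat) word \<Rightarrow> (nat \<Rightarrow> nat + nat) \<Rightarrow> bool) \<Rightarrow> bool" where
  "expresses V \<phi> Q \<longleftrightarrow> set_fo \<phi> \<subseteq> sact ` S \<union> eact ` S \<and> free_vars \<phi> \<subseteq> V \<and>
     (\<forall>P w \<nu>. valid P \<and> w \<in> executions (sact ` S) (eact ` S) P \<longrightarrow> (sat P w \<nu> \<phi> \<longleftrightarrow> Q P w \<nu>))"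

text \<open>Conditions independent of the input enter the instance code as constants, so the mere
  existence of a formula is enough for them. Only the test for x is written down explicitly, by
  \<open>exactly\<close>.\<close>

definition expressible :: "nat set \<Rightarrow>
    ((ptype \<Rightarrow> nat set) \<Rightarrow> (nat \<times> nat) word \<Rightarrow> (nat \<Rightarrow> nat + nat) \<Rightarrow> bool) \<Rightarrow> bool" where
  "expressible V Q \<longleftrightarrow> (\<exists>\<phi>. expresses V \<phi> Q)"

lemma expressible_cong: "expressible V Q \<Longrightarrow> (\<And>P w \<nu>. Q P w \<nu> \<longleftrightarrow> Q' P w \<nu>) \<Longrightarrow> expressible V Q'"
  unfolding expressible_def expresses_def by simp

lemma expresses_not: "expresses V \<phi> Q \<Longrightarrow> expresses V (FNeg \<phi>) (\<lambda>P w \<nu>. \<not> Q P w \<nu>)"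
  unfolding expresses_def by simp

lemma expresses_or: "expresses V \<phi> Q \<Longrightarrow> expresses V \<psi> Q' \<Longrightarrow>
    expresses V (FOr \<phi> \<psi>) (\<lambda>P w \<nu>. Q P w \<nu> \<or> Q' P w \<nu>)"
  unfolding expresses_def by simp

lemma expresses_and: "expresses V \<phi> Q \<Longrightarrow> expresses V \<psi> Q' \<Longrightarrow>
    expresses V (FAnd \<phi> \<psi>) (\<lambda>P w \<nu>. Q P w \<nu> \<and> Q' P w \<nu>)"
  unfolding expresses_def by simp

lemma expressible_not: "expressible V Q \<Longrightarrow> expressible V (\<lambda>P w \<nu>. \<not> Q P w \<nu>)"
  unfolding expressible_def using expresses_not by blast

lemma expressible_or: "expressible V Q \<Longrightarrow> expressible V Q' \<Longrightarrow> expressible V (\<lambda>P w \<nu>. Q P w \<nu> \<or> Q' P w \<nu>)"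
  unfolding expressible_def using expresses_or by blast

lemma expressible_and: "expressible V Q \<Longrightarrow> expressible V Q' \<Longrightarrow> expressible V (\<lambda>P w \<nu>. Q P w \<nu> \<and> Q' P w \<nu>)"
  unfolding expressible_def using expresses_and by blast

lemma expressible_False: "expressible V (\<lambda>P w \<nu>. False)"
  unfolding expressible_def expresses_def by (rule exI[of _ "FEx 0 (FNeg (FEq 0 0))"]) simp

lemma expressible_const: "expressible V (\<lambda>P w \<nu>. b)"
  using expressible_False expressible_not[OF expressible_False] by (cases b) simp_all

lemma expressible_imp:
  assumes "b \<Longrightarrow> expressible V Q"
  shows "expressible V (\<lambda>P w \<nu>. b \<longrightarrow> Q P w \<nu>)" "expressible V (\<lambda>P w \<nu>. b \<and> Q P w \<nu>)"
proof (atomize (full), cases b)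
  case True
  then show "expressible V (\<lambda>P w \<nu>. b \<longrightarrow> Q P w \<nu>) \<and> expressible V (\<lambda>P w \<nu>. b \<and> Q P w \<nu>)"
    using expressible_cong[OF assms[OF True], of "\<lambda>P w \<nu>. b \<longrightarrow> Q P w \<nu>"]
      expressible_cong[OF assms[OF True], of "\<lambda>P w \<nu>. b \<and> Q P w \<nu>"] by blast
next
  case False
  then show "expressible V (\<lambda>P w \<nu>. b \<longrightarrow> Q P w \<nu>) \<and> expressible V (\<lambda>P w \<nu>. b \<and> Q P w \<nu>)"
    using expressible_cong[OF expressible_const[of V True], of "\<lambda>P w \<nu>. b \<longrightarrow> Q P w \<nu>"]
      expressible_cong[OF expressible_const[of V False], of "\<lambda>P w \<nu>. b \<and> Q P w \<nu>"] by blast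
qed

lemma expressible_bex:
  assumes "finite I" "\<And>i. i \<in> I \<Longrightarrow> expressible V (Q i)"
  shows "expressible V (\<lambda>P w \<nu>. \<exists>i\<in>I. Q i P w \<nu>)"
  using assms by (induction I rule: finite_induct) (simp_all add: expressible_False expressible_or)

lemma expressible_ball:
  assumes "finite I" "\<And>i. i \<in> I \<Longrightarrow> expressible V (Q i)"
  shows "expressible V (\<lambda>P w \<nu>. \<forall>i\<in>I. Q i P w \<nu>)"
  using assms by (induction I rule: finite_induct) (simp_all add: expressible_const expressible_and)

text \<open>A process is identified by its type, since variables also range over positions; what it
  has done is found through positions related to it by \<sim>.\<close>

lemma expressible_act:
  assumes "a \<in> sact ` S \<union> eact ` S"
  shows "expressible {0} (\<lambda>P w \<nu>. \<exists>p\<in>P Shared. \<nu> 0 = Inl p \<and> (a, p) \<in> letter w ` pos w)"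
  unfolding expressible_def expresses_def
proof (intro exI conjI allI impI)
  let ?\<phi> = "FAnd (FType Shared 0) (FEx 1 (FAnd (FAct a 1) (FSim 1 0)))"
  show "set_fo ?\<phi> \<subseteq> sact ` S \<union> eact ` S" using assms by simp
  show "free_vars ?\<phi> \<subseteq> {0}" by auto
  fix P :: "ptype \<Rightarrow> nat set" and w :: "(nat \<times> nat) word" and \<nu> :: "nat \<Rightarrow> nat + nat"
  assume "valid P \<and> w \<in> executions (sact ` S) (eact ` S) P"
  then have w: "w \<in> executions (sact ` S) (eact ` S) P" ..
  show "sat P w \<nu> ?\<phi> \<longleftrightarrow> (\<exists>p\<in>P Shared. \<nu> 0 = Inl p \<and> (a, p) \<in> letter w ` pos w)"
  proof
    assume "sat P w \<nu> ?\<phi>"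
    then have "\<nu> 0 \<in> Inl ` P Shared"
      "\<exists>u. u \<in> Inr ` {i \<in> pos w. fst (letter w i) = a} \<and> (u, \<nu> 0) \<in> same_process P w" by auto
    then obtain p u where p: "p \<in> P Shared" "\<nu> 0 = Inl p"
      and u: "u \<in> Inr ` {i \<in> pos w. fst (letter w i) = a}" "(u, Inl p) \<in> same_process P w" by fastforce
    then obtain i where i: "u = Inr i" "i \<in> pos w" "fst (letter w i) = a" by blast
    have "snd (letter w i) = p" using u(2) unfolding same_process_iff[OF w] by (simp add: i)
    then have "(a, p) = letter w i" using i by auto
    then show "\<exists>p\<in>P Shared. \<nu> 0 = Inl p \<and> (a, p) \<in> letter w ` pos w" using p i by blast
  next
    assume "\<exists>p\<in>P Shared. \<nu> 0 = Inl p \<and> (a, p) \<in> letter w ` pos w"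
    then obtain p i where p: "p \<in> P Shared" "\<nu> 0 = Inl p" and i: "i \<in> pos w" "letter w i = (a, p)"
      by force
    have "(Inr i, Inl p) \<in> same_process P w"
      unfolding same_process_iff[OF w] using p i by (auto simp: universe_def)
    then show "sat P w \<nu> ?\<phi>" using p i by (auto simp: universe_def intro!: bexI[of _ "Inr i"])
  qed
qed

lemma expressible_type: "expressible {0} (\<lambda>P w \<nu>. \<exists>p\<in>P Shared. \<nu> 0 = Inl p)"
  unfolding expressible_def expresses_def by (rule exI[of _ "FType Shared 0"]) auto

lemma expressible_status:
  "expressible {0} (\<lambda>P w \<nu>. \<exists>p\<in>P Shared. \<nu> 0 = Inl p \<and> status (letter w ` pos w) p = (X, Y))"
proof -
  let ?D = "\<lambda>a P w \<nu>. \<exists>p\<in>P Shared. \<nu> 0 = Inl p \<and> (a, p) \<in> letter w ` pos w"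
  have "expressible {0} (\<lambda>P w \<nu>. (\<exists>p\<in>P Shared. \<nu> 0 = Inl p) \<and> (X \<subseteq> S \<and> Y \<subseteq> S) \<and>
      (\<forall>s\<in>S. (s \<in> X \<longrightarrow> ?D (sact s) P w \<nu>) \<and> (s \<notin> X \<longrightarrow> \<not> ?D (sact s) P w \<nu>) \<and>
        (s \<in> Y \<longrightarrow> ?D (eact s) P w \<nu>) \<and> (s \<notin> Y \<longrightarrow> \<not> ?D (eact s) P w \<nu>)))"
    by (intro expressible_and expressible_imp expressible_ball expressible_not expressible_act
        expressible_type expressible_const finite_S) simp_all
  then show ?thesis
  proof (rule expressible_cong)
    fix P :: "ptype \<Rightarrow> nat set" and w :: "(nat \<times> nat) word" and \<nu> :: "nat \<Rightarrow> nat + nat"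
    show "((\<exists>p\<in>P Shared. \<nu> 0 = Inl p) \<and> (X \<subseteq> S \<and> Y \<subseteq> S) \<and>
      (\<forall>s\<in>S. (s \<in> X \<longrightarrow> ?D (sact s) P w \<nu>) \<and> (s \<notin> X \<longrightarrow> \<not> ?D (sact s) P w \<nu>) \<and>
        (s \<in> Y \<longrightarrow> ?D (eact s) P w \<nu>) \<and> (s \<notin> Y \<longrightarrow> \<not> ?D (eact s) P w \<nu>))) \<longleftrightarrow>
    (\<exists>p\<in>P Shared. \<nu> 0 = Inl p \<and> status (letter w ` pos w) p = (X, Y))"
    proof (cases "\<exists>p\<in>P Shared. \<nu> 0 = Inl p")
    case True
    then obtain p where p: "p \<in> P Shared" "\<nu> 0 = Inl p" by blast
    then have D: "?D a P w \<nu> \<longleftrightarrow> (a, p) \<in> letter w ` pos w" for a by auto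
    let ?E = "letter w ` pos w"
    have "status ?E p = (X, Y) \<longleftrightarrow> (X \<subseteq> S \<and> Y \<subseteq> S) \<and>
        (\<forall>s\<in>S. (s \<in> X \<longleftrightarrow> (sact s, p) \<in> ?E) \<and> (s \<in> Y \<longleftrightarrow> (eact s, p) \<in> ?E))"
      unfolding status_def by auto
    moreover have "(\<exists>q\<in>P Shared. \<nu> 0 = Inl q \<and> status ?E q = (X, Y)) \<longleftrightarrow> status ?E p = (X, Y)"
      using p by auto
    ultimately show ?thesis unfolding D using True by meson
    qed auto
  qed
qed

text \<open>One formula is fixed for each pair, so that \<open>exactly\<close> over it has a code
  depending on the number alone.\<close>

definition status_formula :: "nat set \<Rightarrow> nat set \<Rightarrow> nat fo" where
  "status_formula X Y = (SOME \<psi>. expresses {0} \<psi>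
     (\<lambda>P w \<nu>. \<exists>p\<in>P Shared. \<nu> 0 = Inl p \<and> status (letter w ` pos w) p = (X, Y)))"

lemma status_formula:
  "set_fo (status_formula X Y) \<subseteq> sact ` S \<union> eact ` S" "free_vars (status_formula X Y) \<subseteq> {0}"
  "valid P \<Longrightarrow> w \<in> executions (sact ` S) (eact ` S) P \<Longrightarrow>
    sat P w \<nu> (status_formula X Y) \<longleftrightarrow> (\<exists>p\<in>P Shared. \<nu> 0 = Inl p \<and> status (letter w ` pos w) p = (X, Y))"
proof -
  have "expresses {0} (status_formula X Y)
     (\<lambda>P w \<nu>. \<exists>p\<in>P Shared. \<nu> 0 = Inl p \<and> status (letter w ` pos w) p = (X, Y))"
    unfolding status_formula_def
    by (rule someI_ex) (rule expressible_status[unfolded expressible_def])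
  note * = this[unfolded expresses_def]
  show "set_fo (status_formula X Y) \<subseteq> sact ` S \<union> eact ` S" "free_vars (status_formula X Y) \<subseteq> {0}"
    using * by blast+
  show "sat P w \<nu> (status_formula X Y) \<longleftrightarrow> (\<exists>p\<in>P Shared. \<nu> 0 = Inl p \<and> status (letter w ` pos w) p = (X, Y))"
    if "valid P" "w \<in> executions (sact ` S) (eact ` S) P"
    using *[THEN conjunct2, THEN conjunct2, rule_format, of P w \<nu>] that by blast
qed

lemma sat_exactly_status:
  assumes P: "valid P" and w: "w \<in> executions (sact ` S) (eact ` S) P"
  shows "sat P w \<nu> (exactly n (status_formula X Y) n) \<longleftrightarrow> tally (P Shared) (letter w ` pos w) (X, Y) = n"
proof -
  let ?A = "{p \<in> P Shared. status (letter w ` pos w) p = (X, Y)}"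
  let ?T = "{u \<in> universe P w. sat P w (\<nu>(0 := u)) (status_formula X Y)}"
  have T: "?T = Inl ` ?A" unfolding status_formula(3)[OF P w] by (auto simp: universe_def)
  have "finite ?A" using P by (simp add: valid_def)
  then have "finite ?T" unfolding T by simp
  from sat_exactly[OF status_formula(2) refl this, of n n \<nu>]
  have "sat P w \<nu> (exactly n (status_formula X Y) n) \<longleftrightarrow> card ?T = n" by simp
  also have "card ?T = card ?A" unfolding T by (rule card_image) simp
  finally show ?thesis by (simp add: tally_def)
qed

lemma expressible_tally:
  "expressible {} (\<lambda>P w \<nu>. tally (P Shared) (letter w ` pos w) (X, Y) = n)"
proof -
  let ?\<phi> = "exactly n (status_formula X Y) n"
  have "set_fo ?\<phi> \<subseteq> sact ` S \<union> eact ` S"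
    using set_fo_exactly status_formula(1) by (rule order_trans)
  moreover have "free_vars ?\<phi> \<subseteq> {}" using free_vars_exactly[OF status_formula(2), of n n] by simp
  ultimately have "expresses {} ?\<phi> (\<lambda>P w \<nu>. tally (P Shared) (letter w ` pos w) (X, Y) = n)"
    unfolding expresses_def using sat_exactly_status by blast
  then show ?thesis unfolding expressible_def by blast
qed

lemma expressible_pos:
  "expressible {} (\<lambda>P w \<nu>. 0 < tally (P Shared) (letter w ` pos w) (X, Y))"
  using expressible_not[OF expressible_tally[of X Y 0]] by simp

lemma expressible_pending:
  "expressible {} (\<lambda>P w \<nu>. pending (X, s, g) (tally (P Shared) (letter w ` pos w)))"
proof -
  have "expressible {} (\<lambda>P w \<nu>. \<forall>n. g Y = Some n \<longrightarrow> tally (P Shared) (letter w ` pos w) (Y, Y) = n)" for Y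
    by (cases "g Y") (simp_all add: expressible_const expressible_tally)
  then show ?thesis
    unfolding pending_def prod.case using finite_S
    by (intro expressible_and expressible_ball expressible_imp expressible_tally) simp_all
qed

lemma expressible_accept:
  "expressible {} (\<lambda>P w \<nu>. accept (tally (P Shared) (letter w ` pos w)))"
proof -
  have "finite W" using W(1) finite_S finite_subset by blast
  moreover have "expressible {} (\<lambda>P w \<nu>. pending \<rho> (tally (P Shared) (letter w ` pos w)))" for \<rho>
    using expressible_pending by (cases \<rho>) simp
  ultimately show ?thesis
    unfolding accept_def cheated_def won_def using finite_S finite_R
    by (intro expressible_or expressible_bex expressible_imp expressible_pos) simp_all
qed

end

section \<open>Undecidability\<close>

lemma total_rec_if_mem:
  assumes "finite A" "total_rec n F" "total_rec n H" "total_rec n K"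
  shows "total_rec n (\<lambda>xs. if F xs \<in> A then H xs else K xs)"
  using assms(1)
proof (induction A rule: finite_induct)
  case empty
  then show ?case using assms(4) by simp
next
  case (insert a A)
  have "total_rec n (\<lambda>xs. if F xs = a then H xs else if F xs \<in> A then H xs else K xs)"
    by (rule total_rec_if_eq[OF assms(2) total_rec_const assms(3) insert.IH])
  then show ?case by (rule total_rec_cong) simp
qed

text \<open>A set code is a sum of powers of 2, so an element that is already present must not be
  added again; hence the case distinction.\<close>

lemma total_rec_set_encode_insert:
  assumes "finite A" "total_rec n F"
  shows "total_rec n (\<lambda>xs. set_encode (insert (F xs) A))"
proof (rule total_rec_cong)
  show "total_rec n (\<lambda>xs. if F xs \<in> A then set_encode A else 2 ^ F xs + set_encode A)"
    by (intro total_rec_if_mem total_rec_add total_rec_power total_rec_const assms)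
qed (use assms(1) in \<open>auto simp: insert_absorb\<close>)

text \<open>A many-one reduction: composing a decider with the function that computes instance codes
  would decide \<open>halting_set\<close>.\<close>

lemma reduction_from_halting_set:
  assumes dec: "decidable cd I Y" and I: "\<And>x. r x \<in> I" and Y: "\<And>x. r x \<in> Y \<longleftrightarrow> x \<in> halting_set"
    and rec: "total_rec (Suc 0) (\<lambda>xs. cd (r (xs ! 0)))"
  shows False
proof -
  obtain f where f: "\<And>x. x \<in> I \<Longrightarrow> computes f [cd x] (if x \<in> Y then 1 else 0)"
    using dec unfolding decidable_def by blast
  obtain c where c: "\<And>xs. length xs = Suc 0 \<Longrightarrow> computes c xs (cd (r (xs ! 0)))"
    using rec unfolding total_rec_def by blast
  have "computes (Comp f [c]) [x] (if x \<in> halting_set then 1 else 0)" for x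
  proof (rule computes_Comp[where ys = "[cd (r x)]"])
    show "\<forall>i<length [c]. computes ([c] ! i) [x] ([cd (r x)] ! i)" using c[of "[x]"] by simp
    show "computes f [cd (r x)] (if x \<in> halting_set then 1 else 0)" using f[OF I, of x] Y[of x] by simp
  qed simp
  then show False using halting_set_undecidable by blast
qed

section \<open>Recursiveness of the instance codes\<close>

definition and_code :: "nat \<Rightarrow> nat \<Rightarrow> nat" where
  "and_code a b = list_encode [4, list_encode [5, list_encode [4, a], list_encode [4, b]]]"

lemma fo_code_FAnd: "fo_code (FAnd \<phi> \<psi>) = and_code (fo_code \<phi>) (fo_code \<psi>)"
  by (simp add: FAnd_def and_code_def del: list_encode.simps)

lemma total_rec_and_code:
  "total_rec n F \<Longrightarrow> total_rec n G \<Longrightarrow> total_rec n (\<lambda>xs. and_code (F xs) (G xs))"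
  unfolding and_code_def by (intro total_rec_list_encode_Cons total_rec_list_encode_Nil total_rec_const)

lemma total_rec_fresh: "total_rec n F \<Longrightarrow> total_rec n G \<Longrightarrow> total_rec n (\<lambda>xs. fo_code (fresh (F xs) (G xs)))"
proof (rule total_rec_comp2[of "\<lambda>m v. fo_code (fresh v m)"])
  show "total_rec 2 (\<lambda>xs. fo_code (fresh (xs ! 1) (xs ! 0)))"
    unfolding numeral_2_eq_2
  proof (rule total_rec_primrec)
    show "total_rec (Suc 0) (\<lambda>xs. list_encode [2, xs ! 0, xs ! 0])"
      by (intro total_rec_list_encode_Cons total_rec_list_encode_Nil total_rec_const total_rec_nth) simp_all
    show "total_rec (Suc 0 + 2) (\<lambda>ys. and_code (list_encode [4, list_encode [2, ys ! 2, Suc (ys ! 0)]]) (ys ! 1))"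
      by (intro total_rec_and_code total_rec_list_encode_Cons total_rec_list_encode_Nil total_rec_const
          total_rec_Suc total_rec_nth) simp_all
  qed (simp_all add: fo_code_FAnd del: list_encode.simps)
qed

lemma fo_code_holds_of: "fo_code (holds_of \<psi> v) = list_encode [6, 0, and_code (list_encode [2, 0, v]) (fo_code \<psi>)]"
  by (simp add: holds_of_def fo_code_FAnd del: list_encode.simps)

lemma total_rec_holds_of: "total_rec n F \<Longrightarrow> total_rec n (\<lambda>xs. fo_code (holds_of \<psi> (F xs)))"
  unfolding fo_code_holds_of
  by (intro total_rec_and_code total_rec_list_encode_Cons total_rec_list_encode_Nil total_rec_const)

text \<open>The recursion of \<open>exactly\<close> is in its last argument while the first stays
  fixed, so the code is computed with both arguments and then taken on the diagonal.\<close>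

lemma total_rec_exactly: "total_rec (Suc 0) (\<lambda>xs. fo_code (exactly (xs ! 0) \<psi> (xs ! 0)))"
proof -
  have "total_rec 2 (\<lambda>xs. fo_code (exactly (xs ! 1) \<psi> (xs ! 0)))"
    unfolding numeral_2_eq_2
  proof (rule total_rec_primrec)
    let ?A = "\<lambda>xs :: nat list. list_encode [4, list_encode [6, Suc (xs ! 0),
      and_code (fo_code (holds_of \<psi> (Suc (xs ! 0)))) (fo_code (fresh (Suc (xs ! 0)) (xs ! 0)))]]"
    let ?G = "\<lambda>ys :: nat list. list_encode [6, ys ! 2 - ys ! 0,
      and_code (and_code (fo_code (holds_of \<psi> (ys ! 2 - ys ! 0)))
        (fo_code (fresh (ys ! 2 - ys ! 0) (ys ! 2 - Suc (ys ! 0))))) (ys ! 1)]"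
    show "total_rec (Suc 0) ?A"
      by (intro total_rec_and_code total_rec_list_encode_Cons total_rec_list_encode_Nil total_rec_const
          total_rec_holds_of total_rec_fresh total_rec_Suc total_rec_nth) simp_all
    show "total_rec (Suc 0 + 2) ?G"
      by (intro total_rec_and_code total_rec_list_encode_Cons total_rec_list_encode_Nil total_rec_const
          total_rec_holds_of total_rec_fresh total_rec_diff total_rec_Suc total_rec_nth) simp_all
  qed (simp_all add: fo_code_FAnd del: list_encode.simps)
  then show ?thesis
    by (rule total_rec_comp2[of "\<lambda>r n. fo_code (exactly n \<psi> r)"]) (simp_all add: total_rec_nth)
qed

lemma image_eq_insert: "a \<in> A \<Longrightarrow> f ` A = insert (f a) (f ` (A - {a}))"
  by blast

text \<open>A set of graphs codes the acceptance component, and x occurs in one graph at one point.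
  The code is therefore obtained from constants by inserting the pair for that point into a fixed
  set and the resulting graph code into another fixed set.\<close>

lemma game_problem_undecidable: "\<not> decidable game_code game_instances (game_problem {0} {0} UNIV)"
proof
  assume dec: "decidable game_code game_instances (game_problem {0} {0} UNIV)"
  obtain S R W X s g Y where ts: "\<And>x. token_system S (insert (X, s, g(Y \<mapsto> x)) R) W"
    and wins: "\<And>x. (\<exists>k. ts_wins (insert (X, s, g(Y \<mapsto> x)) R) W k) \<longleftrightarrow> x \<in> halting_set"
    using token_system_for_halting_set by blast
  let ?\<rho> = "\<lambda>x. (X, s, g(Y \<mapsto> x))"
  let ?R = "\<lambda>x. insert (?\<rho> x) R"
  let ?G = "\<lambda>x. token_system.game S (?R x) W"
  let ?rule = "token_system.kappa_rule S"
  let ?locs = "token_system.locs S"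
  have Y: "Y \<subseteq> S" using token_system.rules[OF ts[of 0], of X s "g(Y \<mapsto> 0)"] by auto
  have finR: "finite R" and finS: "finite S"
    using token_system.finite_R[OF ts[of 0]] token_system.finite_S[OF ts[of 0]] by simp_all
  let ?l = "token_system.loc_of S (Y, Y)"
  let ?some = "(\<lambda>(X, Y). token_system.kappa_some S X Y) ` {(X, Y) \<in> Pow S \<times> Pow S. \<not> Y \<subseteq> X \<or> X = Y \<and> X \<in> W}"
  let ?code = "\<lambda>\<kappa>. graph_code (graph_code id id (sact ` S \<union> eact ` S)) cond_triple_code ?locs \<kappa>"
  have locs: "locations (?G x) = ?locs" for x by (rule token_system.locations_game[OF ts])
  have finlocs: "finite ?locs" using token_system.finite_locs[OF ts[of 0]] unfolding locs .
  have loc_code: "loc_code (?G x) = graph_code id id (sact ` S \<union> eact ` S)" for x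
    unfolding loc_code_def[abs_def] by (simp add: token_system.game_def[OF ts])
  have code: "game_code (?G x) = list_encode [set_encode (sact ` S), set_encode (eact ` S), 1,
      set_encode (insert (?code (?rule (?\<rho> x))) (?code ` (?some \<union> ?rule ` R)))]" for x
    unfolding game_code_def locs loc_code
    by (simp add: token_system.game_def[OF ts] token_system.kappas_def[OF ts] del: list_encode.simps)
  have l: "?l \<in> ?locs" by (rule token_system.loc_of_locs[OF ts])
  have at_l: "?rule (?\<rho> x) ?l = (\<lambda>\<theta>. if \<theta> \<noteq> Shared then (CGe, 0) else (CEq, x))" for x
    using l Y token_system.sx_loc_of[OF ts Y] token_system.sy_loc_of[OF ts Y]
    by (auto simp: token_system.kappa_rule_def[OF ts] fun_eq_iff)
  \<comment> \<open>Away from the location of (Y, Y) the guard value at \<open>Y\<close> is never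
    consulted.\<close>
  have off_l: "?rule (?\<rho> x) l' = ?rule (?\<rho> 0) l'" if "l' \<in> ?locs - {?l}" for x l'
  proof -
    have "\<not> (token_system.sx S l' = Y \<and> token_system.sy S l' = Y)"
      using token_system.loc_of_sx_sy[OF ts, of l'] that by auto
    then show ?thesis using that by (auto simp: token_system.kappa_rule_def[OF ts] fun_eq_iff)
  qed
  let ?pt = "\<lambda>\<kappa> l. prod_encode (graph_code id id (sact ` S \<union> eact ` S) l, cond_triple_code (\<kappa> l))"
  have rule_code: "?code (?rule (?\<rho> x)) = set_encode (insert
      (prod_encode (graph_code id id (sact ` S \<union> eact ` S) ?l,
        list_encode [prod_encode (1, 0), prod_encode (1, 0), prod_encode (0, x)]))
      (?pt (?rule (?\<rho> 0)) ` (?locs - {?l})))" for x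
  proof -
    have "?pt (?rule (?\<rho> x)) ` ?locs = insert (?pt (?rule (?\<rho> x)) ?l) (?pt (?rule (?\<rho> x)) ` (?locs - {?l}))"
      by (rule image_eq_insert[OF l])
    moreover have "?pt (?rule (?\<rho> x)) ` (?locs - {?l}) = ?pt (?rule (?\<rho> 0)) ` (?locs - {?l})"
      by (rule image_cong[OF refl], subst off_l, assumption, rule refl)
    moreover have "cond_triple_code (?rule (?\<rho> x) ?l) =
        list_encode [prod_encode (1, 0), prod_encode (1, 0), prod_encode (0, x)]"
      unfolding at_l by (simp add: cond_triple_code_def del: list_encode.simps)
    ultimately show ?thesis unfolding graph_code_def[of "graph_code id id _"] by simp
  qed
  have "finite {(X, Y) \<in> Pow S \<times> Pow S. \<not> Y \<subseteq> X \<or> X = Y \<and> X \<in> W}"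
    by (rule finite_subset[of _ "Pow S \<times> Pow S"]) (use finS in auto)
  then have finK: "finite (?some \<union> ?rule ` R)" using finR by (intro finite_UnI finite_imageI)
  have "total_rec (Suc 0) (\<lambda>xs. game_code (?G (xs ! 0)))"
    unfolding code rule_code
    by (intro total_rec_list_encode_Cons total_rec_list_encode_Nil total_rec_const
        total_rec_set_encode_insert total_rec_prod_encode total_rec_nth
        finite_imageI finite_Diff finK finlocs) simp
  moreover have "?G x \<in> game_instances" for x
    unfolding game_instances_def using token_system.is_game[OF ts] by simp
  moreover have "?G x \<in> game_problem {0} {0} UNIV \<longleftrightarrow> x \<in> halting_set" for x
    using token_system.is_game[OF ts] token_system.game_iff[OF ts[of x]] wins[of x]
    unfolding game_problem_def game_instances_def by simp
  ultimately show False using reduction_from_halting_set[OF dec, of ?G] by blast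
qed

text \<open>This splits the one count that carries the input off a guard, leaving a guard
  independent of x.\<close>

lemma guard_update_iff:
  assumes "Y \<in> A"
  shows "(\<forall>Z\<in>A. \<forall>n. (g(Y \<mapsto> x)) Z = Some n \<longrightarrow> e Z = n) \<longleftrightarrow>
    (\<forall>Z\<in>A. \<forall>n. (g(Y := None)) Z = Some n \<longrightarrow> e Z = n) \<and> e Y = x"
    (is "?lhs \<longleftrightarrow> ?rhs")
proof
  assume l: ?lhs
  have "e Y = x" using l assms by simp
  moreover have "e Z = n" if "Z \<in> A" "(g(Y := None)) Z = Some n" for Z n
    using l that by (cases "Z = Y") simp_all
  ultimately show ?rhs by blast
next
  assume r: ?rhs
  have "e Z = n" if "Z \<in> A" "(g(Y \<mapsto> x)) Z = Some n" for Z n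
    using r that by (cases "Z = Y") simp_all
  then show ?lhs by blast
qed

lemma synthesis_problem_undecidable:
  "\<not> decidable synthesis_code synthesis_instances (synthesis_problem {0} {0} UNIV)"
proof
  assume dec: "decidable synthesis_code synthesis_instances (synthesis_problem {0} {0} UNIV)"
  obtain S R W X s g Y where ts: "\<And>x. token_system S (insert (X, s, g(Y \<mapsto> x)) R) W"
    and wins: "\<And>x. (\<exists>k. ts_wins (insert (X, s, g(Y \<mapsto> x)) R) W k) \<longleftrightarrow> x \<in> halting_set"
    using token_system_for_halting_set by blast
  let ?R = "\<lambda>x. insert (X, s, g(Y \<mapsto> x)) R"
  let ?A = "sact ` S \<union> eact ` S"
  have Y: "Y \<subseteq> S" using token_system.rules[OF ts[of 0], of X s "g(Y \<mapsto> 0)"] by auto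
  have ts0: "token_system S R W"
    using ts[of 0] unfolding token_system_def by auto
  let ?tally = "\<lambda>P w. token_system.tally S (P Shared) (letter w ` pos w)"
  obtain \<phi>1 where \<phi>1: "token_system.expresses S {} \<phi>1 (\<lambda>P w \<nu>. token_system.accept S R W (?tally P w))"
    using token_system.expressible_accept[OF ts0] unfolding token_system.expressible_def[OF ts0] by blast
  obtain \<phi>2 where \<phi>2: "token_system.expresses S {} \<phi>2
      (\<lambda>P w \<nu>. token_system.pending S (X, s, g(Y := None)) (?tally P w))"
    using token_system.expressible_pending[OF ts0] unfolding token_system.expressible_def[OF ts0] by blast
  let ?\<psi> = "token_system.status_formula S Y Y"
  \<comment> \<open>\<phi>1 expresses acceptance by all rules other than the loading test, \<phi>2
    the part of that test independent of x, and the last conjunct its count; only this conjunct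
    varies.\<close>
  define \<phi> where "\<phi> x = FOr \<phi>1 (FAnd \<phi>2 (exactly x ?\<psi> x))" for x
  have pend: "token_system.pending S (X, s, g(Y \<mapsto> x)) d \<longleftrightarrow>
      token_system.pending S (X, s, g(Y := None)) d \<and> d (Y, Y) = x" for d x
    unfolding token_system.pending_def[OF ts0] prod.case
    using guard_update_iff[of Y "Pow S" g x "\<lambda>Z. d (Z, Z)"] Y by (simp only: Pow_iff conj_assoc)
  have sat: "sat P w \<nu> (\<phi> x) \<longleftrightarrow> token_system.accept S (?R x) W (?tally P w)"
    if P: "token_system.valid P" and w: "w \<in> executions (sact ` S) (eact ` S) P" for P w \<nu> x
  proof -
    let ?d = "?tally P w"
    have "token_system.accept S (?R x) W ?d \<longleftrightarrow>
        token_system.accept S R W ?d \<or> token_system.pending S (X, s, g(Y \<mapsto> x)) ?d"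
      unfolding token_system.accept_def[OF ts] token_system.accept_def[OF ts0] by blast
    then have "token_system.accept S (?R x) W ?d \<longleftrightarrow>
        token_system.accept S R W ?d \<or> token_system.pending S (X, s, g(Y := None)) ?d \<and> ?d (Y, Y) = x"
      unfolding pend .
    moreover have "sat P w \<nu> \<phi>1 \<longleftrightarrow> token_system.accept S R W ?d"
      using \<phi>1 P w unfolding token_system.expresses_def[OF ts0] by blast
    moreover have "sat P w \<nu> \<phi>2 \<longleftrightarrow> token_system.pending S (X, s, g(Y := None)) ?d"
      using \<phi>2 P w unfolding token_system.expresses_def[OF ts0] by blast
    ultimately show ?thesis
      using token_system.sat_exactly_status[OF ts0 P w, of \<nu> x Y Y] by (simp add: \<phi>_def)
  qed
  have models: "models P w (\<phi> x) \<longleftrightarrow> token_system.accept S (?R x) W (?tally P w)"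
    if "token_system.valid P" "w \<in> executions (sact ` S) (eact ` S) P" for P w x
    unfolding models_def using sat[OF that] by simp
  let ?r = "\<lambda>x. (sact ` S, eact ` S, \<phi> x)"
  have closed: "sentence ?A (\<phi> x)" for x
    using \<phi>1 \<phi>2 set_fo_exactly[of x ?\<psi> x] free_vars_exactly[OF token_system.status_formula(2)[OF ts0], of x x Y Y]
      token_system.status_formula(1)[OF ts0, of Y Y]
    unfolding token_system.expresses_def[OF ts0] sentence_def \<phi>_def by auto
  have "?r x \<in> synthesis_instances" for x
    unfolding synthesis_instances_def using closed token_system.finite_S[OF ts0] by auto
  moreover from this have "?r x \<in> synthesis_problem {0} {0} UNIV \<longleftrightarrow> x \<in> halting_set" for x
  proof -
    have "synth_win (sact ` S) (eact ` S) (\<phi> x) \<inter> ({0} \<times> {0} \<times> UNIV) \<noteq> {} \<longleftrightarrow>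
        (\<exists>k. ts_wins (?R x) W k)"
      by (rule token_system.synth_iff[OF ts[of x]]) (rule models)
    then show ?thesis
      using \<open>?r x \<in> synthesis_instances\<close> wins[of x] unfolding synthesis_problem_def by simp
  qed
  moreover have "total_rec (Suc 0) (\<lambda>xs. synthesis_code (?r (xs ! 0)))"
    unfolding synthesis_code.simps \<phi>_def fo_code.simps fo_code_FAnd
    by (intro total_rec_list_encode_Cons total_rec_list_encode_Nil total_rec_and_code total_rec_exactly
        total_rec_const)
  ultimately show False using reduction_from_halting_set[OF dec, of ?r] by blast
qed

theorem theorem4:
  shows "\<not> decidable game_code game_instances (game_problem {0} {0} UNIV) \<and>
         \<not> decidable synthesis_code synthesis_instances (synthesis_problem {0} {0} UNIV)"
  using game_problem_undecidable synthesis_problem_undecidable by blast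

end
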